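(* Let $G$ be a $d$-variate generalized extreme value (GEV) cdf with margins $G_j(x)=\exp\{-(1+\gamma_j\frac{x-\mu_j}{\alpha_j})^{-1/\gamma_j}\}$, with $0<G(\mathbf 0)<1$, and let $H$ be the generalized Pareto (GP) cdf associated to $G$, written $H\leftrightarrow G$. Let $\boldsymbol\gamma=(\gamma_1,\dots,\gamma_d)$ and $\boldsymbol\sigma=\boldsymbol\alpha-\boldsymbol\gamma\boldsymbol\mu$. (i) Let $\emptyset\neq J\subset\{1,\dots,d\}$. If $H_J(\mathbf 0)<1$, then $H_J^+$ is a GP cdf too, with $H_J^+\leftrightarrow G_J$; and if $\sigma_j>0$, then $H_j^+(x)=1-(1+\gamma_j\frac{x}{\sigma_j})^{-1/\gamma_j}$ for $x\ge 0$ such that $\sigma_j+\gamma_jx>0$. Further, $H_J$ is a GP distribution if and only if $H_J(\mathbf 0)=0$. (ii) A scale transformation of $H$, i.e. $\mathbf x\mapsto H(\mathbf x/\mathbf s)$ with $\mathbf s\in(0,\infty)^d$, is also a GP distribution. (iii) Let $\mathbf X\sim H$. If $\boldsymbol\sigma>\mathbf 0$ and $\mathbf u\ge\mathbf 0$ with $H(\mathbf u)<1$, then the conditional distribution of $\mathbf X-\mathbf u$ given that $\mathbf X\nleq\mathbf u$ is a GP distribution with the same shape parameter $\boldsymbol\gamma$ and with $\boldsymbol\sigma$ replaced by $\boldsymbol\sigma+\boldsymbol\gamma\mathbf u$. (iv) If $(H_n)$ is a sequence of GP distributions with all components of the corresponding vectors $\boldsymbol\sigma_n$ bounded away from $0$,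 and if $H_n\to\tilde H$ in distribution, then $\tilde H$ is a GP distribution too. (v) A finite or infinite mixture of GP distributions with the same $\boldsymbol\sigma$ and $\boldsymbol\gamma$ is a GP distribution. (vi) We have $H\leftrightarrow G^t$ for all $t>0$. Conversely, if $H\leftrightarrow G_*$ for some $G_*$ and if $\boldsymbol\sigma>\mathbf 0$, then $G_*=G^{t_1}$ for some $t_1>0$. (vii) If $G(\mathbf 0)=e^{-v}$, then $G(\mathbf x)=\exp\{-v\bar H(\mathbf x)\}$ for $\mathbf x\ge\mathbf 0$, and if $\boldsymbol\sigma>\mathbf 0$ this determines $G$. (viii) If $\boldsymbol\sigma>\mathbf 0$, the scaling and threshold functions in the threshold-stability characterization of GP distributions may be taken as $\mathbf s_t=t^{\boldsymbol\gamma}$ and $\mathbf u_t=\boldsymbol\sigma(t^{\boldsymbol\gamma}-\mathbf 1)/\boldsymbol\gamma$ for $t\ge 1$; that is, with these functions and $\mathbf X\sim H$ one has, for all $t\ge1$ and $\mathbf x\in\mathbb R^d$, $\Pr[\mathbf s_t^{-1}(\mathbf X-\mathbf u_t)\le\mathbf x\mid\mathbf X\nleq\mathbf u_t]=H(\mathbf x)$. (ix) The parameters $\boldsymbol\gamma$ and $\boldsymbol\sigma$ are identifiable from $H$ (they are uniquely determined by $H$).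
   Context: Notation. Bold symbols are $d$-vectors; operations and relations on vectors are componentwise ($\mathbf x\le\mathbf y$ iff $x_j\le y_j$ for all $j$; $\mathbf x\nleq\mathbf y$ is its negation; $\wedge$ is minimum; $t^{\boldsymbol\gamma}=(t^{\gamma_1},\dots,t^{\gamma_d})$). $\bar F=1-F$. For $\gamma=0$, $(x^\gamma-1)/\gamma$ and $(1+\gamma x)^{1/\gamma}$ are read as their limits $\log x$ and $e^x$. GEV distributions. A $d$-variate GEV cdf $G$ is a cdf with non-degenerate margins that is max-stable: for each $t>0$ there are $\mathbf a_t\in(0,\infty)^d$, $\mathbf b_t\in\mathbb R^d$ with $G(\mathbf a_t\mathbf x+\mathbf b_t)^t=G(\mathbf x)$ for all $\mathbf x$. Equivalently it is a possible limit law (with non-degenerate margins) of location-scale normalized componentwise maxima of i.i.d. random vectors. Its margins are $G_j(x)=\exp\{-(1+\gamma_j\frac{x-\mu_j}{\alpha_j})^{-1/\gamma_j}\}$ for $x$ with $\alpha_j+\gamma_j(x-\mu_j)>0$, where $(\gamma_j,\mu_j,\alpha_j)\in\mathbb R\times\mathbb R\times(0,\infty)$. Put $\sigma_j=\alpha_j-\gamma_j\mu_j$. Let $\eta_j\in\mathbb R\cup\{-\infty\}$ be the lower endpoint of $G_j$ (so $\eta_j=-\sigma_j/\gamma_j$ if $\gamma_j>0$ and $\eta_j=-\infty$ otherwise). GP distributions. For a GEV cdf $G$ with $0<G(\mathbf 0)<1$, the associated GP distribution $H$ (a distribution on $[-\infty,\infty)^d$) has cdf $$H(\mathbf x)=\frac{1}{\log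 G(\mathbf 0)}\log\left(\frac{G(\mathbf x\wedge\mathbf 0)}{G(\mathbf x)}\right)\ \text{ if }\mathbf x>\boldsymbol\eta,\qquad H(\mathbf x)=0\ \text{ if }x_j<\eta_j\text{ for some }j,$$ and for $\mathbf x\ge\boldsymbol\eta$ with some $x_j=\eta_j$ the value is determined by right-continuity. One writes $H\leftrightarrow G$, and calls $\boldsymbol\gamma$ (shape) and $\boldsymbol\sigma$ the parameters of $H$. A GP distribution is a distribution $H$ associated to some such $G$ (in the appropriate dimension). Margins. For non-empty $J\subset\{1,\dots,d\}$, $H_J$ and $G_J$ are the $|J|$-variate marginal cdfs of $H$ and $G$. If $H_J(\mathbf 0)<1$, $H_J^+(\mathbf x)=\{H_J(\mathbf x)-H_J(\mathbf x\wedge\mathbf 0)\}/\bar H_J(\mathbf 0)$ is $H_J$ conditioned to have at least one positive component; $H_j^+=H_{\{j\}}^+$. Threshold-stability characterization: the class of GP distributions $H$ with $H_j(0)<1$ for all $j$ is characterized by existence of continuous functions $\mathbf s_t\in(0,\infty)^d$ and $\mathbf u_t\in\mathbb R^d$, $\mathbf u_t$ increasing in $t$, with $\mathbf u_1=\mathbf 0$, $H(\mathbf u_t)\to1$ as $t\to\infty$, and, for $\mathbf X\sim H$, $\Pr[\mathbf s_t^{-1}(\mathbf X-\mathbf u_t)\le\mathbf x\mid\mathbf X\nleq\mathbf u_t]=H(\mathbf x)$.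
   Formalization: Mended where false as stated: (iv) takes σ_n ≥ c > 0 and assumes each margin of the limit is non-degenerate on the real line or entirely at −∞; (v) assumes σ > 0 for infinite mixtures; (ix) identifies γ_j, σ_j only for components j with P(X_j = −∞) < 1. *)

theory Defs
  imports "HOL-Probability.Probability"
begin

text \<open>
  A vector with components indexed by a finite set \<open>I\<close> is a function on the index type of which only the
  values on \<open>I\<close> matter; the cdfs below are functions of such vectors. Using index sets rather than
  index types lets the margins for subsets of \<open>I\<close> be handled by the same definitions.
\<close>

text \<open>The random vector \<open>(X j)\<^sub>j\<close>, with values in \<open>[-\<infinity>,\<infinity>)\<close> in each component, has cdf \<open>F\<close>.
  Such a distribution is determined by the values of its cdf at real vectors.\<close>

definition has_cdf ::
  "'w measure \<Rightarrow> 'i set \<Rightarrow> ('i \<Rightarrow> 'w \<Rightarrow> ereal) \<Rightarrow> (('i \<Rightarrow> real) \<Rightarrow> real) \<Rightarrow> bool" where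
  "has_cdf P I X F \<longleftrightarrow>
     prob_space P \<and>
     (\<forall>j\<in>I. X j \<in> borel_measurable P) \<and>
     (\<forall>j\<in>I. AE \<omega> in P. X j \<omega> < \<infinity>) \<and>
     (\<forall>x. \<P>(\<omega> in P. \<forall>j\<in>I. X j \<omega> \<le> ereal (x j)) = F x)"

definition real_cdf :: "'i set \<Rightarrow> (('i \<Rightarrow> real) \<Rightarrow> real) \<Rightarrow> bool" where
  "real_cdf I F \<longleftrightarrow>
     (\<exists>M :: ('i \<Rightarrow> real) measure. sets M = sets (Pi\<^sub>M I (\<lambda>_. borel)) \<and>
        has_cdf M I (\<lambda>j \<omega>. ereal (\<omega> j)) F)"

definition ext_cdf :: "'i set \<Rightarrow> (('i \<Rightarrow> real) \<Rightarrow> real) \<Rightarrow> bool" where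
  "ext_cdf I F \<longleftrightarrow>
     (\<exists>M :: ('i \<Rightarrow> ereal) measure. sets M = sets (Pi\<^sub>M I (\<lambda>_. borel)) \<and>
        has_cdf M I (\<lambda>j \<omega>. \<omega> j) F)"

text \<open>The marginal cdf: the arguments outside \<open>J\<close> are sent to \<open>\<infinity>\<close>.\<close>

definition margin :: "'i set \<Rightarrow> (('i \<Rightarrow> real) \<Rightarrow> real) \<Rightarrow> ('i \<Rightarrow> real) \<Rightarrow> real" where
  "margin J F x = Lim at_top (\<lambda>t. F (\<lambda>i. if i \<in> J then x i else t))"

definition margin1 :: "(('i \<Rightarrow> real) \<Rightarrow> real) \<Rightarrow> 'i \<Rightarrow> real \<Rightarrow> real" where
  "margin1 F j y = margin {j} F (\<lambda>_. y)"

text \<open>For the cdf of a distribution on \<open>[-\<infinity>,\<infinity>)\<close>: its restriction to the real line is not a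
  (possibly zero) multiple of a point mass. For a distribution on the real line this says that the
  distribution is not a point mass.\<close>

definition nondegenerate :: "(real \<Rightarrow> real) \<Rightarrow> bool" where
  "nondegenerate F \<longleftrightarrow> (\<exists>x y. x < y \<and> F x < F y \<and> F y < 1)"

definition lower_endpoint :: "(real \<Rightarrow> real) \<Rightarrow> ereal" where
  "lower_endpoint F = Inf (ereal ` {x. 0 < F x})"

definition max_stable :: "'i set \<Rightarrow> (('i \<Rightarrow> real) \<Rightarrow> real) \<Rightarrow> bool" where
  "max_stable I G \<longleftrightarrow>
     (\<forall>t>0. \<exists>a b. (\<forall>j\<in>I. 0 < a j) \<and> (\<forall>x. G (\<lambda>j. a j * x j + b j) powr t = G x))"

definition gev_cdf :: "'i set \<Rightarrow> (('i \<Rightarrow> real) \<Rightarrow> real) \<Rightarrow> bool" where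
  "gev_cdf I G \<longleftrightarrow>
     finite I \<and> I \<noteq> {} \<and> real_cdf I G \<and> (\<forall>j\<in>I. nondegenerate (margin1 G j)) \<and> max_stable I G"

text \<open>\<open>(1 + \<gamma> z)\<^sup>-\<^sup>1\<^sup>/\<^sup>\<gamma>\<close> for \<open>1 + \<gamma> z > 0\<close>.\<close>

definition gp_tail :: "real \<Rightarrow> real \<Rightarrow> real" where
  "gp_tail \<gamma> z = (if \<gamma> = 0 then exp (- z) else (1 + \<gamma> * z) powr (- 1 / \<gamma>))"

text \<open>\<open>(t\<^sup>\<gamma> - 1) / \<gamma>\<close> for \<open>t > 0\<close>.\<close>

definition box_cox :: "real \<Rightarrow> real \<Rightarrow> real" where
  "box_cox \<gamma> t = (if \<gamma> = 0 then ln t else (t powr \<gamma> - 1) / \<gamma>)"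

definition gev_margins ::
  "'i set \<Rightarrow> (('i \<Rightarrow> real) \<Rightarrow> real) \<Rightarrow> ('i \<Rightarrow> real) \<Rightarrow> ('i \<Rightarrow> real) \<Rightarrow> ('i \<Rightarrow> real) \<Rightarrow> bool" where
  "gev_margins I G \<gamma> \<mu> \<alpha> \<longleftrightarrow>
     (\<forall>j\<in>I. 0 < \<alpha> j \<and>
        (\<forall>x. 0 < \<alpha> j + \<gamma> j * (x - \<mu> j) \<longrightarrow>
             margin1 G j x = exp (- gp_tail (\<gamma> j) ((x - \<mu> j) / \<alpha> j))))"

text \<open>The relation between a GP cdf \<open>H\<close> and a GEV cdf \<open>G\<close>. Values of \<open>H\<close> at vectors having some
  component equal to a lower endpoint are determined by \<open>ext_cdf\<close>, since cdfs are right-continuous.\<close>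

definition gp_assoc ::
  "'i set \<Rightarrow> (('i \<Rightarrow> real) \<Rightarrow> real) \<Rightarrow> (('i \<Rightarrow> real) \<Rightarrow> real) \<Rightarrow> bool" where
  "gp_assoc I H G \<longleftrightarrow>
     gev_cdf I G \<and> 0 < G (\<lambda>_. 0) \<and> G (\<lambda>_. 0) < 1 \<and> ext_cdf I H \<and>
     (\<forall>x. (\<forall>j\<in>I. lower_endpoint (margin1 G j) < ereal (x j)) \<longrightarrow>
          H x = 1 / ln (G (\<lambda>_. 0)) * ln (G (\<lambda>j. min (x j) 0) / G x)) \<and>
     (\<forall>x. (\<exists>j\<in>I. ereal (x j) < lower_endpoint (margin1 G j)) \<longrightarrow> H x = 0)"

definition gp_cdf :: "'i set \<Rightarrow> (('i \<Rightarrow> real) \<Rightarrow> real) \<Rightarrow> bool" where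
  "gp_cdf I H \<longleftrightarrow> (\<exists>G. gp_assoc I H G)"

definition gp_params ::
  "'i set \<Rightarrow> (('i \<Rightarrow> real) \<Rightarrow> real) \<Rightarrow> ('i \<Rightarrow> real) \<Rightarrow> ('i \<Rightarrow> real) \<Rightarrow> bool" where
  "gp_params I H \<gamma> \<sigma> \<longleftrightarrow>
     (\<exists>G \<mu> \<alpha>. gp_assoc I H G \<and> gev_margins I G \<gamma> \<mu> \<alpha> \<and> (\<forall>j\<in>I. \<sigma> j = \<alpha> j - \<gamma> j * \<mu> j))"

text \<open>The cdf of \<open>F\<close> conditioned to have at least one positive component, if \<open>F 0 < 1\<close>.\<close>

definition pos_cond :: "(('i \<Rightarrow> real) \<Rightarrow> real) \<Rightarrow> ('i \<Rightarrow> real) \<Rightarrow> real" where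
  "pos_cond F x = (F x - F (\<lambda>j. min (x j) 0)) / (1 - F (\<lambda>_. 0))"

text \<open>Convergence in distribution, in terms of cdfs as in \<^const>\<open>weak_conv\<close>. On \<open>[-\<infinity>,\<infinity>)\<close>-valued
  vectors it suffices to consider real continuity points, because these are dense.\<close>

definition conv_in_dist ::
  "(nat \<Rightarrow> ('i \<Rightarrow> real) \<Rightarrow> real) \<Rightarrow> (('i \<Rightarrow> real) \<Rightarrow> real) \<Rightarrow> bool" where
  "conv_in_dist F L \<longleftrightarrow> (\<forall>x. (L \<longlongrightarrow> L x) (nhds x) \<longrightarrow> (\<lambda>n. F n x) \<longlonglongrightarrow> L x)"

end

theory Submission
  imports Defs
begin

text \<open>
  Put \<open>V = - ln G\<close>. Max-stability together with the form of the margins forces the normalizing maps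
  to be the flow \<open>x \<mapsto> t powr \<gamma> * x + \<sigma> * box_cox \<gamma> t\<close>, and \<open>V\<close> is divided by \<open>t\<close> along this flow. As
  \<open>H x = (V (min x 0) - V x) / V 0\<close>, the cdf \<open>H\<close> is threshold-stable, and parts (i)--(iii) and (vi)--(viii)
  become computations with \<open>V\<close>.

  Conversely, if \<open>\<sigma> > 0\<close>, then a threshold-stable \<open>H\<close> determines \<open>V\<close>, since \<open>V x = t * (1 - H (flow t x))\<close> as soon
  as \<open>flow t x \<ge> 0\<close>. On the set of these \<open>x\<close>, \<open>exp (- V)\<close> is the cdf of the rescaled maximum of a Poisson number
  of independent vectors with cdf \<open>H\<close>, and letting \<open>t \<rightarrow> \<infinity>\<close> one finds that \<open>exp (- V)\<close> is a cdf. This yields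
  part (v), because threshold stability is linear in \<open>H\<close>, and part (iv), because threshold stability bounds the
  oscillation of the tails of \<open>H\<close> in terms of \<open>\<gamma>\<close> and \<open>\<sigma>\<close>, which keeps these parameters in a compact set
  when the limit is non-degenerate.

  In part (ix) the parameters with \<open>\<sigma> j > 0\<close> are read off from \<open>flow t 0\<close>, a quantile of the margin. If
  \<open>\<sigma> j \<le> 0\<close>, then \<open>H\<close> still shows the upper endpoint \<open>- \<sigma> j / \<gamma> j\<close>, and \<open>\<gamma> j\<close> is the rate at which
  the flow of component \<open>j\<close> contracts towards it while another component exceeds a high threshold.
\<close>

section \<open>Distribution functions of random vectors\<close>

text \<open>Two features shape the proof. If \<open>\<sigma> j \<le> 0\<close>, then
  \<open>\<gamma> j < 0\<close> and component \<open>j\<close> almost surely does not exceed 0 under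
  \<open>H\<close>, so the nonnegative orthant says nothing about it. Identifiability then has to
  use exceedances of other components, and finite mixtures are built from products of powers of the
  cdfs \<open>G\<close> rather than by reconstruction from \<open>H\<close>. Secondly,
  \<open>V\<close> is recovered only on regions that grow with \<open>t\<close>, and each Poisson
  maximum has an explicit cdf that vanishes off such a region. A limit law is obtained not from
  compactness but from consistency: restricted to the regions, these laws form an increasing
  sequence of measures. In the limit theorem the cdfs converge only off a countable set, while
  threshold stability evaluates them at points that move with \<open>n\<close>. Continuity of the
  limiting margins on the positive half-line repairs this, and so the reconstruction asks for
  threshold stability only where the flow has reached the positive orthant. Components that become
  -\<infinity> almost surely are split off and reattached as independent components of
  \<open>G\<close>.\<close>

lemma margin_cong:
  assumes "\<And>j. j \<in> J \<Longrightarrow> x j = y j"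
  shows "margin J F x = margin J F y"
proof -
  have "(\<lambda>i. if i \<in> J then x i else t) = (\<lambda>i. if i \<in> J then y i else t)" for t
    using assms by auto
  then show ?thesis by (simp add: margin_def)
qed

section \<open>Real sequences that stand for an extended coordinate of a corner\<close>

text \<open>Every fixed value below \<infinity> eventually lies on the same side of
  \<open>s n\<close> as of \<open>a\<close>. This is what makes the indicators of quadrants with
  corners \<open>s n\<close> converge at each outcome, and it covers constants, limits from the
  right and both infinite limits; a limit strictly from the left would fail at \<open>z = a\<close>.
  The value \<infinity> is left out because components take it with probability 0.\<close>

definition approximates :: "(nat \<Rightarrow> real) \<Rightarrow> ereal \<Rightarrow> bool" where
  "approximates s a \<longleftrightarrow> (\<forall>z<\<infinity>. \<forall>\<^sub>F n in sequentially. z \<le> ereal (s n) \<longleftrightarrow> z \<le> a)"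

lemma approximates_const: "approximates (\<lambda>_. x) (ereal x)"
  by (simp add: approximates_def)

lemma approximates_top:
  assumes "filterlim s at_top sequentially"
  shows "approximates s \<infinity>"
  unfolding approximates_def
proof (intro allI impI)
  fix z :: ereal
  assume z: "z < \<infinity>"
  show "\<forall>\<^sub>F n in sequentially. z \<le> ereal (s n) \<longleftrightarrow> z \<le> \<infinity>"
  proof (cases z)
    case (real r)
    then show ?thesis
      using assms by (auto simp: filterlim_at_top)
  qed (use z in auto)
qed

lemma approximates_bot:
  assumes "filterlim s at_bot sequentially"
  shows "approximates s (-\<infinity>)"
  unfolding approximates_def
proof (intro allI impI)
  fix z :: ereal
  assume z: "z < \<infinity>"
  show "\<forall>\<^sub>F n in sequentially. z \<le> ereal (s n) \<longleftrightarrow> z \<le> -\<infinity>"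
  proof (cases z)
    case (real r)
    then show ?thesis
      using assms by (auto simp: filterlim_at_bot_dense not_le)
  qed (use z in auto)
qed

lemma approximates_right:
  assumes "s \<longlonglongrightarrow> x" "\<And>n. x \<le> s n"
  shows "approximates s (ereal x)"
  unfolding approximates_def
proof (intro allI impI)
  fix z :: ereal
  assume z: "z < \<infinity>"
  show "\<forall>\<^sub>F n in sequentially. z \<le> ereal (s n) \<longleftrightarrow> z \<le> ereal x"
  proof (cases z)
    case (real r)
    show ?thesis
    proof (cases "r \<le> x")
      case True
      then have "z \<le> ereal (s n)" for n
        using assms(2)[of n] real by simp
      then show ?thesis
        using True real by simp
    next
      case False
      then show ?thesis
        using order_tendstoD(2)[OF assms(1), of r] real by (auto elim!: eventually_mono)
    qed
  qed (use z in auto)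
qed

locale cdf_of =
  fixes P :: "'w measure" and I :: "'i set" and X :: "'i \<Rightarrow> 'w \<Rightarrow> ereal"
    and F :: "('i \<Rightarrow> real) \<Rightarrow> real"
  assumes has_cdf: "has_cdf P I X F" and finite_index: "finite I"
begin

sublocale prob_space P
  using has_cdf by (simp add: has_cdf_def)

lemma component_measurable [measurable (raw)]: "j \<in> I \<Longrightarrow> X j \<in> borel_measurable P"
  using has_cdf by (simp add: has_cdf_def)

text \<open>Corners are extended: a coordinate \<infinity> drops the component, which turns margins
  into probabilities of quadrants, and a coordinate -\<infinity> detects mass at the bottom.\<close>

definition quadrant :: "('i \<Rightarrow> ereal) \<Rightarrow> 'w set" where
  "quadrant a = {\<omega> \<in> space P. \<forall>j\<in>I. X j \<omega> \<le> a j}"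

lemma quadrant_measurable [measurable]: "quadrant a \<in> events"
proof -
  have "Measurable.pred P (\<lambda>\<omega>. \<forall>j\<in>I. X j \<omega> \<le> a j)"
    using finite_index by measurable
  then show ?thesis
    by (simp add: quadrant_def pred_def)
qed

lemma cdf_eq: "F x = prob (quadrant (\<lambda>j. ereal (x j)))"
  using has_cdf by (simp add: has_cdf_def quadrant_def)

lemma AE_less_infinity: "AE \<omega> in P. \<forall>j\<in>I. X j \<omega> < \<infinity>"
  using has_cdf finite_index by (subst AE_finite_all) (auto simp: has_cdf_def)

lemma cdf_tendsto:
  assumes "\<And>j. j \<in> I \<Longrightarrow> approximates (\<lambda>n. y n j) (a j)"
  shows "(\<lambda>n. F (y n)) \<longlonglongrightarrow> prob (quadrant a)"
proof -
  have "(\<lambda>n. \<integral>\<omega>. indicator (quadrant (\<lambda>j. ereal (y n j))) \<omega> \<partial>P)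
      \<longlonglongrightarrow> (\<integral>\<omega>. (indicator (quadrant a) \<omega> :: real) \<partial>P)"
  proof (rule integral_dominated_convergence[where w="\<lambda>_. 1"])
    show "AE \<omega> in P. (\<lambda>n. indicat_real (quadrant (\<lambda>j. ereal (y n j))) \<omega>) \<longlonglongrightarrow> indicator (quadrant a) \<omega>"
      using AE_less_infinity
    proof (eventually_elim)
      case (elim \<omega>)
      then have "\<forall>\<^sub>F n in sequentially. \<forall>j\<in>I. X j \<omega> \<le> ereal (y n j) \<longleftrightarrow> X j \<omega> \<le> a j"
        using assms finite_index by (intro eventually_ball_finite) (auto simp: approximates_def)
      then have "\<forall>\<^sub>F n in sequentially. indicat_real (quadrant (\<lambda>j. ereal (y n j))) \<omega> = indicator (quadrant a) \<omega>"
        by eventually_elim (auto simp: quadrant_def indicator_def)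
      then show ?case
        by (rule tendsto_eventually)
    qed
  qed auto
  then show ?thesis
    by (simp add: cdf_eq)
qed

lemma cdf_nonneg: "0 \<le> F x" and cdf_le_1: "F x \<le> 1"
  by (simp_all add: cdf_eq)

lemma cdf_mono: "(\<And>j. j \<in> I \<Longrightarrow> x j \<le> y j) \<Longrightarrow> F x \<le> F y"
  unfolding cdf_eq
  by (rule finite_measure_mono[OF _ quadrant_measurable]) (force simp: quadrant_def intro: order_trans)

lemma cdf_cong: "(\<And>j. j \<in> I \<Longrightarrow> x j = y j) \<Longrightarrow> F x = F y"
  by (intro antisym cdf_mono) auto

lemma margin_eq_quadrant:
  assumes "J \<subseteq> I"
  shows "margin J F x = prob (quadrant (\<lambda>j. if j \<in> J then ereal (x j) else \<infinity>))"
proof -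
  have "((\<lambda>t. F (\<lambda>i. if i \<in> J then x i else t)) \<longlongrightarrow>
      prob (quadrant (\<lambda>j. if j \<in> J then ereal (x j) else \<infinity>))) at_top"
  proof (rule tendsto_at_topI_sequentially, rule cdf_tendsto)
    fix s :: "nat \<Rightarrow> real" and j
    assume "filterlim s at_top sequentially"
    then show "approximates (\<lambda>n. if j \<in> J then x j else s n) (if j \<in> J then ereal (x j) else \<infinity>)"
      by (auto simp: approximates_const approximates_top)
  qed
  then show ?thesis
    unfolding margin_def by (intro tendsto_Lim) auto
qed

lemma margin_eq:
  "J \<subseteq> I \<Longrightarrow> margin J F x = \<P>(\<omega> in P. \<forall>j\<in>J. X j \<omega> \<le> ereal (x j))"
  unfolding margin_eq_quadrant quadrant_def by (rule arg_cong[where f=prob]) auto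

lemma has_cdf_margin: "J \<subseteq> I \<Longrightarrow> has_cdf P J X (margin J F)"
  using has_cdf by (auto simp: has_cdf_def margin_eq)

lemma margin_full: "margin I F = F"
  by (rule ext) (simp add: margin_eq cdf_eq quadrant_def)

lemma margin_margin:
  assumes "K \<subseteq> J" "J \<subseteq> I"
  shows "margin K (margin J F) = margin K F"
proof -
  interpret J: cdf_of P J X "margin J F"
    using assms has_cdf_margin finite_index by unfold_locales (auto intro: finite_subset)
  show ?thesis
    using assms by (intro ext) (simp add: margin_eq J.margin_eq)
qed

lemma margin_tendsto:
  assumes "J \<subseteq> I" and "\<And>j. j \<in> J \<Longrightarrow> approximates (\<lambda>n. y n j) (ereal (x j))"
    and "\<And>j. j \<in> I - J \<Longrightarrow> filterlim (\<lambda>n. y n j) at_top sequentially"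
  shows "(\<lambda>n. F (y n)) \<longlonglongrightarrow> margin J F x"
  unfolding margin_eq_quadrant[OF assms(1)] using assms by (intro cdf_tendsto) (auto simp: approximates_top)

lemma margin_tendsto_real:
  "J \<subseteq> I \<Longrightarrow> (\<lambda>n. F (\<lambda>j. if j \<in> J then x j else real n)) \<longlonglongrightarrow> margin J F x"
  by (intro margin_tendsto) (auto simp: approximates_const filterlim_real_sequentially)

lemma margin1_tendsto_real:
  "j \<in> I \<Longrightarrow> (\<lambda>n. F (\<lambda>i. if i = j then y else real n)) \<longlonglongrightarrow> margin1 F j y"
  unfolding margin1_def
  by (intro margin_tendsto) (auto simp: approximates_const filterlim_real_sequentially)

lemma cdf_right_continuous:
  assumes "\<And>j. j \<in> I \<Longrightarrow> (\<lambda>n. y n j) \<longlonglongrightarrow> x j" "\<And>n j. j \<in> I \<Longrightarrow> x j \<le> y n j"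
  shows "(\<lambda>n. F (y n)) \<longlonglongrightarrow> F x"
  unfolding cdf_eq[of x] using assms by (intro cdf_tendsto) (auto simp: approximates_right)

lemma margin1_eq: "j \<in> I \<Longrightarrow> margin1 F j y = \<P>(\<omega> in P. X j \<omega> \<le> ereal y)"
  unfolding margin1_def by (subst margin_eq) auto

lemma margin1_margin: "j \<in> J \<Longrightarrow> J \<subseteq> I \<Longrightarrow> margin1 (margin J F) j = margin1 F j"
  unfolding margin1_def by (subst margin_margin) auto

lemma margin_singleton: "margin {j} F x = margin1 F j (x j)"
proof -
  have "(\<lambda>i. if i \<in> {j} then x i else t) = (\<lambda>i. if i \<in> {j} then x j else t)" for t
    by auto
  then show ?thesis
    by (simp add: margin1_def margin_def)
qed

lemma margin1_nonneg: "j \<in> I \<Longrightarrow> 0 \<le> margin1 F j y"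
  and margin1_le_1: "j \<in> I \<Longrightarrow> margin1 F j y \<le> 1"
  by (simp_all add: margin1_eq)

lemma margin1_mono: "j \<in> I \<Longrightarrow> y \<le> z \<Longrightarrow> margin1 F j y \<le> margin1 F j z"
  unfolding margin1_eq by (intro finite_measure_mono) (auto intro: order_trans)

lemma cdf_le_margin: "J \<subseteq> I \<Longrightarrow> F x \<le> margin J F x"
  unfolding margin_eq_quadrant cdf_eq
  by (rule finite_measure_mono[OF _ quadrant_measurable]) (auto simp: quadrant_def)

lemma cdf_le_margin1: "j \<in> I \<Longrightarrow> F x \<le> margin1 F j (x j)"
  unfolding margin1_eq cdf_eq by (intro finite_measure_mono) (auto simp: quadrant_def)

lemma margin1_right_continuous:
  assumes "j \<in> I" "s \<longlonglongrightarrow> x" "\<And>n. x \<le> s n"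
  shows "(\<lambda>n. margin1 F j (s n)) \<longlonglongrightarrow> margin1 F j x"
proof -
  interpret J: cdf_of P "{j}" X "margin {j} F"
    using assms has_cdf_margin finite_index by unfold_locales auto
  show ?thesis
    using J.cdf_right_continuous[of "\<lambda>n _. s n" "\<lambda>_. x"] assms by (simp add: margin1_def)
qed

lemma margin1_at_top: 
  assumes "j \<in> I" shows "((\<lambda>y. margin1 F j y) \<longlongrightarrow> 1) at_top"
proof -
  interpret J: cdf_of P "{j}" X "margin {j} F"
    using assms has_cdf_margin finite_index by unfold_locales auto
  show ?thesis
  proof (rule tendsto_at_topI_sequentially)
    fix s :: "nat \<Rightarrow> real" assume "filterlim s at_top sequentially"
    then have "(\<lambda>n. margin {j} F (\<lambda>_. s n)) \<longlonglongrightarrow> prob (J.quadrant (\<lambda>_. \<infinity>))"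
      by (intro J.cdf_tendsto approximates_top)
    then show "(\<lambda>n. margin1 F j (s n)) \<longlonglongrightarrow> 1"
      by (simp add: margin1_def J.quadrant_def prob_space)
  qed
qed

text \<open>The event that \<open>X \<le> x\<close> but not \<open>X \<le> y\<close> is covered by
  the events \<open>y j < X j \<le> x j\<close>. From this bound come both the continuity of
  \<open>F\<close> where its margins are continuous and the tail estimates.\<close>

lemma cdf_diff_le: "F x - F y \<le> (\<Sum>j\<in>I. max 0 (margin1 F j (x j) - margin1 F j (y j)))"
proof -
  let ?Q = "\<lambda>x. quadrant (\<lambda>j. ereal (x j))"
  let ?D = "\<lambda>j. {\<omega>\<in>space P. X j \<omega> \<le> ereal (x j)} - {\<omega>\<in>space P. X j \<omega> \<le> ereal (y j)}"
  have "F x - F y \<le> prob (?Q x - ?Q y)"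
  proof -
    have "prob (?Q x) \<le> prob ((?Q x - ?Q y) \<union> ?Q y)"
      by (intro finite_measure_mono) auto
    also have "\<dots> \<le> prob (?Q x - ?Q y) + prob (?Q y)"
      by (intro measure_Un_le) auto
    finally show ?thesis by (simp add: cdf_eq)
  qed
  also have "\<dots> \<le> prob (\<Union>j\<in>I. ?D j)"
  proof (rule finite_measure_mono)
    show "(\<Union>j\<in>I. ?D j) \<in> events"
      using finite_index by (intro sets.finite_UN) measurable
  qed (auto simp: quadrant_def)
  also have "\<dots> \<le> (\<Sum>j\<in>I. prob (?D j))"
    using finite_index by (intro finite_measure_subadditive_finite) auto
  also have "\<dots> \<le> (\<Sum>j\<in>I. max 0 (margin1 F j (x j) - margin1 F j (y j)))"
  proof (rule sum_mono)
    fix j assume j: "j \<in> I"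
    show "prob (?D j) \<le> max 0 (margin1 F j (x j) - margin1 F j (y j))"
    proof (cases "y j \<le> x j")
      case True
      then have "prob (?D j) = margin1 F j (x j) - margin1 F j (y j)"
        unfolding margin1_eq[OF j] using j by (intro finite_measure_Diff) (auto intro: order_trans)
      then show ?thesis by simp
    next
      case False
      then have "?D j = {}" by (auto, meson dual_order.trans ereal_less_eq(3) linorder_le_cases)
      then show ?thesis by (simp only: measure_empty max.cobounded1)
    qed
  qed
  finally show ?thesis .
qed

lemma cdf_lipschitz: "\<bar>F x - F y\<bar> \<le> (\<Sum>j\<in>I. \<bar>margin1 F j (x j) - margin1 F j (y j)\<bar>)"
proof -
  have "(\<Sum>j\<in>I. max 0 (margin1 F j (x j) - margin1 F j (y j))) \<le> (\<Sum>j\<in>I. \<bar>margin1 F j (x j) - margin1 F j (y j)\<bar>)" for x y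
    by (intro sum_mono) auto
  from order_trans[OF cdf_diff_le this, of x y] order_trans[OF cdf_diff_le this, of y x]
  show ?thesis by (simp add: abs_minus_commute abs_le_iff)
qed

text \<open>Raising one coordinate outside \<open>J\<close> to \<infinity> changes \<open>F\<close>
  by at most the tail of that component.\<close>

lemma margin_diff_le:
  assumes "J \<subseteq> I"
  shows "margin J F x - F x \<le> (\<Sum>j\<in>I - J. 1 - margin1 F j (x j))"
proof -
  let ?y = "\<lambda>n j. if j \<in> J then x j else max (x j) (real n)"
  have "(\<lambda>n. F (?y n)) \<longlonglongrightarrow> margin J F x"
  proof (rule margin_tendsto[OF assms])
    fix j assume "j \<in> I - J"
    then show "filterlim (\<lambda>n. ?y n j) at_top sequentially"
      by (auto intro!: filterlim_at_top_mono[OF filterlim_real_sequentially])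
  qed (simp add: approximates_const)
  then have "(\<lambda>n. F (?y n) - F x) \<longlonglongrightarrow> margin J F x - F x"
    by (intro tendsto_intros)
  moreover have "F (?y n) - F x \<le> (\<Sum>j\<in>I - J. 1 - margin1 F j (x j))" for n
  proof -
    have "F (?y n) - F x \<le> (\<Sum>j\<in>I. max 0 (margin1 F j (?y n j) - margin1 F j (x j)))"
      by (rule cdf_diff_le)
    also have "\<dots> = (\<Sum>j\<in>I - J. max 0 (margin1 F j (?y n j) - margin1 F j (x j)))"
      using finite_index by (intro sum.mono_neutral_right) auto
    also have "\<dots> \<le> (\<Sum>j\<in>I - J. 1 - margin1 F j (x j))"
      using margin1_le_1 by (intro sum_mono) auto
    finally show ?thesis .
  qed
  ultimately show ?thesis
    by (intro LIMSEQ_le_const2) auto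
qed

lemma one_minus_cdf_le: "1 - F x \<le> (\<Sum>j\<in>I. 1 - margin1 F j (x j))"
  using margin_diff_le[of "{}" x] by (simp add: margin_eq prob_space)

end

section \<open>Transfer of a cdf to the standard spaces of extended and real vectors\<close>

text \<open>The image of \<open>P\<close> under the restricted vector has the same cdf. Hence a cdf
  may be constructed on whatever space is convenient: a product, a conditioned measure, a supremum
  of measures.\<close>

lemma has_cdf_imp_ext_cdf:
  assumes "has_cdf P I X F" "finite I"
  shows "ext_cdf I F"
proof -
  interpret cdf_of P I X F
    using assms by unfold_locales
  let ?f = "\<lambda>\<omega>. \<lambda>j\<in>I. X j \<omega>"
  let ?M = "distr P (Pi\<^sub>M I (\<lambda>_. borel)) ?f"
  have f [measurable]: "?f \<in> P \<rightarrow>\<^sub>M Pi\<^sub>M I (\<lambda>_. borel)"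
    by (intro measurable_restrict) simp
  have "has_cdf ?M I (\<lambda>j \<omega>. \<omega> j) F"
    unfolding has_cdf_def
  proof (intro conjI ballI allI)
    show "prob_space ?M"
      by (rule prob_space_distr) measurable
    show "AE \<omega> in ?M. \<omega> j < \<infinity>" if "j \<in> I" for j
    proof (subst AE_distr_iff)
      show "AE \<omega> in P. ?f \<omega> j < \<infinity>"
        using AE_less_infinity that by (auto elim!: eventually_mono)
    qed (use that in \<open>auto\<close>)
    show "\<P>(\<omega> in ?M. \<forall>j\<in>I. \<omega> j \<le> ereal (x j)) = F x" for x
    proof (subst measure_distr)
      show "{\<omega> \<in> space ?M. \<forall>j\<in>I. \<omega> j \<le> ereal (x j)} \<in> sets (Pi\<^sub>M I (\<lambda>_. borel))"
        using finite_index by simp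
      have "?f -` {\<omega> \<in> space ?M. \<forall>j\<in>I. \<omega> j \<le> ereal (x j)} \<inter> space P = quadrant (\<lambda>j. ereal (x j))"
        using measurable_space[OF f] by (auto simp: quadrant_def)
      then show "prob (?f -` {\<omega> \<in> space ?M. \<forall>j\<in>I. \<omega> j \<le> ereal (x j)} \<inter> space P) = F x"
        by (simp add: cdf_eq)
    qed measurable
  qed auto
  then show ?thesis
    unfolding ext_cdf_def by (intro exI[of _ ?M]) auto
qed

definition cdf_measure :: "'i set \<Rightarrow> (('i \<Rightarrow> real) \<Rightarrow> real) \<Rightarrow> ('i \<Rightarrow> ereal) measure" where
  "cdf_measure I F = (SOME M. sets M = sets (Pi\<^sub>M I (\<lambda>_. borel)) \<and> has_cdf M I (\<lambda>j \<omega>. \<omega> j) F)"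

locale vec_cdf =
  fixes I :: "'i set" and F :: "('i \<Rightarrow> real) \<Rightarrow> real"
  assumes ext_cdf: "ext_cdf I F" and finite_I: "finite I"
begin

lemma cdf_measure_props:
  "sets (cdf_measure I F) = sets (Pi\<^sub>M I (\<lambda>_. borel))" "has_cdf (cdf_measure I F) I (\<lambda>j \<omega>. \<omega> j) F"
  using someI_ex[OF ext_cdf[unfolded ext_cdf_def]] by (auto simp: cdf_measure_def)

sublocale cdf_of "cdf_measure I F" I "\<lambda>j \<omega>. \<omega> j" F
  using finite_I cdf_measure_props by unfold_locales

lemma ext_cdf_margin: "J \<subseteq> I \<Longrightarrow> ext_cdf J (margin J F)"
  using has_cdf_imp_ext_cdf[OF has_cdf_margin] finite_subset finite_I by auto

end

lemma real_cdf_imp_ext_cdf: "real_cdf I F \<Longrightarrow> finite I \<Longrightarrow> ext_cdf I F"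
  unfolding real_cdf_def by (auto intro: has_cdf_imp_ext_cdf)

lemma real_cdf_margin1_at_bot:
  assumes "real_cdf I F" "finite I" "j \<in> I" "filterlim s at_bot sequentially"
  shows "(\<lambda>n. margin1 F j (s n)) \<longlonglongrightarrow> 0"
proof -
  obtain M where "has_cdf M I (\<lambda>j \<omega>. ereal (\<omega> j)) F"
    using assms by (auto simp: real_cdf_def)
  then interpret cdf_of M I "\<lambda>j \<omega>. ereal (\<omega> j)" F
    using assms by unfold_locales
  interpret J: cdf_of M "{j}" "\<lambda>j \<omega>. ereal (\<omega> j)" "margin {j} F"
    using assms has_cdf_margin by unfold_locales auto
  have "(\<lambda>n. margin {j} F (\<lambda>_. s n)) \<longlonglongrightarrow> prob (J.quadrant (\<lambda>_. -\<infinity>))"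
    using assms by (intro J.cdf_tendsto approximates_bot)
  also have "J.quadrant (\<lambda>_. -\<infinity>) = {}"
    by (auto simp: J.quadrant_def)
  finally show ?thesis
    by (simp add: margin1_def)
qed

text \<open>A component takes the value -\<infinity> with a probability below every
  \<open>margin1 F j (- real n)\<close>, so margins that vanish at -\<infinity> make
  \<open>real_of_ereal\<close> harmless almost surely. Real cdfs can thus be handled as extended
  ones with an additional limit condition.\<close>

lemma real_cdf_iff:
  assumes "finite I"
  shows "real_cdf I F \<longleftrightarrow> ext_cdf I F \<and> (\<forall>j\<in>I. (\<lambda>n. margin1 F j (- real n)) \<longlonglongrightarrow> 0)"
proof safe
  assume F: "real_cdf I F"
  then show "ext_cdf I F"
    using assms by (rule real_cdf_imp_ext_cdf)
  fix j assume "j \<in> I"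
  then show "(\<lambda>n. margin1 F j (- real n)) \<longlonglongrightarrow> 0"
    using F assms by (intro real_cdf_margin1_at_bot)
      (auto simp: filterlim_uminus_at_bot filterlim_real_sequentially)
next
  assume "ext_cdf I F" and lim: "\<forall>j\<in>I. (\<lambda>n. margin1 F j (- real n)) \<longlonglongrightarrow> 0"
  then interpret vec_cdf I F
    using assms by unfold_locales
  let ?P = "cdf_measure I F"
  let ?f = "\<lambda>\<omega>. \<lambda>j\<in>I. real_of_ereal (\<omega> j)"
  let ?M = "distr ?P (Pi\<^sub>M I (\<lambda>_. borel)) ?f"
  have f [measurable]: "?f \<in> ?P \<rightarrow>\<^sub>M Pi\<^sub>M I (\<lambda>_. borel)"
    by (intro measurable_restrict) simp
  have "AE \<omega> in ?P. \<omega> j \<noteq> -\<infinity>" if j: "j \<in> I" for j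
  proof -
    have "prob {\<omega> \<in> space ?P. \<omega> j = -\<infinity>} \<le> margin1 F j (- real n)" for n
      unfolding margin1_eq[OF j] using j by (intro finite_measure_mono) auto
    then have "prob {\<omega> \<in> space ?P. \<omega> j = -\<infinity>} \<le> 0"
      by (intro LIMSEQ_le_const[OF bspec[OF lim j]]) blast
    then have "prob {\<omega> \<in> space ?P. \<omega> j = -\<infinity>} = 0"
      by (simp add: measure_le_0_iff)
    then show ?thesis
      using j by (subst (asm) prob_eq_0) auto
  qed
  then have "AE \<omega> in ?P. \<forall>j\<in>I. \<omega> j \<noteq> -\<infinity>"
    using assms by (simp add: AE_finite_all)
  then have fin: "AE \<omega> in ?P. \<forall>j\<in>I. \<bar>\<omega> j\<bar> \<noteq> \<infinity>"
    using AE_less_infinity by eventually_elim auto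
  have "has_cdf ?M I (\<lambda>j \<omega>. ereal (\<omega> j)) F"
    unfolding has_cdf_def
  proof (intro conjI ballI allI)
    show "prob_space ?M"
      by (rule prob_space_distr) measurable
    show "\<P>(\<omega> in ?M. \<forall>j\<in>I. ereal (\<omega> j) \<le> ereal (x j)) = F x" for x
    proof (subst measure_distr)
      show "{\<omega> \<in> space ?M. \<forall>j\<in>I. ereal (\<omega> j) \<le> ereal (x j)} \<in> sets (Pi\<^sub>M I (\<lambda>_. borel))"
        using finite_index by simp
      have "prob (?f -` {\<omega> \<in> space ?M. \<forall>j\<in>I. ereal (\<omega> j) \<le> ereal (x j)} \<inter> space ?P) = 
        prob (quadrant (\<lambda>j. ereal (x j)))"
      proof (rule finite_measure_eq_AE)
        show "AE \<omega> in ?P. (\<omega> \<in> ?f -` {\<omega> \<in> space ?M. \<forall>j\<in>I. ereal (\<omega> j) \<le> ereal (x j)} \<inter> space ?P)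
            = (\<omega> \<in> quadrant (\<lambda>j. ereal (x j)))"
          using fin AE_space
        proof eventually_elim
          case (elim \<omega>)
          have "real_of_ereal z \<le> r \<longleftrightarrow> z \<le> ereal r" if "\<bar>z\<bar> \<noteq> \<infinity>" for z r
            using that by (cases z) auto
          with elim show ?case
            using measurable_space[OF f, of \<omega>] by (auto simp: quadrant_def)
        qed
      qed (use finite_index in \<open>auto\<close>)
      then show "prob (?f -` {\<omega> \<in> space ?M. \<forall>j\<in>I. ereal (\<omega> j) \<le> ereal (x j)} \<inter> space ?P) = F x"
        by (simp add: cdf_eq)
    qed measurable
  qed auto
  then show "real_cdf I F"
    unfolding real_cdf_def by (intro exI[of _ ?M]) auto
qed

subsection \<open>Closure properties\<close>

lemma ereal_affine_le_iff:
  assumes "0 < a"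
  shows "ereal (1 / a) * (z - ereal b) \<le> ereal x \<longleftrightarrow> z \<le> ereal (a * x + b)"
  using assms by (cases z) (auto simp: field_simps)

lemma has_cdf_affine:
  assumes "has_cdf P I X F" "finite I" "\<And>j. j \<in> I \<Longrightarrow> 0 < a j"
  shows "has_cdf P I (\<lambda>j \<omega>. ereal (1 / a j) * (X j \<omega> - ereal (b j))) (\<lambda>x. F (\<lambda>j. a j * x j + b j))"
proof -
  interpret cdf_of P I X F
    using assms by unfold_locales
  have lt: "z < \<infinity> \<Longrightarrow> 0 < a j \<Longrightarrow> ereal (1 / a j) * (z - ereal (b j)) < \<infinity>" for j z
    by (cases z) auto
  show ?thesis
    unfolding has_cdf_def
  proof (intro conjI ballI allI)
    show "AE \<omega> in P. ereal (1 / a j) * (X j \<omega> - ereal (b j)) < \<infinity>" if j: "j \<in> I" for j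
      using AE_less_infinity
    proof eventually_elim
      case (elim \<omega>)
      then show ?case using lt[of "X j \<omega>" j] assms(3)[OF j] j by blast
    qed
    show "\<P>(\<omega> in P. \<forall>j\<in>I. ereal (1 / a j) * (X j \<omega> - ereal (b j)) \<le> ereal (x j)) = F (\<lambda>j. a j * x j + b j)" for x
      using assms(3) by (simp add: cdf_eq quadrant_def ereal_affine_le_iff cong: ball_cong)
  qed (auto intro: prob_space_axioms)
qed

lemma ext_cdf_affine:
  assumes "ext_cdf I F" "finite I" "\<And>j. j \<in> I \<Longrightarrow> 0 < a j"
  shows "ext_cdf I (\<lambda>x. F (\<lambda>j. a j * x j + b j))"
  using assms by (auto simp: ext_cdf_def[of I F] intro: has_cdf_imp_ext_cdf has_cdf_affine)

lemma filterlim_affine_at_top: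
  assumes "0 < (a::real)" "filterlim s at_top sequentially"
  shows "filterlim (\<lambda>n. a * s n + b) at_top sequentially"
proof -
  have "filterlim (\<lambda>n. b + a * s n) at_top sequentially"
    using assms by (intro filterlim_tendsto_add_at_top[OF tendsto_const]
        filterlim_tendsto_pos_mult_at_top[OF tendsto_const])
  then show ?thesis by (simp add: add.commute)
qed

lemma margin_affine:
  assumes "ext_cdf I F" "finite I" "\<And>j. j \<in> I \<Longrightarrow> 0 < a j" "J \<subseteq> I"
  shows "margin J (\<lambda>x. F (\<lambda>j. a j * x j + b j)) x = margin J F (\<lambda>j. a j * x j + b j)"
proof (rule LIMSEQ_unique)
  let ?y = "\<lambda>n j. if j \<in> J then x j else real n"
  interpret vec_cdf I F using assms by unfold_locales
  interpret F': vec_cdf I "\<lambda>x. F (\<lambda>j. a j * x j + b j)"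
    by unfold_locales (use ext_cdf_affine[OF assms(1-3), where b=b] assms(2) in simp_all)
  show "(\<lambda>n. F (\<lambda>j. a j * ?y n j + b j)) \<longlonglongrightarrow> margin J (\<lambda>x. F (\<lambda>j. a j * x j + b j)) x"
    using assms by (intro F'.margin_tendsto_real) auto
  show "(\<lambda>n. F (\<lambda>j. a j * ?y n j + b j)) \<longlonglongrightarrow> margin J F (\<lambda>j. a j * x j + b j)"
    using assms by (intro margin_tendsto)
      (auto simp: approximates_const filterlim_real_sequentially intro!: filterlim_affine_at_top)
qed

lemma margin1_affine:
  assumes "ext_cdf I F" "finite I" "\<And>j. j \<in> I \<Longrightarrow> 0 < a j" "j \<in> I"
  shows "margin1 (\<lambda>x. F (\<lambda>j. a j * x j + b j)) j y = margin1 F j (a j * y + b j)"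
proof -
  interpret vec_cdf I F using assms by unfold_locales
  show ?thesis
    using margin_affine[OF assms(1-3), where J="{j}" and b=b and x="\<lambda>_. y"] assms(4)
    by (simp add: margin1_def[of "\<lambda>x. F (\<lambda>j. a j * x j + b j)"] margin_singleton)
qed

lemma real_cdf_affine:
  assumes "real_cdf I F" "finite I" "\<And>j. j \<in> I \<Longrightarrow> 0 < a j"
  shows "real_cdf I (\<lambda>x. F (\<lambda>j. a j * x j + b j))"
proof -
  have ext: "ext_cdf I F" using assms real_cdf_imp_ext_cdf by blast
  have "(\<lambda>n. margin1 F j (a j * (- real n) + b j)) \<longlonglongrightarrow> 0" if "j \<in> I" for j
  proof (rule real_cdf_margin1_at_bot[OF assms(1,2) that])
    have "filterlim (\<lambda>n. a j * real n + - b j) at_top sequentially"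
      using assms(3)[OF that] by (intro filterlim_affine_at_top filterlim_real_sequentially)
    then show "filterlim (\<lambda>n. a j * (- real n) + b j) at_bot sequentially"
      by (simp add: filterlim_uminus_at_bot)
  qed
  then show ?thesis
    using ext_cdf_affine[OF ext assms(2,3)] margin1_affine[OF ext assms(2,3)]
    by (simp add: real_cdf_iff[OF assms(2)])
qed

section \<open>Conditioning on exceedance of a threshold, and maxima of independent vectors\<close>

lemma (in cdf_of) prob_not_quadrant_inter:
  "\<P>(\<omega> in P. (\<forall>j\<in>I. X j \<omega> \<le> ereal (x j)) \<and> \<not> (\<forall>j\<in>I. X j \<omega> \<le> ereal (u j))) = F x - F (\<lambda>j. min (x j) (u j))"
proof -
  have "prob (quadrant (\<lambda>j. ereal (x j)) - quadrant (\<lambda>j. ereal (min (x j) (u j)))) =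
      F x - F (\<lambda>j. min (x j) (u j))"
    unfolding cdf_eq
    by (rule finite_measure_Diff[OF quadrant_measurable quadrant_measurable]) (auto simp: quadrant_def)
  also have "quadrant (\<lambda>j. ereal (x j)) - quadrant (\<lambda>j. ereal (min (x j) (u j))) =
    {\<omega>\<in>space P. (\<forall>j\<in>I. X j \<omega> \<le> ereal (x j)) \<and> \<not> (\<forall>j\<in>I. X j \<omega> \<le> ereal (u j))}"
    by (auto simp: quadrant_def min_def split: if_splits) (metis ereal_less_eq(3) linorder_le_cases order_trans)
  finally show ?thesis .
qed

lemma (in cdf_of) prob_not_quadrant:
  "\<P>(\<omega> in P. \<not> (\<forall>j\<in>I. X j \<omega> \<le> ereal (u j))) = 1 - F u"
proof -
  have "prob (space P - quadrant (\<lambda>j. ereal (u j))) = 1 - F u"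
    unfolding cdf_eq by (intro prob_compl) measurable
  also have "space P - quadrant (\<lambda>j. ereal (u j)) = {\<omega>\<in>space P. \<not> (\<forall>j\<in>I. X j \<omega> \<le> ereal (u j))}"
    by (auto simp: quadrant_def)
  finally show ?thesis .
qed

lemma (in cdf_of) cond_prob_eq:
  "cond_prob P (\<lambda>\<omega>. \<forall>j\<in>I. X j \<omega> \<le> ereal (x j)) (\<lambda>\<omega>. \<not> (\<forall>j\<in>I. X j \<omega> \<le> ereal (u j))) =
    (F x - F (\<lambda>j. min (x j) (u j))) / (1 - F u)"
  unfolding cond_prob_def prob_not_quadrant_inter prob_not_quadrant ..

lemma (in cdf_of) ext_cdf_cond:
  assumes "F u < 1"
  shows "ext_cdf I (\<lambda>x. (F x - F (\<lambda>j. min (x j) (u j))) / (1 - F u))"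
proof -
  let ?E = "{\<omega>\<in>space P. \<not> (\<forall>j\<in>I. X j \<omega> \<le> ereal (u j))}"
  let ?M = "uniform_measure P ?E"
  have [measurable]: "Measurable.pred P (\<lambda>\<omega>. \<not> (\<forall>j\<in>I. X j \<omega> \<le> ereal (x j)))" 
    "Measurable.pred P (\<lambda>\<omega>. (\<forall>j\<in>I. X j \<omega> \<le> ereal (x j)))" for x
    using finite_index by measurable
  have E: "prob ?E > 0"
    unfolding prob_not_quadrant using assms by simp
  have "has_cdf ?M I X (\<lambda>x. (F x - F (\<lambda>j. min (x j) (u j))) / (1 - F u))"
    unfolding has_cdf_def
  proof (intro conjI ballI allI)
    show "prob_space ?M"
      using E by (intro prob_space_uniform_measure) (auto simp: emeasure_eq_measure)
    show "AE \<omega> in ?M. X j \<omega> < \<infinity>" if "j \<in> I" for j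
      using AE_less_infinity that by (intro AE_uniform_measureI) (measurable, auto)
    show "\<P>(\<omega> in ?M. \<forall>j\<in>I. X j \<omega> \<le> ereal (x j)) = (F x - F (\<lambda>j. min (x j) (u j))) / (1 - F u)" for x
      unfolding cond_prob_eq[symmetric]
      by (subst measure_uniform_measure_eq_cond_prob[symmetric]) measurable
  qed auto
  then show ?thesis
    using finite_index by (rule has_cdf_imp_ext_cdf)
qed

text \<open>The product is the cdf of the componentwise maximum of two independent vectors. The
  index sets may differ; a component missing in one vector is padded with -\<infinity>, the neutral
  element of the maximum. The disjoint case is what attaches an independent component.\<close>

lemma ext_cdf_mult:
  assumes "ext_cdf J F" "ext_cdf K G" "finite J" "finite K"
  shows "ext_cdf (J \<union> K) (\<lambda>x. F x * G x)"
proof -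
  interpret F: vec_cdf J F using assms by unfold_locales
  interpret G: vec_cdf K G using assms by unfold_locales
  let ?P = "cdf_measure J F" and ?Q = "cdf_measure K G"
  interpret PQ: pair_prob_space ?P ?Q by unfold_locales
  have fst: "distr (?P \<Otimes>\<^sub>M ?Q) ?P fst = ?P"
    by (rule G.distr_pair_fst)
  have snd: "distr (?P \<Otimes>\<^sub>M ?Q) ?Q snd = ?Q"
  proof (intro measure_eqI)
    fix A assume A: "A \<in> sets (distr (?P \<Otimes>\<^sub>M ?Q) ?Q snd)"
    then have "emeasure (distr (?P \<Otimes>\<^sub>M ?Q) ?Q snd) A = emeasure (?P \<Otimes>\<^sub>M ?Q) (space ?P \<times> A)"
      by (auto simp add: emeasure_distr space_pair_measure dest: sets.sets_into_space intro!: arg_cong2[where f=emeasure])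
    with A show "emeasure (distr (?P \<Otimes>\<^sub>M ?Q) ?Q snd) A = emeasure ?Q A"
      by (simp add: G.emeasure_pair_measure_Times F.emeasure_space_1)
  qed simp
  define Z where "Z j = (\<lambda>(\<omega>, \<omega>').
     max (if j \<in> J then \<omega> j else -\<infinity>) (if j \<in> K then \<omega>' j else -\<infinity>) :: ereal)" for j
  have Z_meas: "Z j \<in> borel_measurable (?P \<Otimes>\<^sub>M ?Q)" for j
  proof -
    have 1: "(\<lambda>\<omega>. fst \<omega> j) \<in> borel_measurable (?P \<Otimes>\<^sub>M ?Q)" if "j \<in> J"
      using measurable_comp[OF measurable_fst F.component_measurable[OF that]] by (simp add: comp_def)
    have 2: "(\<lambda>\<omega>. snd \<omega> j) \<in> borel_measurable (?P \<Otimes>\<^sub>M ?Q)" if "j \<in> K"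
      using measurable_comp[OF measurable_snd G.component_measurable[OF that]] by (simp add: comp_def)
    show ?thesis
      unfolding Z_def split_beta using 1 2 by (cases "j \<in> J"; cases "j \<in> K") auto
  qed
  have "has_cdf (?P \<Otimes>\<^sub>M ?Q) (J \<union> K) Z (\<lambda>x. F x * G x)"
    unfolding has_cdf_def
  proof (intro conjI ballI allI Z_meas)
    show "prob_space (?P \<Otimes>\<^sub>M ?Q)" by unfold_locales
    show "AE \<omega> in ?P \<Otimes>\<^sub>M ?Q. Z j \<omega> < \<infinity>" for j
    proof -
      have "AE \<omega> in ?P \<Otimes>\<^sub>M ?Q. \<forall>j\<in>J. fst \<omega> j < \<infinity>"
        using F.AE_less_infinity by (intro AE_distrD[OF measurable_fst]) (simp only: fst)
      moreover have "AE \<omega> in ?P \<Otimes>\<^sub>M ?Q. \<forall>j\<in>K. snd \<omega> j < \<infinity>"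
        using G.AE_less_infinity by (intro AE_distrD[OF measurable_snd]) (simp only: snd)
      ultimately show ?thesis
        by eventually_elim (auto simp: Z_def split_beta max_def)
    qed
    show "\<P>(\<omega> in ?P \<Otimes>\<^sub>M ?Q. \<forall>j\<in>J \<union> K. Z j \<omega> \<le> ereal (x j)) = F x * G x" for x
    proof -
      let ?A = "F.quadrant (\<lambda>j. ereal (x j))" and ?B = "G.quadrant (\<lambda>j. ereal (x j))"
      have "{\<omega> \<in> space (?P \<Otimes>\<^sub>M ?Q). \<forall>j\<in>J \<union> K. Z j \<omega> \<le> ereal (x j)} = ?A \<times> ?B"
        by (auto simp: space_pair_measure Z_def F.quadrant_def G.quadrant_def split: if_splits)
      moreover have "emeasure (?P \<Otimes>\<^sub>M ?Q) (?A \<times> ?B) = ennreal (F x * G x)"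
        by (simp add: G.emeasure_pair_measure_Times F.emeasure_eq_measure G.emeasure_eq_measure
            F.cdf_eq G.cdf_eq ennreal_mult)
      ultimately show ?thesis
        by (simp add: measure_def F.cdf_nonneg G.cdf_nonneg)
    qed
  qed
  then show ?thesis
    by (rule has_cdf_imp_ext_cdf) (use assms in auto)
qed

lemma margin1_mult:
  assumes "ext_cdf I F" "ext_cdf I G" "finite I" "j \<in> I"
  shows "margin1 (\<lambda>x. F x * G x) j y = margin1 F j y * margin1 G j y"
proof -
  interpret F: vec_cdf I F using assms by unfold_locales
  interpret G: vec_cdf I G using assms by unfold_locales
  have lim: "(\<lambda>n. K (\<lambda>i. if i = j then y else real n)) \<longlonglongrightarrow> margin1 K j y" if "ext_cdf I K" for K
  proof -
    interpret vec_cdf I K using assms that by unfold_locales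
    show ?thesis
      using assms(4) by (intro margin1_tendsto_real) auto
  qed
  have "ext_cdf I (\<lambda>x. F x * G x)"
    using ext_cdf_mult[of I F I G] assms by simp
  from LIMSEQ_unique[OF lim[OF this] tendsto_mult[OF lim lim]] assms show ?thesis
    by blast
qed

lemma real_cdf_mult:
  assumes "real_cdf I F" "real_cdf I G" "finite I"
  shows "real_cdf I (\<lambda>x. F x * G x)"
proof -
  have *: "ext_cdf I F" "ext_cdf I G" using assms real_cdf_imp_ext_cdf by blast+
  have "(\<lambda>n. margin1 F j (- real n) * margin1 G j (- real n)) \<longlonglongrightarrow> 0 * 0" if "j \<in> I" for j
    using assms that by (intro tendsto_mult) (auto simp: real_cdf_iff)
  then show ?thesis
    using ext_cdf_mult[OF *] by (simp add: real_cdf_iff assms margin1_mult[OF *])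
qed

subsection \<open>Mixtures and limits\<close>

lemma sets_borel_ereal: "sets (borel :: ereal measure) = sigma_sets UNIV (range (\<lambda>a. {..a}))"
proof -
  have "(borel :: ereal measure) = sigma UNIV (range (\<lambda>a. {..a}))"
  proof (rule borel_eq_sigmaI1[OF borel_Ioi])
    fix S :: "ereal set"
    assume "S \<in> range greaterThan"
    then obtain a where "S = {a<..}" by auto
    then have "S = UNIV - {..a}" by auto
    then show "S \<in> sets (sigma UNIV (range (\<lambda>a::ereal. {..a})))"
      using sets.compl_sets[of "{..a}" "sigma UNIV (range (\<lambda>a::ereal. {..a}))"] by (auto simp: space_measure_of_conv)
  qed auto
  then show ?thesis by (metis sets_measure_of Pow_UNIV subset_UNIV)
qed

text \<open>The quadrants form a generating pi-system of the product sigma-algebra, which serves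
  both for uniqueness of the measure and for measurability of kernels. With extended corners the
  whole space is itself a quadrant.\<close>

lemma sets_PiM_quadrants:
  assumes "finite I"
  shows "sets (Pi\<^sub>M I (\<lambda>_. borel :: ereal measure)) =
    sigma_sets (Pi\<^sub>E I (\<lambda>_. UNIV)) (range (\<lambda>a. {f \<in> Pi\<^sub>E I (\<lambda>_. UNIV). \<forall>j\<in>I. f j \<le> a j}))"
proof -
  let ?E = "range (\<lambda>a::ereal. {..a})"
  have "sets (Pi\<^sub>M I (\<lambda>_. sigma UNIV ?E)) = sets (sigma (Pi\<^sub>E I (\<lambda>_. UNIV))
      {{f\<in>Pi\<^sub>E I (\<lambda>_. UNIV). \<forall>i\<in>j. f i \<in> A i} | A j. j \<in> {I} \<and> A \<in> Pi j (\<lambda>_. ?E)})"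
  proof (rule sets_PiM_sigma)
    show "\<exists>S\<subseteq>?E. countable S \<and> UNIV = \<Union> S"
      by (intro exI[of _ "{{..\<infinity>}}"]) auto
  qed (use assms in auto)
  also have "{{f\<in>Pi\<^sub>E I (\<lambda>_. UNIV). \<forall>i\<in>j. f i \<in> A i} | A j. j \<in> {I} \<and> A \<in> Pi j (\<lambda>_. ?E)} =
      range (\<lambda>a. {f \<in> Pi\<^sub>E I (\<lambda>_. UNIV). \<forall>j\<in>I. f j \<le> a j})" (is "?L = ?R")
  proof (intro antisym subsetI)
    fix S assume "S \<in> ?L"
    then obtain A where S: "S = {f\<in>Pi\<^sub>E I (\<lambda>_. UNIV). \<forall>i\<in>I. f i \<in> A i}" and A: "A \<in> Pi I (\<lambda>_. ?E)"
      by blast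
    have "\<forall>i\<in>I. \<exists>a. A i = {..a}"
      using A by (auto simp: Pi_iff image_iff)
    then obtain a where "\<forall>i\<in>I. A i = {..a i}" by metis
    then show "S \<in> ?R" using S by auto
  next
    fix S assume "S \<in> ?R"
    then obtain a where "S = {f\<in>Pi\<^sub>E I (\<lambda>_. UNIV). \<forall>i\<in>I. f i \<in> {..a i}}"
      by auto
    moreover have "(\<lambda>i. {..a i}) \<in> Pi I (\<lambda>_. ?E)" by auto
    ultimately show "S \<in> ?L"
      by (intro CollectI exI[of _ "\<lambda>i. {..a i}"] exI[of _ I]) simp
  qed
  also have "sets (sigma (Pi\<^sub>E I (\<lambda>_. UNIV)) (range (\<lambda>a. {f \<in> Pi\<^sub>E I (\<lambda>_. UNIV). \<forall>j\<in>I. f j \<le> (a j :: ereal)})))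
    = sigma_sets (Pi\<^sub>E I (\<lambda>_. UNIV)) (range (\<lambda>a. {f \<in> Pi\<^sub>E I (\<lambda>_. UNIV). \<forall>j\<in>I. f j \<le> a j}))"
    by (rule sets_measure_of) auto
  finally have *: "sets (Pi\<^sub>M I (\<lambda>_. sigma UNIV ?E)) =
      sigma_sets (Pi\<^sub>E I (\<lambda>_. UNIV)) (range (\<lambda>a. {f \<in> Pi\<^sub>E I (\<lambda>_. UNIV). \<forall>j\<in>I. f j \<le> a j}))" .
  have "sets (Pi\<^sub>M I (\<lambda>_. sigma UNIV ?E)) = sets (Pi\<^sub>M I (\<lambda>_. borel :: ereal measure))"
  proof (rule sets_PiM_cong[OF refl])
    show "sets (sigma UNIV ?E) = sets borel"
      unfolding sets_borel_ereal by (rule sets_measure_of) simp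
  qed
  with * show ?thesis by simp
qed

lemma Int_stable_quadrants:
  "Int_stable (range (\<lambda>a::'i \<Rightarrow> ereal. {f \<in> Pi\<^sub>E I (\<lambda>_. UNIV). \<forall>j\<in>I. f j \<le> a j}))"
proof (rule Int_stableI_image)
  fix a b :: "'i \<Rightarrow> ereal"
  show "\<exists>c\<in>UNIV. {f \<in> Pi\<^sub>E I (\<lambda>_. UNIV). \<forall>j\<in>I. f j \<le> a j} \<inter> {f \<in> Pi\<^sub>E I (\<lambda>_. UNIV). \<forall>j\<in>I. f j \<le> b j} =
    {f \<in> Pi\<^sub>E I (\<lambda>_. UNIV). \<forall>j\<in>I. f j \<le> c j}"
    by (intro bexI[of _ "\<lambda>j. min (a j) (b j)"]) auto
qed

text \<open>A canonical approximating sequence for an arbitrary extended corner; it carries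
  identities between cdfs at real vectors over to quadrants with infinite coordinates.\<close>

definition clamp :: "ereal \<Rightarrow> nat \<Rightarrow> real" where
  "clamp a n = (if a = \<infinity> then real n else if a = -\<infinity> then - real n else real_of_ereal a)"

lemma approximates_clamp: "approximates (clamp a) a"
proof (cases a)
  case (real r)
  have "clamp (ereal r) = (\<lambda>_. r)" by (auto simp: clamp_def)
  then show ?thesis using real by (simp add: approximates_const)
next
  case PInf
  have "clamp \<infinity> = real" by (auto simp: clamp_def)
  then show ?thesis using PInf by (simp add: approximates_top filterlim_real_sequentially)
next
  case MInf
  have "clamp (-\<infinity>) = (\<lambda>n. - real n)" by (auto simp: clamp_def)
  then show ?thesis using MInf
    by (simp add: approximates_bot filterlim_uminus_at_bot filterlim_real_sequentially)
qed

lemma (in cdf_of) cdf_tendsto_clamp: "(\<lambda>n. F (\<lambda>j. clamp (a j) n)) \<longlonglongrightarrow> prob (quadrant a)"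
  by (intro cdf_tendsto) (rule approximates_clamp)

lemma cdf_measure_unique:
  assumes "finite I" "sets M = sets (Pi\<^sub>M I (\<lambda>_. borel))" "has_cdf M I (\<lambda>j \<omega>. \<omega> j) F"
    and "sets N = sets (Pi\<^sub>M I (\<lambda>_. borel))" "has_cdf N I (\<lambda>j \<omega>. \<omega> j) F"
  shows "M = N"
proof (rule measure_eqI_generator_eq[OF Int_stable_quadrants])
  interpret M: cdf_of M I "\<lambda>j \<omega>. \<omega> j" F using assms by unfold_locales
  interpret N: cdf_of N I "\<lambda>j \<omega>. \<omega> j" F using assms by unfold_locales
  have space: "space M = Pi\<^sub>E I (\<lambda>_. UNIV)" "space N = Pi\<^sub>E I (\<lambda>_. UNIV)"
    using sets_eq_imp_space_eq[OF assms(2)] sets_eq_imp_space_eq[OF assms(4)] by (auto simp: space_PiM)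
  show "emeasure M Q = emeasure N Q" 
    if "Q \<in> range (\<lambda>a. {f \<in> Pi\<^sub>E I (\<lambda>_. UNIV). \<forall>j\<in>I. f j \<le> a j})" for Q
  proof -
    from that obtain a where "Q = M.quadrant a" "Q = N.quadrant a"
      by (auto simp: M.quadrant_def N.quadrant_def space)
    then show ?thesis
      using LIMSEQ_unique[OF M.cdf_tendsto_clamp[of a] N.cdf_tendsto_clamp[of a]]
      by (simp add: M.emeasure_eq_measure N.emeasure_eq_measure)
  qed
  show "range (\<lambda>_::nat. Pi\<^sub>E I (\<lambda>_. UNIV)) \<subseteq> range (\<lambda>a::'a\<Rightarrow>ereal. {f \<in> Pi\<^sub>E I (\<lambda>_. UNIV). \<forall>j\<in>I. f j \<le> a j})"
    by (auto intro!: image_eqI[of _ _ "\<lambda>_. \<infinity>"])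
  show "\<And>i::nat. emeasure M (Pi\<^sub>E I (\<lambda>_. UNIV)) \<noteq> \<infinity>"
    by simp
qed (use assms sets_PiM_quadrants in auto)

text \<open>Each cdf is realized by its measure \<open>K a\<close>. The map
  \<open>a \<mapsto> K a\<close> is a measurable kernel because it is measurable on quadrants, where
  its values are limits of values of \<open>F a\<close>; integrating the kernel gives a measure with
  the mixed cdf.\<close>

lemma ext_cdf_mixture:
  assumes "finite I" "prob_space N" "\<And>x. (\<lambda>a. F a x) \<in> borel_measurable N"
    and "\<And>a. a \<in> space N \<Longrightarrow> ext_cdf I (F a)"
  shows "ext_cdf I (\<lambda>x. \<integral>a. F a x \<partial>N)"
proof -
  interpret N: prob_space N by fact
  note [measurable] = assms(3)
  let ?L = "Pi\<^sub>M I (\<lambda>_. borel :: ereal measure)"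
  define K where "K a = cdf_measure I (F a)" for a
  have vec: "vec_cdf I (F a)" if "a \<in> space N" for a
    using that assms by unfold_locales auto
  have K: "prob_space (K a)" "sets (K a) = sets ?L" "has_cdf (K a) I (\<lambda>j \<omega>. \<omega> j) (F a)" if "a \<in> space N" for a
    using vec_cdf.cdf_measure_props[OF vec[OF that]] by (auto simp: K_def has_cdf_def)
  have meas: "K \<in> N \<rightarrow>\<^sub>M prob_algebra ?L"
  proof (rule measurable_prob_algebra_generated[OF sets_PiM_quadrants Int_stable_quadrants])
    fix Q assume "Q \<in> range (\<lambda>a::'a\<Rightarrow>ereal. {f \<in> Pi\<^sub>E I (\<lambda>_. UNIV). \<forall>j\<in>I. f j \<le> a j})"
    then obtain b where Q: "Q = {f \<in> Pi\<^sub>E I (\<lambda>_. UNIV). \<forall>j\<in>I. f j \<le> b j}" by auto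
    have lim: "(\<lambda>n. F a (\<lambda>j. clamp (b j) n)) \<longlonglongrightarrow> measure (K a) Q" if "a \<in> space N" for a
    proof -
      interpret cdf_of "K a" I "\<lambda>j \<omega>. \<omega> j" "F a"
        using K(3)[OF that] assms(1) by unfold_locales
      have "Q = quadrant b"
        using sets_eq_imp_space_eq[OF K(2)[OF that]] by (simp add: Q quadrant_def space_PiM)
      then show ?thesis by (simp add: cdf_tendsto_clamp)
    qed
    have "(\<lambda>a. measure (K a) Q) \<in> borel_measurable N"
      by (rule borel_measurable_LIMSEQ_real[OF lim]) measurable
    then have "(\<lambda>a. ennreal (measure (K a) Q)) \<in> borel_measurable N"
      by measurable
    moreover have "emeasure (K a) Q = ennreal (measure (K a) Q)" if "a \<in> space N" for a
    proof -
      interpret prob_space "K a" by (rule K(1)[OF that])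
      show ?thesis by (rule emeasure_eq_measure)
    qed
    ultimately show "(\<lambda>a. emeasure (K a) Q) \<in> borel_measurable N"
      by (simp cong: measurable_cong)
  qed (use assms K in auto)
  have N: "N \<in> space (prob_algebra N)"
    by (simp add: space_prob_algebra N.prob_space_axioms)
  let ?M = "N \<bind> K"
  have sets: "sets ?M = sets ?L"
    by (rule sets_bind'[OF N meas])
  have emeasure: "emeasure ?M A = (\<integral>\<^sup>+a. emeasure (K a) A \<partial>N)" if "A \<in> sets ?L" for A
    by (rule emeasure_bind_prob_algebra[OF N meas that])
  interpret M: prob_space ?M
    by (rule prob_space_bind'[OF N meas])
  have space: "space ?M = space ?L" "\<And>a. a \<in> space N \<Longrightarrow> space (K a) = space ?L"
    using sets K(2) sets_eq_imp_space_eq by blast+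
  have "has_cdf ?M I (\<lambda>j \<omega>. \<omega> j) (\<lambda>x. \<integral>a. F a x \<partial>N)"
    unfolding has_cdf_def
  proof (intro conjI ballI allI M.prob_space_axioms)
    show "(\<lambda>\<omega>. \<omega> j) \<in> borel_measurable ?M" if "j \<in> I" for j
      unfolding measurable_cong_sets[OF sets refl] using that by measurable
    show "AE \<omega> in ?M. \<omega> j < \<infinity>" if j: "j \<in> I" for j
    proof (rule AE_I)
      let ?A = "{\<omega> \<in> space ?L. \<omega> j = \<infinity>}"
      show A: "?A \<in> sets ?M"
        unfolding sets using j by measurable
      have "emeasure (K a) ?A = 0" if "a \<in> space N" for a
      proof -
        have "AE \<omega> in K a. \<omega> j < \<infinity>"
          using K(3)[OF that] j by (auto simp: has_cdf_def)
        then have "AE \<omega> in K a. \<omega> \<notin> ?A" by auto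
        moreover have "?A \<in> sets (K a)" using A sets K(2)[OF that] by simp
        ultimately show ?thesis using AE_iff_measurable[of ?A "K a" "\<lambda>\<omega>. \<omega> \<notin> ?A"]
          by (auto simp: space(2)[OF that])
      qed
      then show "emeasure ?M ?A = 0"
        using A sets by (simp add: emeasure cong: nn_integral_cong)
      show "{\<omega> \<in> space ?M. \<not> \<omega> j < \<infinity>} \<subseteq> ?A"
        by (auto simp: space)
    qed
    show "\<P>(\<omega> in ?M. \<forall>j\<in>I. \<omega> j \<le> ereal (x j)) = (\<integral>a. F a x \<partial>N)" for x
    proof -
      let ?A = "{\<omega> \<in> space ?L. \<forall>j\<in>I. \<omega> j \<le> ereal (x j)}"
      have bnd: "0 \<le> F a x" "F a x \<le> 1" if "a \<in> space N" for a
      proof -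
        interpret vec_cdf I "F a" by (rule vec[OF that])
        show "0 \<le> F a x" "F a x \<le> 1" by (rule cdf_nonneg cdf_le_1)+
      qed
      have A: "?A \<in> sets ?L"
        using assms(1) by measurable
      have "emeasure (K a) ?A = ennreal (F a x)" if "a \<in> space N" for a
      proof -
        interpret prob_space "K a" by (rule K(1)[OF that])
        show ?thesis
          using K(3)[OF that] by (simp add: has_cdf_def space(2)[OF that] emeasure_eq_measure)
      qed
      then have "emeasure ?M ?A = (\<integral>\<^sup>+a. ennreal (F a x) \<partial>N)"
        unfolding emeasure[OF A] by (intro nn_integral_cong)
      also have "\<dots> = ennreal (\<integral>a. F a x \<partial>N)"
      proof (rule nn_integral_eq_integral)
        show "integrable N (\<lambda>a. F a x)"
          by (rule N.integrable_const_bound[where B=1]) (use bnd in \<open>auto intro!: AE_I2\<close>)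
        show "AE a in N. 0 \<le> F a x"
          using bnd by auto
      qed
      finally have "measure ?M ?A = (\<integral>a. F a x \<partial>N)"
        unfolding measure_def using bnd by (simp add: integral_nonneg_AE)
      then show ?thesis
        by (simp add: space)
    qed
  qed
  then show ?thesis
    using assms(1) by (rule has_cdf_imp_ext_cdf)
qed

text \<open>The measures with cdfs \<open>Fn n\<close>, restricted to \<open>{y. c n < y}\<close>, increase with \<open>n\<close>, and their supremum
  has cdf \<open>F\<close>.\<close>

lemma ext_cdf_glue:
  fixes I :: "'i set" and c :: "nat \<Rightarrow> 'i \<Rightarrow> real" and F :: "('i \<Rightarrow> real) \<Rightarrow> real"
  defines "Fn \<equiv> \<lambda>n x. if \<forall>j\<in>I. c n j \<le> x j then F x else 0"
  assumes "finite I" and dec: "\<And>m n j. m \<le> n \<Longrightarrow> j \<in> I \<Longrightarrow> c n j \<le> c m j"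
    and ext: "\<And>n. ext_cdf I (Fn n)"
    and outside: "\<And>x. (\<And>n. \<exists>j\<in>I. x j < c n j) \<Longrightarrow> F x = 0"
    and tight: "\<And>j. j \<in> I \<Longrightarrow> (\<lambda>n. margin1 (Fn n) j (c n j)) \<longlonglongrightarrow> 0"
  shows "ext_cdf I F"
proof -
  let ?L = "Pi\<^sub>M I (\<lambda>_. borel :: ereal measure)"
  define M where "M n = cdf_measure I (Fn n)" for n
  define A where "A n = {\<omega>\<in>space ?L. \<forall>j\<in>I. ereal (c n j) < \<omega> j}" for n
  have A_sets: "A n \<in> sets ?L" for n
    unfolding A_def using assms(2) by measurable
  have cdf_M: "cdf_of (M n) I (\<lambda>j \<omega>. \<omega> j) (Fn n)" and sets_M: "sets (M n) = sets ?L" for n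
  proof -
    interpret vec_cdf I "Fn n"
      using ext assms(2) by unfold_locales
    show "cdf_of (M n) I (\<lambda>j \<omega>. \<omega> j) (Fn n)" "sets (M n) = sets ?L"
      using cdf_of_axioms cdf_measure_props by (auto simp: M_def)
  qed
  have space_M: "space (M n) = space ?L" for n
    using sets_M sets_eq_imp_space_eq by blast
  have A_mono: "A m \<subseteq> A n" if "m \<le> n" for m n
  proof
    fix \<omega> assume "\<omega> \<in> A m"
    moreover have "ereal (c n j) \<le> ereal (c m j)" if "j \<in> I" for j
      using dec[OF \<open>m \<le> n\<close> that] by simp
    ultimately show "\<omega> \<in> A n"
      unfolding A_def using le_less_trans by blast
  qed
  \<comment> \<open>Replacing every coordinate by its maximum with \<open>c m\<close> turns the law
    with cdf \<open>Fn n\<close> into the law with cdf \<open>Fn m\<close>, and this map fixes the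
    points of \<open>A m\<close>. Hence the two measures agree inside \<open>A m\<close>.\<close>
  have consistent: "emeasure (M m) (B \<inter> A m) = emeasure (M n) (B \<inter> A m)"
    if "m \<le> n" and B: "B \<in> sets ?L" for m n B
  proof -
    interpret N: cdf_of "M n" I "\<lambda>j \<omega>. \<omega> j" "Fn n" by (rule cdf_M)
    interpret M: cdf_of "M m" I "\<lambda>j \<omega>. \<omega> j" "Fn m" by (rule cdf_M)
    let ?f = "\<lambda>\<omega>. \<lambda>j\<in>I. max (\<omega> j) (ereal (c m j))"
    have f [measurable]: "?f \<in> M n \<rightarrow>\<^sub>M ?L"
      unfolding measurable_cong_sets[OF sets_M refl] by (intro measurable_restrict) measurable
    let ?N = "distr (M n) ?L ?f"
    have "has_cdf ?N I (\<lambda>j \<omega>. \<omega> j) (Fn m)"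
      unfolding has_cdf_def
    proof (intro conjI ballI allI)
      show "prob_space ?N"
        by (rule N.prob_space_distr) measurable
      show "AE \<omega> in ?N. \<omega> j < \<infinity>" if j: "j \<in> I" for j
      proof (subst AE_distr_iff)
        show "AE \<omega> in M n. ?f \<omega> j < \<infinity>"
          using N.AE_less_infinity j by (auto elim!: eventually_mono simp: max_def)
      qed (use j in auto)
      show "\<P>(\<omega> in ?N. \<forall>j\<in>I. \<omega> j \<le> ereal (x j)) = Fn m x" for x
      proof (subst measure_distr)
        let ?Q = "{\<omega> \<in> space ?N. \<forall>j\<in>I. \<omega> j \<le> ereal (x j)}"
        show "?Q \<in> sets ?L"
          using assms(2) by simp
        show "N.prob (?f -` ?Q \<inter> space (M n)) = Fn m x"
        proof (cases "\<forall>j\<in>I. c m j \<le> x j")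
          case True
          then have "?f -` ?Q \<inter> space (M n) = N.quadrant (\<lambda>j. ereal (x j))"
            using measurable_space[OF f] by (auto simp: N.quadrant_def)
          then have "N.prob (?f -` ?Q \<inter> space (M n)) = Fn n x"
            by (simp add: N.cdf_eq)
          also have "\<dots> = Fn m x"
            using True dec[OF \<open>m \<le> n\<close>] by (fastforce simp: Fn_def intro: order_trans)
          finally show ?thesis .
        next
          case False
          then have "?f -` ?Q \<inter> space (M n) = {}"
            by auto
          then show ?thesis
            using False by (simp only: measure_empty) (auto simp: Fn_def)
        qed
      qed measurable
    qed auto
    then have "?N = M m"
      using assms(2) M.has_cdf sets_M by (intro cdf_measure_unique[of I ?N "Fn m" "M m"]) auto
    then have "emeasure (M m) (B \<inter> A m) = emeasure ?N (B \<inter> A m)" by simp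
    also have "\<dots> = emeasure (M n) (?f -` (B \<inter> A m) \<inter> space (M n))"
      using B A_sets by (intro emeasure_distr) auto
    also have "?f -` (B \<inter> A m) \<inter> space (M n) = B \<inter> A m"
    proof -
      have eq: "?f \<omega> = \<omega>" if "\<omega> \<in> A m" for \<omega>
        using that by (intro HOL.ext) (auto simp: A_def space_PiM PiE_def extensional_def restrict_def max_def)
      have mem: "\<omega> \<in> A m" if "?f \<omega> \<in> A m" "\<omega> \<in> space (M n)" for \<omega>
        using that by (auto simp: A_def space_M less_max_iff_disj)
      show ?thesis
      proof (intro antisym subsetI)
        fix \<omega> assume "\<omega> \<in> ?f -` (B \<inter> A m) \<inter> space (M n)"
        then have "?f \<omega> \<in> B" "?f \<omega> \<in> A m" "\<omega> \<in> space (M n)" by blast+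
        with mem[of \<omega>] eq[of \<omega>] show "\<omega> \<in> B \<inter> A m" by (simp only: Int_iff)
      next
        fix \<omega> assume *: "\<omega> \<in> B \<inter> A m"
        then have "\<omega> \<in> space (M n)"
          using sets.sets_into_space[OF A_sets[of m]] space_M by blast
        with * eq[of \<omega>] show "\<omega> \<in> ?f -` (B \<inter> A m) \<inter> space (M n)"
          by (simp only: Int_iff vimage_eq)
      qed
    qed
    finally show ?thesis .
  qed
  \<comment> \<open>Restricting \<open>M n\<close> to \<open>A n\<close> makes the measures increase
    with \<open>n\<close>, so that their supremum is available as a measure.\<close>
  define D where "D n = density (M n) (indicator (A n))" for n
  have sets_D: "sets (D n) = sets ?L" for n
    by (simp add: D_def sets_M)
  have emeasure_D: "emeasure (D n) B = emeasure (M n) (B \<inter> A n)" if "B \<in> sets ?L" for n B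
  proof -
    have "emeasure (D n) B = (\<integral>\<^sup>+\<omega>. indicator (A n) \<omega> * indicator B \<omega> \<partial>M n)"
      unfolding D_def using that A_sets[of n] by (intro emeasure_density borel_measurable_indicator) (simp_all add: sets_M)
    also have "\<dots> = (\<integral>\<^sup>+\<omega>. indicator (B \<inter> A n) \<omega> \<partial>M n)"
      by (simp add: indicator_inter_arith mult.commute)
    also have "\<dots> = emeasure (M n) (B \<inter> A n)"
      using that A_sets[of n] by (intro nn_integral_indicator) (simp add: sets_M)
    finally show ?thesis .
  qed
  have D_mono: "D m \<le> D n" if "m \<le> n" for m n
    unfolding le_measure[OF trans[OF sets_D sets_D[symmetric]]] sets_D
    using that A_mono[OF that] A_sets
    by (auto simp: emeasure_D consistent sets_M intro!: emeasure_mono)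
  define S where "S = (SUP n. D n)"
  have sets_S: "sets S = sets ?L"
    unfolding S_def by (rule sets_SUP) (simp_all add: sets_D)
  have emeasure_S: "(\<lambda>n. emeasure (M n) (B \<inter> A n)) \<longlonglongrightarrow> emeasure S B" if B: "B \<in> sets ?L" for B
  proof -
    have "Complete_Partial_Order.chain (\<le>) (range D)"
      unfolding Complete_Partial_Order.chain_def using D_mono by (metis imageE nat_le_linear)
    then have "emeasure S B = (SUP n. emeasure (D n) B)"
      unfolding S_def using B by (intro emeasure_SUP_chain[where N="?L"]) (auto simp: sets_D)
    moreover have "incseq (\<lambda>n. emeasure (D n) B)"
      using D_mono B by (auto simp: incseq_def le_measure sets_D)
    ultimately show ?thesis
      using LIMSEQ_SUP[of "\<lambda>n. emeasure (D n) B"] B by (simp add: emeasure_D)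
  qed
  \<comment> \<open>A bound for the mass that \<open>M n\<close> has outside \<open>A n\<close>. By
    the tightness assumption it vanishes, so the restrictions lose nothing in the limit.\<close>
  define \<delta> where "\<delta> n = (\<Sum>j\<in>I. margin1 (Fn n) j (c n j))" for n
  have \<delta>: "\<delta> \<longlonglongrightarrow> 0"
    unfolding \<delta>_def using tendsto_sum[of I, OF tight] by simp
  have approx: "measure (M n) B - \<delta> n \<le> measure (M n) (B \<inter> A n)" "measure (M n) (B \<inter> A n) \<le> measure (M n) B"
    if B: "B \<in> sets ?L" for n B
  proof -
    interpret cdf_of "M n" I "\<lambda>j \<omega>. \<omega> j" "Fn n" by (rule cdf_M)
    have BA: "B \<in> events" "A n \<in> events"
      using B A_sets by (auto simp: sets_M)
    show "prob (B \<inter> A n) \<le> prob B"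
      using BA by (intro finite_measure_mono) auto
    have Q: "{\<omega>\<in>space (M n). \<omega> j \<le> ereal (c n j)} \<in> events" if "j \<in> I" for j
      using component_measurable[OF that] by measurable
    have "prob B \<le> prob ((B \<inter> A n) \<union> (\<Union>j\<in>I. {\<omega>\<in>space (M n). \<omega> j \<le> ereal (c n j)}))"
      using BA Q assms(2) sets.sets_into_space[OF B]
      by (intro finite_measure_mono sets.Un sets.finite_UN) (auto simp: A_def space_M not_le)
    also have "\<dots> \<le> prob (B \<inter> A n) + prob (\<Union>j\<in>I. {\<omega>\<in>space (M n). \<omega> j \<le> ereal (c n j)})"
      using BA Q assms(2) by (intro measure_Un_le sets.finite_UN) auto
    also have "prob (\<Union>j\<in>I. {\<omega>\<in>space (M n). \<omega> j \<le> ereal (c n j)}) \<le>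
      (\<Sum>j\<in>I. prob {\<omega>\<in>space (M n). \<omega> j \<le> ereal (c n j)})"
      using Q assms(2) by (intro finite_measure_subadditive_finite) auto
    also have "\<dots> = \<delta> n"
      unfolding \<delta>_def by (intro sum.cong refl) (simp add: margin1_eq)
    finally show "prob B - \<delta> n \<le> prob (B \<inter> A n)" by simp
  qed
  have measure_S: "emeasure S B = ennreal b" if B: "B \<in> sets ?L" and b: "(\<lambda>n. measure (M n) B) \<longlonglongrightarrow> b" for B b
  proof -
    have "(\<lambda>n. measure (M n) (B \<inter> A n)) \<longlonglongrightarrow> b"
    proof (rule tendsto_sandwich)
      show "(\<lambda>n. measure (M n) B - \<delta> n) \<longlonglongrightarrow> b"
        using tendsto_diff[OF b \<delta>] by simp
    qed (use approx[OF B] b in auto)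
    then have "(\<lambda>n. ennreal (measure (M n) (B \<inter> A n))) \<longlonglongrightarrow> ennreal b"
      by (rule tendsto_ennrealI)
    moreover have "ennreal (measure (M n) (B \<inter> A n)) = emeasure (M n) (B \<inter> A n)" for n
    proof -
      interpret cdf_of "M n" I "\<lambda>j \<omega>. \<omega> j" "Fn n" by (rule cdf_M)
      show ?thesis by (simp add: emeasure_eq_measure)
    qed
    ultimately show ?thesis
      using emeasure_S[OF B] LIMSEQ_unique by auto
  qed
  have space_S: "space S = space ?L"
    using sets_S sets_eq_imp_space_eq by blast
  have "has_cdf S I (\<lambda>j \<omega>. \<omega> j) F"
    unfolding has_cdf_def
  proof (intro conjI ballI allI)
    show "prob_space S"
    proof
      have "measure (M n) (space ?L) = 1" for n
      proof -
        interpret cdf_of "M n" I "\<lambda>j \<omega>. \<omega> j" "Fn n" by (rule cdf_M)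
        show ?thesis using prob_space by (simp add: space_M)
      qed
      then show "emeasure S (space S) = 1"
        unfolding space_S by (subst measure_S[of _ 1]) auto
    qed
    show "(\<lambda>\<omega>. \<omega> j) \<in> borel_measurable S" if "j \<in> I" for j
      unfolding measurable_cong_sets[OF sets_S refl] using that by measurable
    show "AE \<omega> in S. \<omega> j < \<infinity>" if j: "j \<in> I" for j
    proof (rule AE_I)
      let ?B = "{\<omega> \<in> space ?L. \<omega> j = \<infinity>}"
      show B: "?B \<in> sets S"
        unfolding sets_S using j by measurable
      have "measure (M n) ?B = 0" for n
      proof -
        interpret cdf_of "M n" I "\<lambda>j \<omega>. \<omega> j" "Fn n" by (rule cdf_M)
        have "AE \<omega> in M n. \<omega> \<notin> ?B" using AE_less_infinity j by (auto elim!: eventually_mono)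
        then show ?thesis
          using B sets_S sets_M by (subst prob_eq_0) auto
      qed
      then show "emeasure S ?B = 0"
        using B sets_S by (subst measure_S[of _ 0]) auto
      show "{\<omega> \<in> space S. \<not> \<omega> j < \<infinity>} \<subseteq> ?B"
        by (auto simp: space_S)
    qed
    show "\<P>(\<omega> in S. \<forall>j\<in>I. \<omega> j \<le> ereal (x j)) = F x" for x
    proof -
      let ?Q = "{\<omega> \<in> space ?L. \<forall>j\<in>I. \<omega> j \<le> ereal (x j)}"
      have "measure (M n) ?Q = Fn n x" for n
      proof -
        interpret cdf_of "M n" I "\<lambda>j \<omega>. \<omega> j" "Fn n" by (rule cdf_M)
        show ?thesis by (simp add: cdf_eq quadrant_def space_M)
      qed
      moreover have lim: "(\<lambda>n. Fn n x) \<longlonglongrightarrow> F x"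
      proof (cases "\<exists>N. \<forall>j\<in>I. c N j \<le> x j")
        case True
        then obtain N where "\<forall>j\<in>I. c N j \<le> x j" by blast
        then have "Fn n x = F x" if "n \<ge> N" for n
          using dec[OF that] by (force simp: Fn_def intro: order_trans)
        then show ?thesis
          by (intro tendsto_eventually eventually_sequentiallyI[of N])
      next
        case False
        then have "F x = 0" using outside by (force simp: not_le)
        moreover have "Fn n x = 0" for n using False by (auto simp: Fn_def)
        ultimately show ?thesis by simp
      qed
      ultimately have "emeasure S ?Q = ennreal (F x)"
        using assms(2) by (intro measure_S) auto
      moreover have "0 \<le> F x"
      proof (rule LIMSEQ_le_const[OF lim])
        show "\<exists>N. \<forall>n\<ge>N. 0 \<le> Fn n x"
          using cdf_of.cdf_nonneg[OF cdf_M] by blast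
      qed
      ultimately show ?thesis
        by (simp add: measure_def space_S)
    qed
  qed
  then show ?thesis
    using assms(2) by (rule has_cdf_imp_ext_cdf)
qed

text \<open>For \<open>k = 0\<close> this is the unit mass at 0, and each factor \<open>K\<close>
  takes the maximum with one more independent vector. The cut-off encodes that 0 takes part in the
  maximum.\<close>

lemma ext_cdf_power_nonneg:
  assumes "ext_cdf I K" "finite I"
  shows "ext_cdf I (\<lambda>x. if \<forall>j\<in>I. 0 \<le> x j then K x ^ k else 0)"
proof (induction k)
  case 0
  have "has_cdf (return (count_space UNIV) ()) I (\<lambda>j _. 0) (\<lambda>x. if \<forall>j\<in>I. 0 \<le> x j then K x ^ 0 else 0)"
    by (auto simp: has_cdf_def prob_space_return measure_return indicator_def zero_ereal_def)
  then show ?case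
    using assms(2) by (rule has_cdf_imp_ext_cdf)
next
  case (Suc k)
  have "(\<lambda>x. K x * (if \<forall>j\<in>I. 0 \<le> x j then K x ^ k else 0)) = 
    (\<lambda>x. if \<forall>j\<in>I. 0 \<le> x j then K x ^ Suc k else 0)"
    by auto
  then show ?case
    using ext_cdf_mult[OF assms(1) Suc assms(2) assms(2)] by (simp only: Un_absorb)
qed

text \<open>The cdf of the maximum of \<open>0\<close> and a Poisson number of independent vectors with cdf \<open>K\<close>.\<close>

lemma ext_cdf_poisson:
  assumes "ext_cdf I K" "finite I" "0 < r"
  shows "ext_cdf I (\<lambda>x. if \<forall>j\<in>I. 0 \<le> x j then exp (- r * (1 - K x)) else 0)"
proof -
  define F where "F k x = (if \<forall>j\<in>I. 0 \<le> x j then K x ^ k else 0)" for k :: nat and x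
  interpret vec_cdf I K using assms by unfold_locales
  have "ext_cdf I (\<lambda>x. \<integral>k. F k x \<partial>measure_pmf (poisson_pmf r))"
    unfolding F_def using assms
    by (intro ext_cdf_mixture ext_cdf_power_nonneg prob_space_measure_pmf) auto
  also have "(\<lambda>x. \<integral>k. F k x \<partial>measure_pmf (poisson_pmf r)) =
      (\<lambda>x. if \<forall>j\<in>I. 0 \<le> x j then exp (- r * (1 - K x)) else 0)"
  proof (intro ext)
    fix x
    let ?f = "\<lambda>k. pmf (poisson_pmf r) k * (K x) ^ k"
    have "(\<lambda>k. (r * K x) ^ k /\<^sub>R fact k * exp (- r)) sums (exp (r * K x) * exp (- r))"
      by (intro sums_mult2 exp_converges)
    also have "(\<lambda>k. (r * K x) ^ k /\<^sub>R fact k * exp (- r)) = ?f"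
      using assms(3) by (auto simp: fun_eq_iff power_mult_distrib field_simps)
    also have "exp (r * K x) * exp (- r) = exp (- r * (1 - K x))"
      by (simp add: exp_add[symmetric] algebra_simps)
    finally have sums: "?f sums exp (- r * (1 - K x))" .
    have "(\<integral>k. K x ^ k \<partial>measure_pmf (poisson_pmf r)) = (\<integral>k. ?f k \<partial>count_space UNIV)"
      unfolding measure_pmf_eq_density by (subst integral_density) auto
    also have "\<dots> = exp (- r * (1 - K x))"
    proof (subst integral_count_space_nat)
      show "integrable (count_space UNIV) ?f"
        using sums cdf_nonneg assms(3)
        by (subst integrable_count_space_nat_iff) (auto simp: abs_mult sums_iff)
    qed (use sums in \<open>simp add: sums_iff\<close>)
    finally have *: "(\<integral>k. K x ^ k \<partial>measure_pmf (poisson_pmf r)) = exp (- r * (1 - K x))" .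
    show "(\<integral>k. F k x \<partial>measure_pmf (poisson_pmf r)) =
        (if \<forall>j\<in>I. 0 \<le> x j then exp (- r * (1 - K x)) else 0)"
      (is "?l = ?r")
    proof (cases "\<forall>j\<in>I. 0 \<le> x j")
      case True
      then have "F k x = K x ^ k" for k by (simp add: F_def)
      with True * show ?thesis by simp
    next
      case False
      then have "F k x = 0" for k by (auto simp: F_def)
      with False show ?thesis by auto
    qed
  qed
  finally show ?thesis .
qed

section \<open>The affine flows attached to the extreme value margins\<close>

text \<open>With \<open>t = exp \<tau>\<close> this is the solution at time \<tau> of the affine
  differential equation \<open>x' = s + g * x\<close>. The velocity \<open>s + g * x\<close> is at
  the same time the expression whose sign decides whether \<open>x\<close> lies in the support of
  the margin.\<close>

definition flow :: "real \<Rightarrow> real \<Rightarrow> real \<Rightarrow> real \<Rightarrow> real" where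
  "flow g s t x = t powr g * x + s * box_cox g t"

text \<open>The margins are \<open>exp (- \<kappa> * gev_exponent \<gamma> \<sigma> x)\<close>; this parametrization by
  \<open>(\<gamma>, \<sigma>, \<kappa>)\<close> is better adapted to the relation between \<open>H\<close> and \<open>G\<close> than \<open>(\<gamma>, \<mu>, \<alpha>)\<close>.\<close>

definition gev_exponent :: "real \<Rightarrow> real \<Rightarrow> real \<Rightarrow> real" where
  "gev_exponent g s x = (if g = 0 then exp (- x / s) else (s + g * x) powr (- 1 / g))"

lemma box_cox_1 [simp]: "box_cox g 1 = 0"
  by (simp add: box_cox_def)

lemma flow_1 [simp]: "flow g s 1 x = x"
  by (simp add: flow_def)

lemma flow_0: "flow g s t 0 = s * box_cox g t"
  by (simp add: flow_def)

text \<open>The cocycle identity that makes the maps \<open>flow g s t\<close> a multiplicative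
  group.\<close>

lemma box_cox_mult:
  assumes "0 < t" "0 < u"
  shows "box_cox g (t * u) = t powr g * box_cox g u + box_cox g t"
  using assms by (auto simp: box_cox_def ln_mult powr_mult field_simps)

lemma flow_flow:
  assumes "0 < t" "0 < u"
  shows "flow g s t (flow g s u x) = flow g s (t * u) x"
  using assms by (simp add: flow_def box_cox_mult powr_mult algebra_simps)

lemma flow_inverse:
  assumes "0 < t"
  shows "flow g s t (flow g s (1 / t) x) = x" "flow g s (1 / t) (flow g s t x) = x"
  using assms by (simp_all add: flow_flow)

lemma flow_le_iff: "0 < t \<Longrightarrow> flow g s t x \<le> flow g s t y \<longleftrightarrow> x \<le> y"
  by (simp add: flow_def)

lemma flow_min: "0 < t \<Longrightarrow> flow g s t (min x y) = min (flow g s t x) (flow g s t y)"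
  by (auto simp: min_def flow_le_iff)

text \<open>The velocity is transported by its own flow and so keeps its sign: supports are
  invariant.\<close>

lemma flow_support: "0 < t \<Longrightarrow> s + g * flow g s t x = t powr g * (s + g * x)"
  by (auto simp: flow_def box_cox_def field_simps)

lemma flow_support_pos_iff: "0 < t \<Longrightarrow> 0 < s + g * flow g s t x \<longleftrightarrow> 0 < s + g * x"
  by (simp add: flow_support zero_less_mult_iff)

text \<open>Two values determine an affine map. Normalizing constants are identified in this way,
  because the margins determine the image of a point only inside the support.\<close>

lemma flow_eqI:
  assumes "x \<noteq> y" "a * x + b = flow g s t x" "a * y + b = flow g s t y"
  shows "a = t powr g \<and> b = s * box_cox g t"
proof -
  have "a * (x - y) = t powr g * (x - y)"
    using assms(2,3) by (simp add: flow_def algebra_simps)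
  then have "a = t powr g" using assms(1) by simp
  with assms(2) show ?thesis by (simp add: flow_def)
qed

lemma box_cox_strict_mono:
  assumes "0 < t" "t < u"
  shows "box_cox g t < box_cox g u"
proof (cases g "0::real" rule: linorder_cases)
  case less
  then have "u powr g < t powr g" using assms by (intro powr_less_mono2_neg) auto
  then show ?thesis using less by (simp add: box_cox_def divide_strict_right_mono_neg)
next
  case greater
  then have "t powr g < u powr g" using assms by (intro powr_less_mono2) auto
  then show ?thesis using greater by (simp add: box_cox_def divide_strict_right_mono)
qed (use assms in \<open>simp add: box_cox_def\<close>)

lemma box_cox_nonneg: "1 \<le> t \<Longrightarrow> 0 \<le> box_cox g t"
  using box_cox_strict_mono[of 1 t g] by (cases "t = 1") auto

lemma box_cox_pos: "1 < t \<Longrightarrow> 0 < box_cox g t"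
  using box_cox_strict_mono[of 1 t g] by simp

lemma flow_nonneg: "0 \<le> s \<Longrightarrow> 1 \<le> t \<Longrightarrow> 0 \<le> x \<Longrightarrow> 0 \<le> flow g s t x"
  by (simp add: flow_def box_cox_nonneg)

lemma flow_pos: "0 < s \<Longrightarrow> 1 \<le> t \<Longrightarrow> 0 < x \<Longrightarrow> 0 < flow g s t x"
  by (simp add: flow_def box_cox_nonneg add_pos_nonneg)

lemma flow_0_pos: "0 < s \<Longrightarrow> 1 < t \<Longrightarrow> 0 < flow g s t 0"
  by (simp add: flow_0 box_cox_pos)

lemma gev_exponent_pos: "0 < s + g * x \<Longrightarrow> 0 < gev_exponent g s x"
  by (simp add: gev_exponent_def)

text \<open>The exponent linearizes the flow: moving for time \<open>t\<close> becomes division by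
  \<open>t\<close>.\<close>

lemma gev_exponent_flow:
  assumes "0 < t" "0 < s + g * x"
  shows "gev_exponent g s (flow g s t x) = gev_exponent g s x / t"
proof (cases "g = 0")
  case True
  then have "exp (- (x + s * ln t) / s) = exp (- x / s) * exp (- ln t)"
    using assms by (simp add: exp_add[symmetric] field_simps)
  with True assms show ?thesis
    by (simp add: gev_exponent_def flow_def box_cox_def exp_minus field_simps)
next
  case False
  then have "gev_exponent g s (flow g s t x) = (t powr g * (s + g * x)) powr (- 1 / g)"
    using assms by (simp add: gev_exponent_def flow_support)
  also have "\<dots> = t powr (- 1) * (s + g * x) powr (- 1 / g)"
    using False assms by (simp add: powr_mult powr_powr)
  finally show ?thesis
    using False assms by (simp add: gev_exponent_def powr_minus field_simps)
qed

lemma gev_exponent_strict_antimono: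
  assumes "0 < s + g * x" "0 < s + g * y" "x < y"
  shows "gev_exponent g s y < gev_exponent g s x"
proof (cases g "0::real" rule: linorder_cases)
  case equal
  then show ?thesis using assms by (simp add: gev_exponent_def divide_strict_right_mono)
next
  case less
  then have "s + g * y < s + g * x" using assms by simp
  then have "(s + g * y) powr (- 1 / g) < (s + g * x) powr (- 1 / g)"
    using less assms by (intro powr_less_mono2) (auto simp: field_simps)
  then show ?thesis using less by (simp add: gev_exponent_def)
next
  case greater
  then have "s + g * x < s + g * y" using assms by simp
  then have "(s + g * y) powr (- 1 / g) < (s + g * x) powr (- 1 / g)"
    using greater assms by (intro powr_less_mono2_neg) (auto simp: field_simps)
  then show ?thesis using greater by (simp add: gev_exponent_def)
qed

lemma gev_exponent_inj:
  assumes "0 < s + g * x" "0 < s + g * y" "gev_exponent g s x = gev_exponent g s y"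
  shows "x = y"
  using assms gev_exponent_strict_antimono[of s g x y] gev_exponent_strict_antimono[of s g y x]
  by (cases x y rule: linorder_cases) auto

lemma gev_exponent_surj:
  assumes "0 < k" "g = 0 \<longrightarrow> 0 < s"
  obtains x where "0 < s + g * x" "gev_exponent g s x = k"
proof (cases "g = 0")
  case True
  with assms show ?thesis
    by (intro that[of "- s * ln k"]) (auto simp: gev_exponent_def)
next
  case False
  with assms show ?thesis
    by (intro that[of "(k powr (- g) - s) / g"]) (auto simp: gev_exponent_def powr_powr)
qed

text \<open>Since the exponent is injective on the support, the flow acts transitively there, and
  the required time is the quotient of the exponents.\<close>

lemma flow_to:
  assumes "0 < s + g * x" "0 < s + g * y"
  shows "flow g s (gev_exponent g s x / gev_exponent g s y) x = y"
proof (rule gev_exponent_inj)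
  have "0 < gev_exponent g s x / gev_exponent g s y"
    using assms gev_exponent_pos by simp
  then show "0 < s + g * flow g s (gev_exponent g s x / gev_exponent g s y) x"
    "gev_exponent g s (flow g s (gev_exponent g s x / gev_exponent g s y) x) = gev_exponent g s y"
    using assms gev_exponent_pos[OF assms(1)] gev_exponent_pos[OF assms(2)]
    by (simp_all add: flow_support_pos_iff gev_exponent_flow)
qed (rule assms)

text \<open>A positive \<open>s\<close> pushes 0, and with it the positive half-line, upwards. A
  negative point inside the support reaches 0 at a finite time \<open>T\<close> and is positive from
  then on.\<close>

lemma flow_eventually_pos:
  assumes "0 < s" "0 < g \<longrightarrow> 0 < s + g * x"
  shows "\<forall>\<^sub>F t in at_top. 0 < flow g s t x"
proof (cases "0 < x")
  case True
  show ?thesis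
    using eventually_ge_at_top[of 1] by eventually_elim (use True assms flow_pos in auto)
next
  case False
  have pos: "0 < s + g * x"
  proof (cases "0 < g")
    case False
    then have "0 \<le> g * x" using \<open>\<not> 0 < x\<close> by (intro mult_nonpos_nonpos) auto
    then show ?thesis using assms by simp
  qed (use assms in simp)
  define T where "T = gev_exponent g s x / gev_exponent g s 0"
  have T: "0 < T" "flow g s T x = 0"
    using pos assms gev_exponent_pos[of s g x] gev_exponent_pos[of s g 0] flow_to[of s g x 0] by (auto simp: T_def)
  have "0 < flow g s t x" if "T < t" for t
  proof -
    have "flow g s t x = flow g s (t / T) (flow g s T x)"
      using T that by (subst flow_flow) auto
    also have "\<dots> > 0"
    proof -
      have "1 < t / T" using T that by simp
      then show ?thesis unfolding T using assms by (intro flow_0_pos)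
    qed
    finally show ?thesis .
  qed
  then show ?thesis
    by (rule eventually_mono[OF eventually_gt_at_top[of T]])
qed

lemma gev_exponent_scale:
  assumes "0 < s" "0 < s + g * x"
  shows "gev_exponent g s x = gev_exponent g s 0 * gp_tail g (x / s)"
proof (cases "g = 0")
  case False
  have "s + g * x = s * (1 + g * (x / s))" using assms by (simp add: field_simps)
  moreover have "0 \<le> 1 + g * (x / s)" using assms by (simp add: field_simps)
  ultimately have "(s + g * x) powr (- 1 / g) = s powr (- 1 / g) * (1 + g * (x / s)) powr (- 1 / g)"
    using assms by (simp only: powr_mult)
  then show ?thesis using False by (simp add: gev_exponent_def gp_tail_def)
qed (simp add: gev_exponent_def gp_tail_def)

lemma gp_tail_eq_gev_exponent:
  assumes "0 < \<alpha>"
  obtains \<kappa> where "0 < \<kappa>"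
    "\<And>x. 0 < \<alpha> + g * (x - \<mu>) \<Longrightarrow> gp_tail g ((x - \<mu>) / \<alpha>) = \<kappa> * gev_exponent g (\<alpha> - g * \<mu>) x"
proof (cases "g = 0")
  case True
  with assms show ?thesis
    by (intro that[of "exp (\<mu> / \<alpha>)"]) (auto simp: gp_tail_def gev_exponent_def exp_add[symmetric] diff_divide_distrib)
next
  case False
  show ?thesis
  proof (rule that[of "\<alpha> powr (1 / g)"])
    fix x assume x: "0 < \<alpha> + g * (x - \<mu>)"
    have "1 + g * ((x - \<mu>) / \<alpha>) = (\<alpha> + g * (x - \<mu>)) / \<alpha>"
      using assms by (simp add: field_simps)
    also have "\<alpha> + g * (x - \<mu>) = (\<alpha> - g * \<mu>) + g * x" by (simp add: algebra_simps)
    finally have "gp_tail g ((x - \<mu>) / \<alpha>) = (((\<alpha> - g * \<mu>) + g * x) / \<alpha>) powr (- 1 / g)"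
      using False by (simp add: gp_tail_def)
    also have "\<dots> = ((\<alpha> - g * \<mu>) + g * x) powr (- 1 / g) / \<alpha> powr (- 1 / g)"
      by (rule powr_divide)
    finally show "gp_tail g ((x - \<mu>) / \<alpha>) = \<alpha> powr (1 / g) * gev_exponent g (\<alpha> - g * \<mu>) x"
      using False assms by (simp add: gev_exponent_def powr_minus field_simps)
  qed (use assms in simp)
qed

lemma gev_exponent_eq_gp_tail:
  assumes "0 < \<kappa>" "g = 0 \<longrightarrow> 0 < s"
  obtains \<alpha> \<mu> where "0 < \<alpha>" "s = \<alpha> - g * \<mu>"
    "\<And>x. 0 < \<alpha> + g * (x - \<mu>) \<Longrightarrow> gp_tail g ((x - \<mu>) / \<alpha>) = \<kappa> * gev_exponent g s x"
proof (cases "g = 0")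
  case True
  show ?thesis
  proof (rule that[of s "s * ln \<kappa>"])
    fix x
    have "- ((x - s * ln \<kappa>) / s) = ln \<kappa> + - x / s" using True assms by (simp add: field_simps)
    then have "exp (- ((x - s * ln \<kappa>) / s)) = \<kappa> * exp (- x / s)"
      using assms by (simp only: exp_add exp_ln)
    then show "gp_tail g ((x - s * ln \<kappa>) / s) = \<kappa> * gev_exponent g s x"
      using True by (simp add: gp_tail_def gev_exponent_def)
  qed (use True assms in auto)
next
  case False
  \<comment> \<open>Forced by \<open>\<alpha> powr (1 / g) = \<kappa>\<close>, the factor between
    the two forms of the exponent; the location is then solved from
    \<open>s = \<alpha> - g * \<mu>\<close>.\<close>
  define \<alpha> where "\<alpha> = \<kappa> powr g"
  have \<alpha>: "0 < \<alpha>" using assms by (simp add: \<alpha>_def)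
  show ?thesis
  proof (rule that[OF \<alpha>, of "(\<alpha> - s) / g"])
    show "s = \<alpha> - g * ((\<alpha> - s) / g)" using False by simp
    fix x assume x: "0 < \<alpha> + g * (x - (\<alpha> - s) / g)"
    have eq: "\<alpha> + g * (x - (\<alpha> - s) / g) = s + g * x" using False by (simp add: field_simps)
    have "1 + g * ((x - (\<alpha> - s) / g) / \<alpha>) = (\<alpha> + g * (x - (\<alpha> - s) / g)) / \<alpha>"
      using \<alpha> by (simp add: field_simps)
    then have "gp_tail g ((x - (\<alpha> - s) / g) / \<alpha>) = ((s + g * x) / \<alpha>) powr (- 1 / g)"
      using False by (simp add: gp_tail_def eq)
    also have "\<dots> = (s + g * x) powr (- 1 / g) / \<alpha> powr (- 1 / g)"
      by (rule powr_divide)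
    also have "\<alpha> powr (- 1 / g) = 1 / \<kappa>"
      using False assms by (simp add: \<alpha>_def powr_powr powr_minus field_simps)
    finally show "gp_tail g ((x - (\<alpha> - s) / g) / \<alpha>) = \<kappa> * gev_exponent g s x"
      using False by (simp add: gev_exponent_def)
  qed
qed

section \<open>Generalized extreme value distributions\<close>

definition gev_params ::
  "'i set \<Rightarrow> (('i \<Rightarrow> real) \<Rightarrow> real) \<Rightarrow> ('i \<Rightarrow> real) \<Rightarrow> ('i \<Rightarrow> real) \<Rightarrow> bool" where
  "gev_params I G \<gamma> \<sigma> \<longleftrightarrow> gev_cdf I G \<and>
     (\<exists>\<mu> \<alpha>. gev_margins I G \<gamma> \<mu> \<alpha> \<and> (\<forall>j\<in>I. \<sigma> j = \<alpha> j - \<gamma> j * \<mu> j))"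

lemma gev_cdf_imp_vec_cdf: "gev_cdf I G \<Longrightarrow> vec_cdf I G"
  unfolding gev_cdf_def by unfold_locales (auto intro: real_cdf_imp_ext_cdf)

text \<open>The constants are chosen before \<open>J\<close>: sending coordinates to \<infinity>
  commutes with increasing affine maps, so the constants of the full cdf serve all margins at
  once.\<close>

lemma max_stable_margins:
  assumes "gev_cdf I G" "0 < t"
  obtains a b where "\<And>j. j \<in> I \<Longrightarrow> 0 < a j"
    "\<And>J x. J \<subseteq> I \<Longrightarrow> margin J G (\<lambda>j. a j * x j + b j) powr t = margin J G x"
proof -
  interpret vec_cdf I G by (rule gev_cdf_imp_vec_cdf[OF assms(1)])
  have "max_stable I G"
    using assms(1) by (simp add: gev_cdf_def)
  then obtain a b where a: "\<forall>j\<in>I. 0 < a j" and stable: "\<And>x. G (\<lambda>j. a j * x j + b j) powr t = G x"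
    using assms(2) unfolding max_stable_def by blast
  have "margin J G (\<lambda>j. a j * x j + b j) powr t = margin J G x" if J: "J \<subseteq> I" for J x
  proof (rule LIMSEQ_unique)
    let ?y = "\<lambda>n j. if j \<in> J then x j else real n"
    have "(\<lambda>n. G (\<lambda>j. a j * ?y n j + b j)) \<longlonglongrightarrow> margin J G (\<lambda>j. a j * x j + b j)"
    proof (rule margin_tendsto[OF J])
      fix j assume "j \<in> I - J"
      then have "filterlim (\<lambda>n. b j + a j * real n) at_top sequentially"
        using a by (intro filterlim_tendsto_add_at_top[OF tendsto_const]
            filterlim_tendsto_pos_mult_at_top[OF tendsto_const] filterlim_real_sequentially) auto
      then show "filterlim (\<lambda>n. a j * ?y n j + b j) at_top sequentially"
        using \<open>j \<in> I - J\<close> by (simp add: add.commute)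
    qed (simp add: approximates_const)
    then show "(\<lambda>n. G (\<lambda>j. a j * ?y n j + b j) powr t) \<longlonglongrightarrow> margin J G (\<lambda>j. a j * x j + b j) powr t"
      using assms(2) cdf_nonneg by (intro tendsto_powr') auto
    show "(\<lambda>n. G (\<lambda>j. a j * ?y n j + b j) powr t) \<longlonglongrightarrow> margin J G x"
      unfolding stable using J
      by (intro margin_tendsto_real) auto
  qed
  with a show ?thesis by (intro that[of a b]) blast+
qed

lemma lower_endpoint_less_iff: "lower_endpoint F < ereal x \<longleftrightarrow> (\<exists>y<x. 0 < F y)"
  unfolding lower_endpoint_def Inf_less_iff by auto

text \<open>Positivity of \<open>G\<close> at 0 alone would allow the endpoint to be 0 with an atom
  there. In that case the normalizing map for \<open>t = 2\<close> would have to fix 0, so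
  \<open>margin1 G j 0\<close> would equal its own square, hence be 1, and the margin would be
  degenerate. Only the bare notion \<open>gev_cdf\<close> is available here, because
  \<open>gp_assoc\<close> does not mention parameters.\<close>

lemma lower_endpoint_neg:
  assumes "gev_cdf I G" "0 < G (\<lambda>_. 0)" "j \<in> I"
  shows "lower_endpoint (margin1 G j) < ereal 0"
proof (rule ccontr)
  interpret vec_cdf I G by (rule gev_cdf_imp_vec_cdf[OF assms(1)])
  assume "\<not> ?thesis"
  then have zero: "margin1 G j y = 0" if "y < 0" for y
    using margin1_nonneg[OF assms(3), of y] that unfolding lower_endpoint_less_iff by force
  have pos: "0 < margin1 G j 0"
    using cdf_le_margin1[OF assms(3), of "\<lambda>_. 0"] assms(2) by simp
  obtain a b where "\<And>j. j \<in> I \<Longrightarrow> 0 < a j"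
    and *: "\<And>J x. J \<subseteq> I \<Longrightarrow> margin J G (\<lambda>j. a j * x j + b j) powr 2 = margin J G x"
    using max_stable_margins[OF assms(1), of 2] by (metis zero_less_numeral)
  then have a: "0 < a j" using assms(3) by blast
  have stable: "margin1 G j (a j * x + b j) powr 2 = margin1 G j x" for x
    using *[of "{j}" "\<lambda>_. x"] assms(3) by (simp add: margin_singleton)
  \<comment> \<open>A negative \<open>b j\<close> would map 0 to a point where the margin vanishes;
    a positive one would map some negative point to a positive point, where the margin does not
    vanish.\<close>
  have "b j = 0"
  proof (rule antisym)
    show "0 \<le> b j"
    proof (rule ccontr)
      assume "\<not> 0 \<le> b j"
      then have "margin1 G j (a j * 0 + b j) = 0" using zero by simp
      then show False using stable[of 0] pos by simp
    qed
    show "b j \<le> 0"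
    proof (rule ccontr)
      assume *: "\<not> b j \<le> 0"
      have eq: "a j * (- b j / (2 * a j)) + b j = b j / 2" using a by (simp add: field_simps)
      have "margin1 G j (b j / 2) powr 2 = margin1 G j (- b j / (2 * a j))"
        using stable[of "- b j / (2 * a j)"] unfolding eq .
      also have "\<dots> = 0" using * a by (intro zero) (simp add: divide_neg_pos)
      finally have "margin1 G j (b j / 2) powr 2 = 0" .
      moreover have "margin1 G j 0 \<le> margin1 G j (b j / 2)"
        using * by (intro margin1_mono assms) auto
      ultimately show False using pos by simp
    qed
  qed
  with stable[of 0] have "margin1 G j 0 powr 2 = margin1 G j 0" by simp
  then have "margin1 G j 0 = 1"
    using pos by (simp add: powr_realpow[symmetric] power2_eq_square)
  moreover have "nondegenerate (margin1 G j)"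
    using assms by (simp add: gev_cdf_def)
  then obtain x y where "x < y" "margin1 G j x < margin1 G j y" "margin1 G j y < 1"
    by (auto simp: nondegenerate_def)
  moreover have "margin1 G j y < 1 \<Longrightarrow> y < 0"
    using margin1_mono[OF assms(3), of 0 y] \<open>margin1 G j 0 = 1\<close> by force
  ultimately show False
    using zero[of y] margin1_nonneg[OF assms(3), of x] by simp
qed

locale gev =
  fixes I :: "'i set" and G :: "('i \<Rightarrow> real) \<Rightarrow> real" and \<gamma> \<sigma> :: "'i \<Rightarrow> real"
  assumes gev_params: "gev_params I G \<gamma> \<sigma>"
begin

abbreviation A :: "real \<Rightarrow> ('i \<Rightarrow> real) \<Rightarrow> 'i \<Rightarrow> real" where
  "A t x \<equiv> \<lambda>j. flow (\<gamma> j) (\<sigma> j) t (x j)"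

abbreviation e :: "'i \<Rightarrow> real \<Rightarrow> real" where
  "e j \<equiv> gev_exponent (\<gamma> j) (\<sigma> j)"

lemma gev_cdf: "gev_cdf I G"
  using gev_params by (simp add: gev_params_def)

lemma index: "finite I" "I \<noteq> {}" and real_cdf: "real_cdf I G"
  using gev_cdf by (auto simp: gev_cdf_def)

sublocale vec_cdf I G
  by (rule gev_cdf_imp_vec_cdf[OF gev_cdf])

lemma sigma_pos_if_shape_0:
  assumes "j \<in> I" "\<gamma> j = 0"
  shows "0 < \<sigma> j"
  using gev_params assms by (auto simp: gev_params_def gev_margins_def)

lemma ex_margin_scale:
  assumes "j \<in> I"
  shows "\<exists>\<kappa>>0. \<forall>x. 0 < \<sigma> j + \<gamma> j * x \<longrightarrow> margin1 G j x = exp (- \<kappa> * e j x)"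
proof -
  obtain \<mu> \<alpha> where "gev_margins I G \<gamma> \<mu> \<alpha>" and \<sigma>: "\<sigma> j = \<alpha> j - \<gamma> j * \<mu> j"
    using gev_params assms by (auto simp: gev_params_def)
  then have \<alpha>: "0 < \<alpha> j" and margin: "\<And>x. 0 < \<alpha> j + \<gamma> j * (x - \<mu> j) \<Longrightarrow>
      margin1 G j x = exp (- gp_tail (\<gamma> j) ((x - \<mu> j) / \<alpha> j))"
    using assms by (auto simp: gev_margins_def)
  obtain \<kappa> where "0 < \<kappa>" and \<kappa>: "\<And>x. 0 < \<alpha> j + \<gamma> j * (x - \<mu> j) \<Longrightarrow>
      gp_tail (\<gamma> j) ((x - \<mu> j) / \<alpha> j) = \<kappa> * gev_exponent (\<gamma> j) (\<alpha> j - \<gamma> j * \<mu> j) x"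
    using gp_tail_eq_gev_exponent[OF \<alpha>, where ?g="\<gamma> j" and ?\<mu>="\<mu> j"] by metis
  moreover have "\<alpha> j + \<gamma> j * (x - \<mu> j) = \<sigma> j + \<gamma> j * x" for x
    by (simp add: \<sigma> algebra_simps)
  ultimately show ?thesis
    using margin by (intro exI[of _ \<kappa>]) (auto simp: \<sigma>)
qed

definition \<kappa> :: "'i \<Rightarrow> real" where
  "\<kappa> j = (SOME k. 0 < k \<and> (\<forall>x. 0 < \<sigma> j + \<gamma> j * x \<longrightarrow> margin1 G j x = exp (- k * e j x)))"

lemma \<kappa>_pos: "j \<in> I \<Longrightarrow> 0 < \<kappa> j"
  and margin1_inside: "j \<in> I \<Longrightarrow> 0 < \<sigma> j + \<gamma> j * x \<Longrightarrow> margin1 G j x = exp (- \<kappa> j * e j x)"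
  using someI_ex[OF ex_margin_scale] unfolding \<kappa>_def by blast+

text \<open>The given form of the margin speaks only about the inside of the support. Monotonicity
  settles the rest: inside points with exponent \<open>n\<close> bound the value from above if the
  support has a lower end, those with exponent \<open>1 / n\<close> bound it from below if it has an
  upper end.\<close>

lemma margin1_outside:
  assumes j: "j \<in> I" and x: "\<sigma> j + \<gamma> j * x \<le> 0"
  shows "margin1 G j x = (if 0 < \<gamma> j then 0 else 1)"
proof -
  have ne: "\<gamma> j \<noteq> 0"
    using sigma_pos_if_shape_0[OF j] x by auto
  have ex: "\<exists>y. 0 < \<sigma> j + \<gamma> j * y \<and> e j y = k" if "0 < k" for k
    using gev_exponent_surj[of k "\<gamma> j" "\<sigma> j"] that ne by metis
  have order: "0 < \<sigma> j + \<gamma> j * y \<Longrightarrow> if 0 < \<gamma> j then x < y else y < x" for y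
    using x ne by (smt (verit, ccfv_SIG) mult_left_mono mult_left_mono_neg)
  show ?thesis
  proof (cases "0 < \<gamma> j")
    case True
    have "margin1 G j x \<le> exp (- \<kappa> j * real n)" if "0 < n" for n :: nat
    proof -
      obtain y where y: "0 < \<sigma> j + \<gamma> j * y" "e j y = real n" using ex[of "real n"] \<open>0 < n\<close> by auto
      have "margin1 G j x \<le> margin1 G j y"
        using order[OF y(1)] True by (intro margin1_mono j) auto
      then show ?thesis using margin1_inside[OF j y(1)] y(2) by simp
    qed
    moreover have "(\<lambda>n. exp (- \<kappa> j * real n)) \<longlonglongrightarrow> 0"
      using LIMSEQ_realpow_zero[of "exp (- \<kappa> j)"] \<kappa>_pos[OF j]
      by (simp add: exp_of_nat_mult[symmetric] mult.commute)
    ultimately have "margin1 G j x \<le> 0"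
      by (intro LIMSEQ_le_const) (auto intro: exI[of _ 1])
    with margin1_nonneg[OF j, of x] True show ?thesis by simp
  next
    case False
    have "exp (- \<kappa> j * (1 / real n)) \<le> margin1 G j x" if "0 < n" for n :: nat
    proof -
      obtain y where y: "0 < \<sigma> j + \<gamma> j * y" "e j y = 1 / real n" using ex[of "1 / real n"] \<open>0 < n\<close> by auto
      have "margin1 G j y \<le> margin1 G j x"
        using order[OF y(1)] False by (intro margin1_mono j) auto
      then show ?thesis using margin1_inside[OF j y(1)] y(2) by simp
    qed
    moreover have "(\<lambda>n. exp (- \<kappa> j * (1 / real n))) \<longlonglongrightarrow> 1"
      by (rule tendsto_eq_intros lim_1_over_n refl | simp)+
    ultimately have "1 \<le> margin1 G j x"
      by (intro LIMSEQ_le_const2) (auto intro: exI[of _ 1])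
    with margin1_le_1[OF j, of x] False show ?thesis by simp
  qed
qed

lemma margin1_pos_iff: "j \<in> I \<Longrightarrow> 0 < margin1 G j x \<longleftrightarrow> (0 < \<gamma> j \<longrightarrow> 0 < \<sigma> j + \<gamma> j * x)"
  using margin1_inside[of j x] margin1_outside[of j x] by (cases "0 < \<sigma> j + \<gamma> j * x") auto

lemma margin1_inside_bounds:
  "j \<in> I \<Longrightarrow> 0 < \<sigma> j + \<gamma> j * x \<Longrightarrow> 0 < margin1 G j x \<and> margin1 G j x < 1"
  using margin1_inside[of j x] gev_exponent_pos[of "\<sigma> j" "\<gamma> j" x] \<kappa>_pos[of j] by simp

lemma margin1_bounds_imp_inside:
  "j \<in> I \<Longrightarrow> 0 < margin1 G j x \<Longrightarrow> margin1 G j x < 1 \<Longrightarrow> 0 < \<sigma> j + \<gamma> j * x"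
  using margin1_outside[of j x] by (cases "0 < \<sigma> j + \<gamma> j * x") (auto split: if_splits)

lemma margin1_inj:
  assumes "j \<in> I" "0 < \<sigma> j + \<gamma> j * x" "margin1 G j x = margin1 G j y"
  shows "x = y"
proof -
  have y: "0 < \<sigma> j + \<gamma> j * y"
    using margin1_inside_bounds[OF assms(1,2)] assms by (intro margin1_bounds_imp_inside) auto
  have "e j x = e j y"
    using assms(3) margin1_inside[OF assms(1,2)] margin1_inside[OF assms(1) y] \<kappa>_pos[OF assms(1)] by simp
  then show ?thesis
    by (rule gev_exponent_inj[OF assms(2) y])
qed

lemma margin1_flow:
  assumes "j \<in> I" "0 < \<sigma> j + \<gamma> j * x" "0 < t"
  shows "margin1 G j (flow (\<gamma> j) (\<sigma> j) t x) = margin1 G j x powr (1 / t)"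
  using assms by (simp add: margin1_inside flow_support_pos_iff gev_exponent_flow powr_def)

lemma ex_inside2:
  assumes "j \<in> I"
  obtains x y where "x \<noteq> y" "0 < \<sigma> j + \<gamma> j * x" "0 < \<sigma> j + \<gamma> j * y"
proof -
  obtain x where x: "0 < \<sigma> j + \<gamma> j * x" "e j x = 1"
    using gev_exponent_surj[of 1 "\<gamma> j" "\<sigma> j"] sigma_pos_if_shape_0[OF assms] by auto
  obtain y where y: "0 < \<sigma> j + \<gamma> j * y" "e j y = 2"
    using gev_exponent_surj[of 2 "\<gamma> j" "\<sigma> j"] sigma_pos_if_shape_0[OF assms] by auto
  show ?thesis using x y by (intro that[of x y]) auto
qed

lemma margin_stable:
  assumes t: "0 < t" and J: "J \<subseteq> I"
  shows "margin J G (A t x) powr t = margin J G x"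
proof -
  interpret J: vec_cdf J "margin J G"
    using J ext_cdf_margin index finite_subset by unfold_locales auto
  obtain a b where a: "\<And>j. j \<in> I \<Longrightarrow> 0 < a j"
    and stable: "\<And>J x. J \<subseteq> I \<Longrightarrow> margin J G (\<lambda>j. a j * x j + b j) powr t = margin J G x"
    using max_stable_margins[OF gev_cdf t] by metis
  have "a j = t powr \<gamma> j \<and> b j = \<sigma> j * box_cox (\<gamma> j) t" if j: "j \<in> I" for j
  proof -
    \<comment> \<open>Both arguments give the margin the value
      \<open>margin1 G j x powr (1 / t)\<close>, which lies strictly between 0 and 1, where the
      margin is injective.\<close>
    have eq: "a j * x + b j = flow (\<gamma> j) (\<sigma> j) t x" if x: "0 < \<sigma> j + \<gamma> j * x" for x
    proof (rule sym, rule margin1_inj[OF j])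
      show "0 < \<sigma> j + \<gamma> j * flow (\<gamma> j) (\<sigma> j) t x"
        using x t by (simp add: flow_support_pos_iff)
      have "margin1 G j (a j * x + b j) powr t = margin1 G j x"
        using stable[of "{j}" "\<lambda>_. x"] j by (simp add: margin_singleton)
      moreover have "0 \<le> margin1 G j (a j * x + b j)" by (rule margin1_nonneg[OF j])
      ultimately have "margin1 G j (a j * x + b j) = margin1 G j x powr (1 / t)"
        using t by (metis powr_powr powr_one nonzero_mult_div_cancel_left times_divide_eq_right mult.right_neutral less_irrefl)
      then show "margin1 G j (flow (\<gamma> j) (\<sigma> j) t x) = margin1 G j (a j * x + b j)"
        using margin1_flow[OF j x t] by simp
    qed
    obtain x y where "x \<noteq> y" "0 < \<sigma> j + \<gamma> j * x" "0 < \<sigma> j + \<gamma> j * y"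
      by (rule ex_inside2[OF j])
    then show ?thesis
      by (intro flow_eqI[of x y]) (auto intro: eq)
  qed
  then have "margin J G (A t x) = margin J G (\<lambda>j. a j * x j + b j)"
    using J by (intro J.cdf_cong) (auto simp: flow_def)
  then show ?thesis using stable[OF J] by simp
qed

lemma stable: "0 < t \<Longrightarrow> G (A t x) powr t = G x"
  using margin_stable[of t I x] by (simp add: margin_full)

text \<open>Positive margins do not by themselves give a positive joint cdf. Flowing for time
  \<open>n\<close> replaces each margin by its \<open>n\<close>-th root, which tends to 1, so that
  the union bound makes \<open>G\<close> positive at \<open>A n x\<close>; max-stability carries
  this back to \<open>x\<close>. Thus the set where \<open>G\<close> is positive depends on the
  parameters alone, and cdfs with equal parameters share it.\<close>

lemma cdf_pos_iff: "0 < G x \<longleftrightarrow> (\<forall>j\<in>I. 0 < \<gamma> j \<longrightarrow> 0 < \<sigma> j + \<gamma> j * x j)"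
proof
  assume "0 < G x"
  then show "\<forall>j\<in>I. 0 < \<gamma> j \<longrightarrow> 0 < \<sigma> j + \<gamma> j * x j"
    using cdf_le_margin1[of _ x] margin1_pos_iff by (meson less_le_trans)
next
  assume "\<forall>j\<in>I. 0 < \<gamma> j \<longrightarrow> 0 < \<sigma> j + \<gamma> j * x j"
  then have pos: "0 < margin1 G j (x j)" if "j \<in> I" for j
    using that margin1_pos_iff by auto
  have "(\<lambda>n. \<Sum>j\<in>I. 1 - margin1 G j (x j) powr (1 / real n)) \<longlonglongrightarrow> (\<Sum>j\<in>I. 1 - margin1 G j (x j) powr 0)"
  proof (intro tendsto_sum tendsto_diff tendsto_powr tendsto_const)
    show "(\<lambda>n. 1 / real n) \<longlonglongrightarrow> 0" by (rule lim_1_over_n)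
  qed (metis pos less_irrefl)
  moreover have "(\<Sum>j\<in>I. 1 - margin1 G j (x j) powr 0) = 0"
  proof (rule sum.neutral, rule ballI)
    fix j assume "j \<in> I"
    then show "1 - margin1 G j (x j) powr 0 = 0" using pos[of j] by simp
  qed
  ultimately have "\<forall>\<^sub>F n in sequentially. (\<Sum>j\<in>I. 1 - margin1 G j (x j) powr (1 / real n)) < 1"
    by (intro order_tendstoD(2)) auto
  then obtain n :: nat where n: "0 < n" "(\<Sum>j\<in>I. 1 - margin1 G j (x j) powr (1 / real n)) < 1"
    using eventually_conj[OF _ eventually_gt_at_top[of 0]] eventually_happens[of _ sequentially]
    by (metis (mono_tags, lifting) sequentially_bot)
  have flow: "margin1 G j (A (real n) x j) = margin1 G j (x j) powr (1 / real n)" if "j \<in> I" for j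
  proof -
    have "margin1 G j (A (real n) x j) powr real n = margin1 G j (x j)"
      using margin_stable[of "real n" "{j}" x] n that by (simp add: margin_singleton)
    then have "margin1 G j (x j) powr (1 / real n) = margin1 G j (A (real n) x j) powr (real n * (1 / real n))"
      by (simp only: powr_powr[symmetric])
    then show ?thesis
      using n margin1_nonneg[OF that, of "A (real n) x j"] by simp
  qed
  have "1 - G (A (real n) x) \<le> (\<Sum>j\<in>I. 1 - margin1 G j (A (real n) x j))"
    by (rule one_minus_cdf_le)
  also have "\<dots> < 1" using n flow by simp
  finally have "0 < G (A (real n) x) powr real n" by simp
  also have "\<dots> = G x"
    using n by (intro stable) simp
  finally show "0 < G x" .
qed

lemma lower_endpoint_less_iff_pos:
  assumes j: "j \<in> I"
  shows "lower_endpoint (margin1 G j) < ereal x \<longleftrightarrow> (0 < \<gamma> j \<longrightarrow> 0 < \<sigma> j + \<gamma> j * x)"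
proof -
  have "(\<exists>y<x. 0 < \<gamma> j \<longrightarrow> 0 < \<sigma> j + \<gamma> j * y) \<longleftrightarrow> (0 < \<gamma> j \<longrightarrow> 0 < \<sigma> j + \<gamma> j * x)"
  proof (cases "0 < \<gamma> j")
    case True
    have "0 < \<sigma> j + \<gamma> j * y \<longleftrightarrow> - \<sigma> j / \<gamma> j < y" for y
      using True by (auto simp: field_simps)
    then show ?thesis using True dense[of "- \<sigma> j / \<gamma> j" x] by (auto intro: less_trans)
  next
    case False
    then show ?thesis by (auto intro: exI[of _ "x - 1"])
  qed
  then show ?thesis
    by (simp add: lower_endpoint_less_iff margin1_pos_iff[OF j])
qed

text \<open>Together with the preceding equivalence this is not a dichotomy: for
  \<open>0 < \<gamma> j\<close> a point with \<open>\<sigma> j + \<gamma> j * x = 0\<close> is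
  neither above nor below the endpoint, which is the case left to right-continuity.\<close>

lemma less_lower_endpoint_iff:
  assumes j: "j \<in> I"
  shows "ereal x < lower_endpoint (margin1 G j) \<longleftrightarrow> 0 < \<gamma> j \<and> \<sigma> j + \<gamma> j * x < 0"
proof -
  have "ereal x < lower_endpoint (margin1 G j) \<longleftrightarrow> (\<exists>z>x. \<not> lower_endpoint (margin1 G j) < ereal z)"
  proof
    assume "ereal x < lower_endpoint (margin1 G j)"
    then obtain z where "ereal x < ereal z" "ereal z < lower_endpoint (margin1 G j)"
      using ereal_dense2 by blast
    then show "\<exists>z>x. \<not> lower_endpoint (margin1 G j) < ereal z" by auto
  next
    assume "\<exists>z>x. \<not> lower_endpoint (margin1 G j) < ereal z"
    then obtain z where "ereal x < ereal z" "ereal z \<le> lower_endpoint (margin1 G j)"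
      by (auto simp: not_less)
    then show "ereal x < lower_endpoint (margin1 G j)" by (rule less_le_trans)
  qed
  also have "\<dots> \<longleftrightarrow> 0 < \<gamma> j \<and> (\<exists>z>x. \<sigma> j + \<gamma> j * z \<le> 0)"
    by (auto simp: lower_endpoint_less_iff_pos[OF j] not_less)
  also have "\<dots> \<longleftrightarrow> 0 < \<gamma> j \<and> \<sigma> j + \<gamma> j * x < 0"
  proof (cases "0 < \<gamma> j")
    case True
    have "\<sigma> j + \<gamma> j * y \<le> 0 \<longleftrightarrow> y \<le> - \<sigma> j / \<gamma> j" "\<sigma> j + \<gamma> j * y < 0 \<longleftrightarrow> y < - \<sigma> j / \<gamma> j" for y
      using True by (auto simp: field_simps)
    then show ?thesis using True by (auto intro: less_le_trans)
  qed simp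
  finally show ?thesis .
qed

end

lemma gev_paramsI:
  assumes "finite I" "I \<noteq> {}" "real_cdf I G" "\<And>j. j \<in> I \<Longrightarrow> \<gamma> j = 0 \<Longrightarrow> 0 < \<sigma> j"
    and margins: "\<And>j. j \<in> I \<Longrightarrow> \<exists>\<kappa>>0. \<forall>x. 0 < \<sigma> j + \<gamma> j * x \<longrightarrow>
        margin1 G j x = exp (- \<kappa> * gev_exponent (\<gamma> j) (\<sigma> j) x)"
    and stable: "\<And>t x. 0 < t \<Longrightarrow> G (\<lambda>j. flow (\<gamma> j) (\<sigma> j) t (x j)) powr t = G x"
  shows "gev_params I G \<gamma> \<sigma>"
proof -
  have "nondegenerate (margin1 G j)" if j: "j \<in> I" for j
  proof -
    obtain \<kappa> where \<kappa>: "0 < \<kappa>" "\<forall>x. 0 < \<sigma> j + \<gamma> j * x \<longrightarrow>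
        margin1 G j x = exp (- \<kappa> * gev_exponent (\<gamma> j) (\<sigma> j) x)"
      using margins[OF j] by blast
    obtain x where x: "0 < \<sigma> j + \<gamma> j * x" "gev_exponent (\<gamma> j) (\<sigma> j) x = 2"
      using gev_exponent_surj[of 2 "\<gamma> j" "\<sigma> j"] assms(4)[OF j] by auto
    obtain y where y: "0 < \<sigma> j + \<gamma> j * y" "gev_exponent (\<gamma> j) (\<sigma> j) y = 1"
      using gev_exponent_surj[of 1 "\<gamma> j" "\<sigma> j"] assms(4)[OF j] by auto
    have "x < y"
      using gev_exponent_strict_antimono[OF y(1) x(1)] x y by (cases x y rule: linorder_cases) auto
    moreover have "margin1 G j x < margin1 G j y" "margin1 G j y < 1"
      using \<kappa> x y by auto
    ultimately show ?thesis
      by (auto simp: nondegenerate_def)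
  qed
  moreover have "max_stable I G"
    unfolding max_stable_def
  proof (intro allI impI)
    fix t :: real assume "0 < t"
    then show "\<exists>a b. (\<forall>j\<in>I. 0 < a j) \<and> (\<forall>x. G (\<lambda>j. a j * x j + b j) powr t = G x)"
      using stable[of t]
      by (intro exI[of _ "\<lambda>j. t powr \<gamma> j"] exI[of _ "\<lambda>j. \<sigma> j * box_cox (\<gamma> j) t"]) (auto simp: flow_def)
  qed
  moreover have "\<exists>\<alpha> \<mu>. 0 < \<alpha> \<and> \<sigma> j = \<alpha> - \<gamma> j * \<mu> \<and>
    (\<forall>x. 0 < \<alpha> + \<gamma> j * (x - \<mu>) \<longrightarrow> margin1 G j x = exp (- gp_tail (\<gamma> j) ((x - \<mu>) / \<alpha>)))" if j: "j \<in> I" for j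
  proof -
    obtain \<kappa> where \<kappa>: "0 < \<kappa>" "\<And>x. 0 < \<sigma> j + \<gamma> j * x \<Longrightarrow>
        margin1 G j x = exp (- \<kappa> * gev_exponent (\<gamma> j) (\<sigma> j) x)"
      using margins[OF j] by blast
    obtain \<alpha> \<mu> where *: "0 < \<alpha>" "\<sigma> j = \<alpha> - \<gamma> j * \<mu>"
      "\<And>x. 0 < \<alpha> + \<gamma> j * (x - \<mu>) \<Longrightarrow> gp_tail (\<gamma> j) ((x - \<mu>) / \<alpha>) = \<kappa> * gev_exponent (\<gamma> j) (\<sigma> j) x"
      using gev_exponent_eq_gp_tail[OF \<kappa>(1), of "\<gamma> j" "\<sigma> j"] assms(4)[OF j] by metis
    have "\<alpha> + \<gamma> j * (x - \<mu>) = \<sigma> j + \<gamma> j * x" for x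
      using *(2) by (simp add: algebra_simps)
    with * \<kappa> show ?thesis
      by (intro exI[of _ \<alpha>] exI[of _ \<mu>]) auto
  qed
  then obtain \<alpha> \<mu> where "\<And>j. j \<in> I \<Longrightarrow> 0 < \<alpha> j \<and> \<sigma> j = \<alpha> j - \<gamma> j * \<mu> j \<and>
    (\<forall>x. 0 < \<alpha> j + \<gamma> j * (x - \<mu> j) \<longrightarrow> margin1 G j x = exp (- gp_tail (\<gamma> j) ((x - \<mu> j) / \<alpha> j)))"
    by metis
  ultimately show ?thesis
    using assms(1-3) unfolding gev_params_def gev_cdf_def gev_margins_def by blast
qed

section \<open>Closure of the extreme value class under margins, affine maps, powers and
  products\<close>

text \<open>The new scale is read off from
  \<open>s + g * (a * x + b) = a * ((s + g * b) / a + g * x)\<close>; the shape stays, and what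
  remains is a constant factor.\<close>

lemma gev_exponent_affine:
  assumes "0 < a" and "g = 0 \<longrightarrow> 0 < s"
  obtains c where "0 < c" "\<And>x. 0 < s + g * (a * x + b) \<Longrightarrow>
    gev_exponent g s (a * x + b) = c * gev_exponent g ((s + g * b) / a) x"
proof (cases "g = 0")
  case True
  show ?thesis
  proof (rule that[of "exp (- b / s)"])
    fix x
    have "- (a * x + b) / s = - b / s + - x / (s / a)"
      using True assms by (simp add: field_simps)
    then show "gev_exponent g s (a * x + b) = exp (- b / s) * gev_exponent g ((s + g * b) / a) x"
      using True by (simp add: gev_exponent_def exp_add[symmetric])
  qed simp
next
  case False
  show ?thesis
  proof (rule that[of "a powr (- 1 / g)"])
    fix x assume "0 < s + g * (a * x + b)"
    moreover have eq: "s + g * (a * x + b) = a * ((s + g * b) / a + g * x)"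
      using assms by (simp add: field_simps)
    ultimately show "gev_exponent g s (a * x + b) = a powr (- 1 / g) * gev_exponent g ((s + g * b) / a) x"
      using False assms by (simp add: gev_exponent_def powr_mult[symmetric])
  qed (use assms in simp)
qed

context gev
begin

lemma gev_params_margin:
  assumes "J \<subseteq> I" "J \<noteq> {}"
  shows "gev_params J (margin J G) \<gamma> \<sigma>"
proof (rule gev_paramsI)
  show fin: "finite J" "J \<noteq> {}"
    using assms index finite_subset by auto
  show "real_cdf J (margin J G)"
    unfolding real_cdf_iff[OF fin(1)] using assms real_cdf real_cdf_iff[OF index(1)]
    by (auto simp: ext_cdf_margin margin1_margin)
  show "\<exists>\<kappa>>0. \<forall>x. 0 < \<sigma> j + \<gamma> j * x \<longrightarrow> margin1 (margin J G) j x = exp (- \<kappa> * e j x)" if "j \<in> J" for j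
    using ex_margin_scale[of j] that assms by (auto simp: margin1_margin)
qed (use assms sigma_pos_if_shape_0 margin_stable in auto)

lemma gev_params_affine:
  assumes a: "\<And>j. j \<in> I \<Longrightarrow> 0 < a j"
  shows "gev_params I (\<lambda>x. G (\<lambda>j. a j * x j + b j)) \<gamma> (\<lambda>j. (\<sigma> j + \<gamma> j * b j) / a j)"
proof (rule gev_paramsI)
  show "0 < (\<sigma> j + \<gamma> j * b j) / a j" if "j \<in> I" "\<gamma> j = 0" for j
    using that a sigma_pos_if_shape_0 by simp
  show "\<exists>\<kappa>>0. \<forall>x. 0 < (\<sigma> j + \<gamma> j * b j) / a j + \<gamma> j * x \<longrightarrow>
      margin1 (\<lambda>x. G (\<lambda>j. a j * x j + b j)) j x =
      exp (- \<kappa> * gev_exponent (\<gamma> j) ((\<sigma> j + \<gamma> j * b j) / a j) x)" if j: "j \<in> I" for j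
  proof -
    obtain c where c: "0 < c" "\<And>x. 0 < \<sigma> j + \<gamma> j * (a j * x + b j) \<Longrightarrow>
        e j (a j * x + b j) = c * gev_exponent (\<gamma> j) ((\<sigma> j + \<gamma> j * b j) / a j) x"
      using gev_exponent_affine[OF a[OF j], of "\<gamma> j" "\<sigma> j"] sigma_pos_if_shape_0[OF j] by metis
    have "0 < (\<sigma> j + \<gamma> j * b j) / a j + \<gamma> j * x \<longleftrightarrow> 0 < \<sigma> j + \<gamma> j * (a j * x + b j)" for x
    proof -
      have "\<sigma> j + \<gamma> j * (a j * x + b j) = a j * ((\<sigma> j + \<gamma> j * b j) / a j + \<gamma> j * x)"
        using a[OF j] by (simp add: field_simps)
      then show ?thesis using a[OF j] by (simp add: zero_less_mult_iff)
    qed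
    then show ?thesis
      using c \<kappa>_pos[OF j] margin1_inside[OF j] margin1_affine[OF ext_cdf index(1) a j]
      by (intro exI[of _ "\<kappa> j * c"]) (simp add: mult.assoc)
  qed
  show "G (\<lambda>j. a j * flow (\<gamma> j) ((\<sigma> j + \<gamma> j * b j) / a j) t (x j) + b j) powr t = G (\<lambda>j. a j * x j + b j)"
    if t: "0 < t" for t x
  proof -
    have "G (\<lambda>j. a j * flow (\<gamma> j) ((\<sigma> j + \<gamma> j * b j) / a j) t (x j) + b j) = G (A t (\<lambda>j. a j * x j + b j))"
    proof (rule cdf_cong)
      fix j assume j: "j \<in> I"
      have "\<gamma> j * box_cox (\<gamma> j) t = t powr \<gamma> j - 1"
        using t by (simp add: box_cox_def)
      moreover have "(\<sigma> j + \<gamma> j * b j) * box_cox (\<gamma> j) t + b j =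
          \<sigma> j * box_cox (\<gamma> j) t + (1 + \<gamma> j * box_cox (\<gamma> j) t) * b j"
        by (simp add: algebra_simps)
      ultimately have "(\<sigma> j + \<gamma> j * b j) * box_cox (\<gamma> j) t + b j = \<sigma> j * box_cox (\<gamma> j) t + t powr \<gamma> j * b j"
        by simp
      then show "a j * flow (\<gamma> j) ((\<sigma> j + \<gamma> j * b j) / a j) t (x j) + b j = A t (\<lambda>j. a j * x j + b j) j"
        using a[OF j] by (simp add: flow_def distrib_left)
    qed
    then show ?thesis using stable[OF t] by simp
  qed
qed (use index real_cdf real_cdf_affine a in auto)

lemma power_eq_flow: "0 < t \<Longrightarrow> G x powr t = G (A (1 / t) x)"
  using stable[of t "A (1 / t) x"] by (simp add: flow_inverse)

text \<open>By max-stability a power of \<open>G\<close> is \<open>G\<close> after the flow for time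
  \<open>1 / t\<close>. A change of variables along its own flow leaves \<sigma> unchanged, so
  powers keep both parameters.\<close>

lemma gev_params_power:
  assumes "0 < t"
  shows "gev_params I (\<lambda>x. G x powr t) \<gamma> \<sigma>"
proof -
  have "(\<sigma> j + \<gamma> j * (\<sigma> j * box_cox (\<gamma> j) (1 / t))) / (1 / t) powr \<gamma> j = \<sigma> j" for j
  proof -
    have "\<gamma> j * box_cox (\<gamma> j) (1 / t) = (1 / t) powr \<gamma> j - 1"
      using assms by (simp add: box_cox_def)
    moreover have "\<sigma> j + \<gamma> j * (\<sigma> j * box_cox (\<gamma> j) (1 / t)) = \<sigma> j * (1 + \<gamma> j * box_cox (\<gamma> j) (1 / t))"
      by (simp add: algebra_simps)
    ultimately have "\<sigma> j + \<gamma> j * (\<sigma> j * box_cox (\<gamma> j) (1 / t)) = \<sigma> j * (1 / t) powr \<gamma> j"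
      by simp
    then show ?thesis using assms by simp
  qed
  then show ?thesis
    using gev_params_affine[of "\<lambda>j. (1 / t) powr \<gamma> j" "\<lambda>j. \<sigma> j * box_cox (\<gamma> j) (1 / t)"] assms
    by (simp add: power_eq_flow flow_def)
qed

lemma A_nonneg:
  assumes "1 \<le> t" "\<And>j. j \<in> I \<Longrightarrow> 0 < \<sigma> j" "\<And>j. j \<in> I \<Longrightarrow> 0 \<le> x j" "j \<in> I"
  shows "0 \<le> A t x j"
  using assms by (intro flow_nonneg) (auto intro: less_imp_le)

end

text \<open>Equal parameters mean equal normalizing maps, so both factors are stable under the same
  flow; the factors \<kappa> of the exponents add up.\<close>

lemma gev_params_mult:
  assumes "gev_params I G \<gamma> \<sigma>" "gev_params I G' \<gamma> \<sigma>"
  shows "gev_params I (\<lambda>x. G x * G' x) \<gamma> \<sigma>"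
proof -
  interpret G: gev I G \<gamma> \<sigma> using assms by unfold_locales
  interpret G': gev I G' \<gamma> \<sigma> using assms by unfold_locales
  show ?thesis
  proof (rule gev_paramsI)
    show "\<exists>\<kappa>>0. \<forall>x. 0 < \<sigma> j + \<gamma> j * x \<longrightarrow> margin1 (\<lambda>x. G x * G' x) j x = exp (- \<kappa> * G.e j x)"
      if j: "j \<in> I" for j
      using G.\<kappa>_pos[OF j] G'.\<kappa>_pos[OF j] G.margin1_inside[OF j] G'.margin1_inside[OF j]
      by (intro exI[of _ "G.\<kappa> j + G'.\<kappa> j"])
        (auto simp: margin1_mult[OF G.ext_cdf G'.ext_cdf G.index(1) j] exp_add[symmetric] algebra_simps)
    show "(G (G.A t x) * G' (G.A t x)) powr t = G x * G' x" if "0 < t" for t x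
      using G.stable[OF that] G'.stable[OF that] by (simp add: powr_mult G.cdf_nonneg G'.cdf_nonneg)
  qed (use G.index G.real_cdf G'.real_cdf real_cdf_mult G.sigma_pos_if_shape_0 in auto)
qed

text \<open>For \<open>t > 1\<close> max-stability of \<open>G'\<close> involves \<open>a x + b \<ge> x\<close>, so the values on \<open>[0,\<infinity>)\<close>
  determine the normalizing constants, and these determine \<open>G'\<close> everywhere.\<close>

lemma (in gev) gev_unique:
  assumes \<sigma>: "\<And>j. j \<in> I \<Longrightarrow> 0 < \<sigma> j" and G': "gev_cdf I G'"
    and eq: "\<And>x. (\<And>j. j \<in> I \<Longrightarrow> 0 \<le> x j) \<Longrightarrow> G' x = G x"
  shows "G' = G"
proof
  fix x
  interpret G': vec_cdf I G' by (rule gev_cdf_imp_vec_cdf[OF G'])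
  have margin_eq: "margin1 G' j y = margin1 G j y" if j: "j \<in> I" and y: "0 \<le> y" for j y
  proof (rule LIMSEQ_unique)
    let ?y = "\<lambda>n i. if i = j then y else real n"
    show "(\<lambda>n. G' (?y n)) \<longlonglongrightarrow> margin1 G' j y"
      using j by (intro G'.margin1_tendsto_real) auto
    have "(\<lambda>n. G (?y n)) \<longlonglongrightarrow> margin1 G j y"
      using j by (intro margin1_tendsto_real) auto
    then show "(\<lambda>n. G' (?y n)) \<longlonglongrightarrow> margin1 G j y"
      using y by (subst eq) auto
  qed
  have stable': "G' (A t x) powr t = G' x" if t: "1 < t" for t x
  proof -
    obtain a b where a: "\<And>j. j \<in> I \<Longrightarrow> 0 < a j"
      and st: "\<And>J x. J \<subseteq> I \<Longrightarrow> margin J G' (\<lambda>j. a j * x j + b j) powr t = margin J G' x"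
      using max_stable_margins[OF G', of t] t by (metis less_trans zero_less_one)
    have "a j = t powr \<gamma> j \<and> b j = \<sigma> j * box_cox (\<gamma> j) t" if j: "j \<in> I" for j
    proof -
      have st1: "margin1 G' j (a j * y + b j) powr t = margin1 G' j y" for y
        using st[of "{j}" "\<lambda>_. y"] j by (simp add: G'.margin_singleton)
      have flow_eq: "a j * y + b j = flow (\<gamma> j) (\<sigma> j) t y" if y: "0 \<le> y" "0 < \<sigma> j + \<gamma> j * y" for y
      proof (rule sym, rule margin1_inj[OF j])
        have bounds: "0 < margin1 G' j y" "margin1 G' j y < 1"
          using margin1_inside_bounds[OF j y(2)] margin_eq[OF j y(1)] by auto
        have eq1: "margin1 G' j (a j * y + b j) = margin1 G' j y powr (1 / t)"
        proof -
          have "margin1 G' j y powr (1 / t) = margin1 G' j (a j * y + b j) powr (t * (1 / t))"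
            unfolding st1[of y, symmetric] by (rule powr_powr)
          then show ?thesis using t G'.margin1_nonneg[OF j] by simp
        qed
        have "margin1 G' j y < margin1 G' j y powr (1 / t)"
          using bounds t powr_less_mono'[of "margin1 G' j y" "1 / t" 1] by simp
        then have "y \<le> a j * y + b j"
          using G'.margin1_mono[OF j, of "a j * y + b j" y] eq1 by (cases "y \<le> a j * y + b j") auto
        then show "margin1 G j (flow (\<gamma> j) (\<sigma> j) t y) = margin1 G j (a j * y + b j)"
          using eq1 margin_eq[OF j y(1)] margin_eq[OF j, of "a j * y + b j"] margin1_flow[OF j y(2), of t] y t
          by simp
        show "0 < \<sigma> j + \<gamma> j * flow (\<gamma> j) (\<sigma> j) t y"
          using y t by (simp add: flow_support_pos_iff)
      qed
      \<comment> \<open>Halving the exponent of 0 leads to a second inside point on the nonnegative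
        half-line; 0 and \<open>y\<close> then determine the affine map.\<close>
      obtain y where y: "0 < \<sigma> j + \<gamma> j * y" "e j y = e j 0 / 2"
        using gev_exponent_surj[of "e j 0 / 2" "\<gamma> j" "\<sigma> j"] gev_exponent_pos[of "\<sigma> j" "\<gamma> j" 0]
          \<sigma>[OF j] by auto
      have "0 < y"
      proof (rule ccontr)
        assume "\<not> 0 < y"
        then have "e j 0 \<le> e j y"
          using gev_exponent_strict_antimono[of "\<sigma> j" "\<gamma> j" y 0] y \<sigma>[OF j] by (cases "y = 0") auto
        then show False
          using y gev_exponent_pos[of "\<sigma> j" "\<gamma> j" 0] \<sigma>[OF j] by simp
      qed
      then show ?thesis
        using flow_eq[of 0] flow_eq[of y] \<sigma>[OF j] y by (intro flow_eqI[of 0 y]) auto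
    qed
    then have "G' (A t x) = G' (\<lambda>j. a j * x j + b j)"
      by (intro G'.cdf_cong) (auto simp: flow_def)
    then show ?thesis using st[of I x] by (simp add: G'.margin_full)
  qed
  have inside: "G' x = G x" if "0 < G x" for x
  proof -
    have "\<forall>\<^sub>F t in at_top. \<forall>j\<in>I. 0 < A t x j"
      using that index \<sigma> by (intro eventually_ball_finite ballI flow_eventually_pos) (auto simp: cdf_pos_iff)
    then have "\<forall>\<^sub>F t in at_top. 1 < t \<and> (\<forall>j\<in>I. 0 < A t x j)"
      using eventually_gt_at_top by (rule eventually_conj[rotated])
    then obtain t where t: "1 < t" "\<And>j. j \<in> I \<Longrightarrow> 0 < A t x j"
      using eventually_happens[of _ "at_top :: real filter"] by fastforce
    have "G' x = G' (A t x) powr t"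
      using stable'[OF t(1)] by simp
    also have "\<dots> = G (A t x) powr t"
      using t by (subst eq) (auto intro: less_imp_le)
    also have "\<dots> = G x"
      using t by (intro stable) simp
    finally show ?thesis .
  qed
  show "G' x = G x"
  proof (cases "0 < G x")
    case False
    then obtain j where j: "j \<in> I" "0 < \<gamma> j" "\<sigma> j + \<gamma> j * x j \<le> 0"
      by (force simp: cdf_pos_iff not_less)
    \<comment> \<open>Here \<open>x j\<close> is at or below the lower endpoint. Inside points of
      exponent \<open>n\<close> lie above it, and there the margins of \<open>G'\<close> and
      \<open>G\<close> agree, because the other coordinates can be sent to \<infinity> within the
      region where \<open>G\<close> is positive.\<close>
    have "G' x \<le> exp (- \<kappa> j * real n)" if n: "0 < n" for n :: nat
    proof -
      obtain y where y: "0 < \<sigma> j + \<gamma> j * y" "e j y = real n"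
        using gev_exponent_surj[of "real n" "\<gamma> j" "\<sigma> j"] j n by auto
      have "\<gamma> j * x j < \<gamma> j * y" using y j by linarith
      then have "x j \<le> y" using j by simp
      let ?z = "\<lambda>m i. if i = j then y else real m"
      have "0 < G (?z m)" for m
        using y \<sigma> by (auto simp: cdf_pos_iff intro!: add_pos_nonneg)
      then have "(\<lambda>m. G (?z m)) = (\<lambda>m. G' (?z m))"
        using inside by simp
      moreover have "(\<lambda>m. G (?z m)) \<longlonglongrightarrow> margin1 G j y"
        using j by (intro margin1_tendsto_real) auto
      moreover have "(\<lambda>m. G' (?z m)) \<longlonglongrightarrow> margin1 G' j y"
        using j by (intro G'.margin1_tendsto_real) auto
      ultimately have "margin1 G' j y = margin1 G j y"
        using LIMSEQ_unique by metis
      also have "\<dots> = exp (- \<kappa> j * real n)"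
        using margin1_inside[OF j(1) y(1)] y by simp
      finally show ?thesis
        using G'.cdf_le_margin1[OF j(1), of x] G'.margin1_mono[OF j(1) \<open>x j \<le> y\<close>] by simp
    qed
    moreover have "(\<lambda>n. exp (- \<kappa> j * real n)) \<longlonglongrightarrow> 0"
      using LIMSEQ_realpow_zero[of "exp (- \<kappa> j)"] \<kappa>_pos[OF j(1)]
      by (simp add: exp_of_nat_mult[symmetric] mult.commute)
    ultimately have "G' x \<le> 0"
      by (intro LIMSEQ_le_const) (auto intro: exI[of _ 1])
    with False show ?thesis
      using G'.cdf_nonneg[of x] cdf_nonneg[of x] by simp
  qed (rule inside)
qed

section \<open>Generalized Pareto distributions\<close>

lemma (in gev) margin_pos_iff:
  assumes "J \<subseteq> I"
  shows "0 < margin J G x \<longleftrightarrow> (\<forall>j\<in>J. 0 < \<gamma> j \<longrightarrow> 0 < \<sigma> j + \<gamma> j * x j)"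
proof (cases "J = {}")
  case True
  then show ?thesis by (simp add: margin_eq prob_space)
next
  case False
  interpret J: gev J "margin J G" \<gamma> \<sigma>
    using gev_params_margin[OF assms False] by unfold_locales
  show ?thesis by (rule J.cdf_pos_iff)
qed

text \<open>An endpoint-free form: lying above all lower endpoints means that \<open>G x\<close> is
  positive. Numerator and denominator have the opposite signs of those in the defining formula, so
  that the former is nonnegative and the latter positive.\<close>

lemma (in gev) gp_assoc_iff:
  assumes "0 < G (\<lambda>_. 0)" "G (\<lambda>_. 0) < 1"
  shows "gp_assoc I H G \<longleftrightarrow> ext_cdf I H \<and>
    (\<forall>x. 0 < G x \<longrightarrow> H x = (ln (G x) - ln (G (\<lambda>j. min (x j) 0))) / - ln (G (\<lambda>_. 0))) \<and>
    (\<forall>x. (\<exists>j\<in>I. 0 < \<gamma> j \<and> \<sigma> j + \<gamma> j * x j < 0) \<longrightarrow> H x = 0)"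
proof -
  have "(\<forall>j\<in>I. lower_endpoint (margin1 G j) < ereal (x j)) \<longleftrightarrow> 0 < G x" for x
    by (auto simp: cdf_pos_iff lower_endpoint_less_iff_pos)
  moreover have "(\<exists>j\<in>I. ereal (x j) < lower_endpoint (margin1 G j)) \<longleftrightarrow>
      (\<exists>j\<in>I. 0 < \<gamma> j \<and> \<sigma> j + \<gamma> j * x j < 0)" for x
    by (auto simp: less_lower_endpoint_iff)
  moreover have "1 / ln (G (\<lambda>_. 0)) * ln (G (\<lambda>j. min (x j) 0) / G x) =
      (ln (G x) - ln (G (\<lambda>j. min (x j) 0))) / - ln (G (\<lambda>_. 0))" if "0 < G x" for x
  proof -
    have "0 < G (\<lambda>j. min (x j) 0)"
      using that assms(1) by (auto simp: cdf_pos_iff min_def)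
    then show ?thesis
      using that assms by (simp add: ln_div field_simps)
  qed
  ultimately show ?thesis
    unfolding gp_assoc_def using gev_cdf assms by auto
qed

text \<open>The formula for \<open>H\<close> reaches 0 because 0 lies strictly above all lower
  endpoints.\<close>

lemma gp_cdf_0:
  assumes "gp_cdf I H"
  shows "H (\<lambda>_. 0) = 0"
proof -
  obtain G where G: "gp_assoc I H G" using assms by (auto simp: gp_cdf_def)
  then have "gev_cdf I G" "0 < G (\<lambda>_. 0)" by (auto simp: gp_assoc_def)
  then have "\<forall>j\<in>I. lower_endpoint (margin1 G j) < ereal 0"
    by (intro ballI lower_endpoint_neg)
  moreover have "(\<forall>j\<in>I. lower_endpoint (margin1 G j) < ereal (x j)) \<longrightarrow>
      H x = 1 / ln (G (\<lambda>_. 0)) * ln (G (\<lambda>j. min (x j) 0) / G x)" for x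
    using G unfolding gp_assoc_def by blast
  from this[of "\<lambda>_. 0"] have "(\<forall>j\<in>I. lower_endpoint (margin1 G j) < ereal 0) \<longrightarrow> H (\<lambda>_. 0) = 0"
    using \<open>0 < G (\<lambda>_. 0)\<close> by (simp only: min.idem) simp
  ultimately show ?thesis by blast
qed

text \<open>For \<open>x \<ge> 0\<close> the minimum with 0 is 0, so \<open>H\<close> determines
  \<open>G x\<close> up to the number \<open>ln (G (\<lambda>_. 0))\<close>. No parameters enter, so
  this also applies to a second cdf associated to the same \<open>H\<close>.\<close>

lemma gp_assoc_nonneg:
  assumes "gp_assoc I H G" "\<And>j. j \<in> I \<Longrightarrow> 0 \<le> x j"
  shows "G x = exp (ln (G (\<lambda>_. 0)) * (1 - H x))"
proof -
  have G: "gev_cdf I G" "0 < G (\<lambda>_. 0)" "G (\<lambda>_. 0) < 1"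
    using assms(1) by (auto simp: gp_assoc_def)
  interpret vec_cdf I G by (rule gev_cdf_imp_vec_cdf[OF G(1)])
  have pos: "0 < G x" using G(2) assms(2) by (intro less_le_trans[OF G(2)] cdf_mono) auto
  have "lower_endpoint (margin1 G j) < ereal (x j)" if "j \<in> I" for j
  proof -
    have "lower_endpoint (margin1 G j) < ereal 0" by (rule lower_endpoint_neg[OF G(1,2) that])
    also have "\<dots> \<le> ereal (x j)" using assms(2)[OF that] by simp
    finally show ?thesis .
  qed
  then have "H x = 1 / ln (G (\<lambda>_. 0)) * ln (G (\<lambda>j. min (x j) 0) / G x)"
    using assms(1) by (simp add: gp_assoc_def)
  also have "G (\<lambda>j. min (x j) 0) = G (\<lambda>_. 0)"
    using assms(2) by (intro cdf_cong) auto
  finally have "ln (G (\<lambda>_. 0)) * (1 - H x) = ln (G x)"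
    using G pos by (simp add: ln_div field_simps)
  then show ?thesis using pos by simp
qed

locale gp = gev I G \<gamma> \<sigma> for I :: "'i set" and G \<gamma> \<sigma> +
  fixes H :: "('i \<Rightarrow> real) \<Rightarrow> real"
  assumes assoc: "gp_assoc I H G"
begin

definition v :: real where "v = - ln (G (\<lambda>_. 0))"

text \<open>The exponent function of the margin. Since \<open>ln 0 = 0\<close>, it has the value 0,
  not \<infinity>, where the margin vanishes, so its size is meaningful only where the margin is
  positive.\<close>

definition V :: "'i set \<Rightarrow> ('i \<Rightarrow> real) \<Rightarrow> real" where "V J x = - ln (margin J G x)"

lemma G_0: "0 < G (\<lambda>_. 0)" "G (\<lambda>_. 0) < 1"
  using assoc by (auto simp: gp_assoc_def)

lemma v_pos: "0 < v"
  using G_0 by (simp add: v_def)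

lemma support_0: "j \<in> I \<Longrightarrow> 0 < \<gamma> j \<Longrightarrow> 0 < \<sigma> j"
  using G_0(1) by (auto simp: cdf_pos_iff)

lemma outside_imp_neg:
  assumes "j \<in> I" "0 < \<gamma> j" "\<sigma> j + \<gamma> j * y < 0"
  shows "y < 0"
proof (rule ccontr)
  assume "\<not> y < 0"
  then have "0 \<le> \<gamma> j * y" using assms by simp
  then show False using assms support_0[of j] by simp
qed

sublocale H: vec_cdf I H
  using assoc index by unfold_locales (auto simp: gp_assoc_def)

lemma V_full: "V I x = - ln (G x)"
  by (simp add: V_def margin_full)

lemma V_flow:
  assumes "J \<subseteq> I" "0 < t"
  shows "V J (A t x) = V J x / t"
proof (cases "0 < margin J G (A t x)")
  case True
  have "ln (margin J G x) = t * ln (margin J G (A t x))"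
    using margin_stable[OF assms(2,1), of x] True by (metis ln_powr)
  then show ?thesis using assms(2) by (simp add: V_def)
next
  case False
  moreover have "0 \<le> margin J G (A t x)" using assms(1) by (simp add: margin_eq)
  ultimately have "margin J G (A t x) = 0" by simp
  moreover from this have "margin J G x = 0"
    using margin_stable[OF assms(2,1), of x] by simp
  ultimately show ?thesis by (simp add: V_def)
qed

lemma pos_min: "0 < G x \<Longrightarrow> 0 < G (\<lambda>j. min (x j) 0)"
  using G_0(1) by (auto simp: cdf_pos_iff min_def)

lemma H_eq: "0 < G x \<Longrightarrow> H x = (V I (\<lambda>j. min (x j) 0) - V I x) / v"
  using assoc unfolding gp_assoc_iff[OF G_0] by (simp add: V_full v_def)

lemma H_outside: "j \<in> I \<Longrightarrow> 0 < \<gamma> j \<Longrightarrow> \<sigma> j + \<gamma> j * x j < 0 \<Longrightarrow> H x = 0"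
  using assoc unfolding gp_assoc_iff[OF G_0] by blast

text \<open>Sending the coordinates outside \<open>J\<close> to \<infinity> makes their minimum with
  0 equal to 0. The first term therefore remains a value of the full \<open>V I\<close>, while the
  second becomes \<open>V J\<close>; because of this mismatch a margin of \<open>H\<close> need not
  be a generalized Pareto cdf.\<close>

lemma margin_H_eq:
  assumes "J \<subseteq> I" "0 < margin J G x"
  shows "margin J H x = (V I (\<lambda>j. if j \<in> J then min (x j) 0 else 0) - V J x) / v"
proof -
  let ?y = "\<lambda>n j. if j \<in> J then x j else real n"
  have pos: "0 < G (?y n)" for n
    using assms(2) support_0 unfolding margin_pos_iff[OF assms(1)] cdf_pos_iff
    by (auto intro!: add_pos_nonneg)
  have "(\<lambda>j. min (?y n j) 0) = (\<lambda>j. if j \<in> J then min (x j) 0 else 0)" for n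
    by auto
  then have eq: "(\<lambda>n. H (?y n)) = (\<lambda>n. (V I (\<lambda>j. if j \<in> J then min (x j) 0 else 0) + ln (G (?y n))) / v)"
    using H_eq[OF pos] by (simp add: V_full)
  have lim: "(\<lambda>n. H (?y n)) \<longlonglongrightarrow> margin J H x"
    using assms(1) by (intro H.margin_tendsto_real) auto
  have "(\<lambda>n. (V I (\<lambda>j. if j \<in> J then min (x j) 0 else 0) + ln (G (?y n))) / v) \<longlonglongrightarrow>
    (V I (\<lambda>j. if j \<in> J then min (x j) 0 else 0) + ln (margin J G x)) / v"
    using assms v_pos by (intro tendsto_intros margin_tendsto)
      (auto simp: approximates_const filterlim_real_sequentially)
  from LIMSEQ_unique[OF lim this[folded eq]] show ?thesis
    by (simp add: V_def)
qed

lemma margin_H_outside: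
  assumes "J \<subseteq> I" "j \<in> J" "0 < \<gamma> j" "\<sigma> j + \<gamma> j * x j < 0"
  shows "margin J H x = 0"
proof -
  let ?y = "\<lambda>n j. if j \<in> J then x j else real n"
  have "(\<lambda>n. H (?y n)) \<longlonglongrightarrow> margin J H x"
    using assms(1) by (intro H.margin_tendsto_real) auto
  moreover have "H (?y n) = 0" for n
    using assms by (intro H_outside[of j]) auto
  ultimately show ?thesis by (simp add: LIMSEQ_const_iff)
qed

lemma margin_pos_nonneg:
  assumes "J \<subseteq> I" "\<And>j. j \<in> J \<Longrightarrow> 0 \<le> x j"
  shows "0 < margin J G x"
  unfolding margin_pos_iff[OF assms(1)]
proof (intro ballI impI)
  fix j assume "j \<in> J" "0 < \<gamma> j"
  then show "0 < \<sigma> j + \<gamma> j * x j"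
    using assms by (intro add_pos_nonneg support_0) auto
qed

lemma margin_H_nonneg:
  assumes "J \<subseteq> I" "\<And>j. j \<in> J \<Longrightarrow> 0 \<le> x j"
  shows "margin J H x = 1 - V J x / v"
proof -
  have "(\<lambda>j. if j \<in> J then min (x j) 0 else 0) = (\<lambda>_. 0)"
    using assms(2) by auto
  then have "V I (\<lambda>j. if j \<in> J then min (x j) 0 else 0) = v"
    by (simp add: V_full v_def)
  then show ?thesis
    using margin_H_eq[OF assms(1) margin_pos_nonneg[OF assms]] v_pos by (simp add: diff_divide_distrib)
qed

lemma H_nonneg: "(\<And>j. j \<in> I \<Longrightarrow> 0 \<le> x j) \<Longrightarrow> H x = 1 - V I x / v"
  using margin_H_nonneg[of I x] by (simp add: H.margin_full)

lemma V1_eq: "j \<in> I \<Longrightarrow> 0 < \<sigma> j + \<gamma> j * x j \<Longrightarrow> V {j} x = \<kappa> j * e j (x j)"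
  by (simp add: V_def margin_singleton margin1_inside)

text \<open>The term in \<open>V I\<close> depends on \<open>x\<close> only through its minimum with
  0, so it cancels in the numerator of \<open>pos_cond\<close>, and a quotient of values of
  \<open>V J\<close> remains.\<close>

lemma gp_assoc_pos_cond:
  assumes J: "J \<subseteq> I" "J \<noteq> {}" and less: "margin J H (\<lambda>_. 0) < 1"
  shows "gp_assoc J (pos_cond (margin J H)) (margin J G)"
proof -
  interpret J: gev J "margin J G" \<gamma> \<sigma>
    using gev_params_margin[OF J] by unfold_locales
  interpret HJ: vec_cdf J "margin J H"
    using H.ext_cdf_margin J J.index by unfold_locales auto
  have eq0: "margin J H (\<lambda>_. 0) = 1 - V J (\<lambda>_. 0) / v"
    using margin_H_nonneg[OF J(1)] by simp
  have pos0: "0 < margin J G (\<lambda>_. 0)"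
    using margin_pos_nonneg[OF J(1)] by simp
  have V0: "0 < V J (\<lambda>_. 0)"
    using less eq0 v_pos by (simp add: zero_less_divide_iff)
  then have less1: "margin J G (\<lambda>_. 0) < 1"
    using pos0 by (simp add: V_def)
  show ?thesis
    unfolding J.gp_assoc_iff[OF pos0 less1]
  proof (intro conjI allI impI)
    have "pos_cond (margin J H) =
      (\<lambda>x. (margin J H x - margin J H (\<lambda>j. min (x j) 0)) / (1 - margin J H (\<lambda>_. 0)))"
      by (auto simp: pos_cond_def)
    then show "ext_cdf J (pos_cond (margin J H))"
      using HJ.ext_cdf_cond[OF less] by simp
    show "pos_cond (margin J H) x = (ln (margin J G x) - ln (margin J G (\<lambda>j. min (x j) 0))) / - ln (margin J G (\<lambda>_. 0))"
      if x: "0 < margin J G x" for x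
    proof -
      have "0 < margin J G (\<lambda>j. min (x j) 0)"
        using x pos0 by (auto simp: J.cdf_pos_iff min_def)
      then have "margin J H (\<lambda>j. min (x j) 0) =
          (V I (\<lambda>j. if j \<in> J then min (x j) 0 else 0) - V J (\<lambda>j. min (x j) 0)) / v"
        using margin_H_eq[OF J(1), of "\<lambda>j. min (x j) 0"] by (simp only: min.assoc min.idem)
      then have "margin J H x - margin J H (\<lambda>j. min (x j) 0) = (V J (\<lambda>j. min (x j) 0) - V J x) / v"
        using margin_H_eq[OF J(1) x] by (simp add: diff_divide_distrib)
      then show ?thesis
        using v_pos by (simp add: pos_cond_def eq0) (simp add: V_def)
    qed
    show "pos_cond (margin J H) x = 0" if ex: "\<exists>j\<in>J. 0 < \<gamma> j \<and> \<sigma> j + \<gamma> j * x j < 0" for x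
    proof -
      obtain j where j: "j \<in> J" "0 < \<gamma> j" "\<sigma> j + \<gamma> j * x j < 0" using ex by blast
      then have "\<sigma> j + \<gamma> j * min (x j) 0 < 0"
        using outside_imp_neg[of j "x j"] J by (simp add: min_def subset_iff)
      then show ?thesis
        using j margin_H_outside[OF J(1), of j x] margin_H_outside[OF J(1), of j "\<lambda>j. min (x j) 0"]
        by (simp add: pos_cond_def)
    qed
  qed
qed

text \<open>If \<open>margin J H\<close> vanishes at 0, it vanishes at all nonpositive vectors, and
  conditioning on a positive component changes nothing.\<close>

lemma gp_cdf_margin_iff:
  assumes "J \<subseteq> I" "J \<noteq> {}"
  shows "gp_cdf J (margin J H) \<longleftrightarrow> margin J H (\<lambda>_. 0) = 0"
proof
  assume zero: "margin J H (\<lambda>_. 0) = 0"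
  interpret HJ: vec_cdf J "margin J H"
    using H.ext_cdf_margin assms index finite_subset by unfold_locales auto
  have "margin J H (\<lambda>j. min (x j) 0) = 0" for x
    using HJ.cdf_mono[of "\<lambda>j. min (x j) 0" "\<lambda>_. 0"] HJ.cdf_nonneg[of "\<lambda>j. min (x j) 0"] zero by simp
  then have "pos_cond (margin J H) = margin J H"
    using zero by (auto simp: pos_cond_def)
  then show "gp_cdf J (margin J H)"
    using gp_assoc_pos_cond[OF assms] zero by (auto simp: gp_cdf_def)
qed (rule gp_cdf_0)

lemma pos_cond_margin1:
  assumes j: "j \<in> I" and \<sigma>: "0 < \<sigma> j" and x: "0 \<le> x" "0 < \<sigma> j + \<gamma> j * x"
  shows "pos_cond (margin {j} H) (\<lambda>_. x) = 1 - gp_tail (\<gamma> j) (x / \<sigma> j)"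
proof -
  have eq: "margin {j} H (\<lambda>_. y) = 1 - \<kappa> j * e j y / v" if "0 \<le> y" "0 < \<sigma> j + \<gamma> j * y" for y
    using margin_H_nonneg[of "{j}" "\<lambda>_. y"] V1_eq[of j "\<lambda>_. y"] that j by simp
  define c where "c = \<kappa> j * e j 0 / v"
  have "0 < \<kappa> j * e j 0"
    using \<kappa>_pos[OF j] gev_exponent_pos[of "\<sigma> j" "\<gamma> j" 0] \<sigma> by simp
  then have c: "0 < c" using v_pos by (simp add: c_def)
  have "e j x = e j 0 * gp_tail (\<gamma> j) (x / \<sigma> j)"
    by (rule gev_exponent_scale[OF \<sigma> x(2)])
  then have eqx: "margin {j} H (\<lambda>_. x) = 1 - c * gp_tail (\<gamma> j) (x / \<sigma> j)"
    using eq[OF x] by (simp add: c_def)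
  have eq0: "margin {j} H (\<lambda>_. 0) = 1 - c"
    using eq[of 0] \<sigma> by (simp add: c_def)
  have "min x 0 = 0" using x by simp
  then show ?thesis
    unfolding pos_cond_def eqx eq0 using c by (simp only: eq0) (simp add: field_simps)
qed

lemma gp_power:
  assumes t: "0 < t"
  shows "gp_assoc I H (\<lambda>x. G x powr t)"
proof -
  interpret G': gev I "\<lambda>x. G x powr t" \<gamma> \<sigma>
    using gev_params_power[OF t] by unfold_locales
  have *: "0 < G (\<lambda>_. 0) powr t" "G (\<lambda>_. 0) powr t < 1"
    using G_0 t powr_less_mono2[of t "G (\<lambda>_. 0)" 1] by auto
  show ?thesis
    unfolding G'.gp_assoc_iff[OF *]
  proof (intro conjI allI impI)
    show "H x = (ln (G x powr t) - ln (G (\<lambda>j. min (x j) 0) powr t)) / - ln (G (\<lambda>_. 0) powr t)"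
      if "0 < G x powr t" for x
    proof -
      have x: "0 < G x" using that cdf_nonneg[of x] by (cases "G x = 0") auto
      have "ln (G x powr t) - ln (G (\<lambda>j. min (x j) 0) powr t) = t * (V I (\<lambda>j. min (x j) 0) - V I x)"
        using x pos_min[OF x] by (simp add: V_full algebra_simps)
      moreover have "- ln (G (\<lambda>_. 0) powr t) = t * v"
        using G_0 by (simp add: v_def)
      ultimately show ?thesis using H_eq[OF x] t by simp
    qed
  qed (use H.ext_cdf H_outside in auto)
qed

text \<open>Scaling and exceedance over a threshold are treated together: the conditioned and
  rescaled vector belongs to \<open>G\<close> after the same affine change. For
  \<open>u \<ge> 0\<close> the negative part of \<open>a * x + u\<close> depends only on the
  negative part of \<open>x\<close>, so the corresponding terms of \<open>H\<close> cancel.\<close>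

lemma gp_affine_cond:
  assumes a: "\<And>j. j \<in> I \<Longrightarrow> 0 < a j" and u: "\<And>j. j \<in> I \<Longrightarrow> 0 \<le> u j" and less: "H u < 1"
  shows "gp_assoc I (\<lambda>x. (H (\<lambda>j. a j * x j + u j) - H (\<lambda>j. a j * min (x j) 0 + u j)) / (1 - H u))
    (\<lambda>x. G (\<lambda>j. a j * x j + u j))"
proof -
  let ?G = "\<lambda>x. G (\<lambda>j. a j * x j + u j)"
  interpret G': gev I ?G \<gamma> "\<lambda>j. (\<sigma> j + \<gamma> j * u j) / a j"
    using gev_params_affine[OF a] by unfold_locales
  have Gu: "0 < G u" using u G_0 by (intro less_le_trans[OF G_0(1)] cdf_mono) auto
  have Hu: "H u = 1 - V I u / v" using u by (rule H_nonneg)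
  then have "0 < V I u" using less v_pos by (simp add: zero_less_divide_iff)
  then have G': "0 < ?G (\<lambda>_. 0)" "?G (\<lambda>_. 0) < 1"
    using Gu by (simp_all add: V_full)
  show ?thesis
    unfolding G'.gp_assoc_iff[OF G']
  proof (intro conjI allI impI)
    have "ext_cdf I (\<lambda>x. (H x - H (\<lambda>j. min (x j) (u j))) / (1 - H u))"
      by (rule H.ext_cdf_cond[OF less])
    from ext_cdf_affine[OF this index(1) a, where b=u]
    have "ext_cdf I (\<lambda>x. (H (\<lambda>j. a j * x j + u j) - H (\<lambda>j. min (a j * x j + u j) (u j))) / (1 - H u))"
      by simp
    moreover have "H (\<lambda>j. min (a j * x j + u j) (u j)) = H (\<lambda>j. a j * min (x j) 0 + u j)" for x
      using a by (intro H.cdf_cong) (simp add: min_mult_distrib_left less_imp_le min_add_distrib_left)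
    ultimately show "ext_cdf I (\<lambda>x. (H (\<lambda>j. a j * x j + u j) - H (\<lambda>j. a j * min (x j) 0 + u j)) / (1 - H u))"
      by simp
    show "(H (\<lambda>j. a j * x j + u j) - H (\<lambda>j. a j * min (x j) 0 + u j)) / (1 - H u) =
      (ln (?G x) - ln (?G (\<lambda>j. min (x j) 0))) / - ln (?G (\<lambda>_. 0))" if x: "0 < ?G x" for x
    proof -
      have x': "0 < ?G (\<lambda>j. min (x j) 0)"
        using x G'(1) unfolding G'.cdf_pos_iff by (auto simp: min_def)
      have "V I (\<lambda>j. min (a j * x j + u j) 0) = V I (\<lambda>j. min (a j * min (x j) 0 + u j) 0)"
        unfolding V_full
      proof (intro arg_cong[where f="\<lambda>x. - ln x"] cdf_cong)
        fix j assume j: "j \<in> I"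
        show "min (a j * x j + u j) 0 = min (a j * min (x j) 0 + u j) 0"
        proof (cases "x j \<le> 0")
          case False
          then have "0 \<le> a j * x j" using a[OF j] by simp
          then show ?thesis using False u[OF j] by (simp add: min_def)
        qed simp
      qed
      then have "H (\<lambda>j. a j * x j + u j) - H (\<lambda>j. a j * min (x j) 0 + u j) =
          (ln (?G x) - ln (?G (\<lambda>j. min (x j) 0))) / v"
        using H_eq[OF x] H_eq[OF x'] by (simp add: V_full diff_divide_distrib[symmetric])
      then show ?thesis
        using v_pos by (simp add: Hu) (simp add: V_full)
    qed
    show "(H (\<lambda>j. a j * x j + u j) - H (\<lambda>j. a j * min (x j) 0 + u j)) / (1 - H u) = 0"
      if ex: "\<exists>j\<in>I. 0 < \<gamma> j \<and> (\<sigma> j + \<gamma> j * u j) / a j + \<gamma> j * x j < 0" for x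
    proof -
      obtain j where j: "j \<in> I" "0 < \<gamma> j" "(\<sigma> j + \<gamma> j * u j) / a j + \<gamma> j * x j < 0"
        using ex by blast
      have "a j * ((\<sigma> j + \<gamma> j * u j) / a j + \<gamma> j * x j) < 0"
        using j a[OF j(1)] by (simp add: mult_less_0_iff)
      moreover have "a j * ((\<sigma> j + \<gamma> j * u j) / a j + \<gamma> j * x j) = \<sigma> j + \<gamma> j * (a j * x j + u j)"
        using a[OF j(1)] by (simp add: field_simps)
      ultimately have 1: "\<sigma> j + \<gamma> j * (a j * x j + u j) < 0" by simp
      have "a j * min (x j) 0 \<le> a j * x j"
        using a[OF j(1)] by simp
      then have "\<gamma> j * (a j * min (x j) 0 + u j) \<le> \<gamma> j * (a j * x j + u j)"
        using j(2) by simp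
      with 1 have "\<sigma> j + \<gamma> j * (a j * min (x j) 0 + u j) < 0" by linarith
      then show ?thesis
        using H_outside[OF j(1,2), of "\<lambda>j. a j * x j + u j"] 1
          H_outside[OF j(1,2), of "\<lambda>j. a j * min (x j) 0 + u j"] by simp
    qed
  qed
qed

lemma H_flow_0:
  assumes "1 \<le> t" "\<And>j. j \<in> I \<Longrightarrow> 0 < \<sigma> j"
  shows "H (A t (\<lambda>_. 0)) = 1 - 1 / t"
proof -
  have "H (A t (\<lambda>_. 0)) = 1 - V I (A t (\<lambda>_. 0)) / v"
    using assms by (intro H_nonneg A_nonneg) auto
  also have "V I (A t (\<lambda>_. 0)) = v / t"
    using assms(1) by (subst V_flow) (auto simp: V_full v_def)
  finally show ?thesis using v_pos by simp
qed

text \<open>As \<sigma> is positive, the flow moves 0 upwards, so the images of \<open>x\<close> and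
  of its minimum with 0 have the same negative part. Their difference under \<open>H\<close> reduces
  to values of \<open>V\<close>, which the flow divides by \<open>t\<close>. Points on the boundary
  of the support are reached from the right.\<close>

lemma threshold_stable:
  assumes t: "1 \<le> t" and \<sigma>: "\<And>j. j \<in> I \<Longrightarrow> 0 < \<sigma> j"
  shows "H x = t * (H (A t x) - H (A t (\<lambda>j. min (x j) 0)))"
proof -
  have inside: "H x = t * (H (A t x) - H (A t (\<lambda>j. min (x j) 0)))" if x: "0 < G x" for x
  proof -
    have pos: "0 < G (A t y)" if "0 < G y" for y
      using that t by (auto simp: cdf_pos_iff flow_support_pos_iff)
    have "V I (\<lambda>j. min (A t x j) 0) = V I (\<lambda>j. min (A t (\<lambda>j. min (x j) 0) j) 0)"
      unfolding V_full
    proof (intro arg_cong[where f="\<lambda>x. - ln x"] cdf_cong)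
      fix j assume "j \<in> I"
      then have "0 \<le> flow (\<gamma> j) (\<sigma> j) t 0"
        using t \<sigma> by (intro flow_nonneg) (auto intro: less_imp_le)
      then show "min (A t x j) 0 = min (A t (\<lambda>j. min (x j) 0) j) 0"
        using t by (simp add: flow_min)
    qed
    then have "H (A t x) - H (A t (\<lambda>j. min (x j) 0)) = (V I (A t (\<lambda>j. min (x j) 0)) - V I (A t x)) / v"
      using H_eq[OF pos[OF x]] H_eq[OF pos[OF pos_min[OF x]]] by (simp add: diff_divide_distrib)
    also have "\<dots> = H x / t"
      using t H_eq[OF x] V_flow[of I t x] V_flow[of I t "\<lambda>j. min (x j) 0"]
      by (simp add: diff_divide_distrib mult.commute)
    finally show ?thesis using t by simp
  qed
  show ?thesis
  proof (cases "\<exists>j\<in>I. 0 < \<gamma> j \<and> \<sigma> j + \<gamma> j * x j < 0")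
    case True
    then obtain j where j: "j \<in> I" "0 < \<gamma> j" "\<sigma> j + \<gamma> j * x j < 0" by blast
    then have "x j < 0"
      by (rule outside_imp_neg)
    then have "\<sigma> j + \<gamma> j * min (x j) 0 < 0"
      using j by simp
    then have "\<sigma> j + \<gamma> j * A t x j < 0" "\<sigma> j + \<gamma> j * A t (\<lambda>j. min (x j) 0) j < 0"
      using j t by (auto simp: flow_support mult_less_0_iff)
    then show ?thesis
      using H_outside[OF j(1,2)] j(3) by simp
  next
    case False
    let ?y = "\<lambda>n j. x j + 1 / real (Suc n)"
    have eq: "H (?y n) = t * (H (A t (?y n)) - H (A t (\<lambda>j. min (?y n j) 0)))" for n
    proof (rule inside, unfold cdf_pos_iff, intro ballI impI)
      fix j assume j: "j \<in> I" "0 < \<gamma> j"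
      then have "0 \<le> \<sigma> j + \<gamma> j * x j" using False by force
      moreover have "0 < \<gamma> j * (1 / real (Suc n))" using j by simp
      ultimately show "0 < \<sigma> j + \<gamma> j * ?y n j" unfolding distrib_left by linarith
    qed
    have y: "(\<lambda>n. ?y n j) \<longlonglongrightarrow> x j" for j
      using tendsto_add[OF tendsto_const LIMSEQ_Suc[OF lim_1_over_n], of "x j"] by simp
    have lim: "(\<lambda>n. H (?y n)) \<longlonglongrightarrow> H x"
      using y by (intro H.cdf_right_continuous) auto
    have "(\<lambda>n. t * (H (A t (?y n)) - H (A t (\<lambda>j. min (?y n j) 0)))) \<longlonglongrightarrow>
        t * (H (A t x) - H (A t (\<lambda>j. min (x j) 0)))"
    proof (intro tendsto_intros H.cdf_right_continuous)
      fix j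
      have flow: "(\<lambda>n. flow (\<gamma> j) (\<sigma> j) t (z n)) \<longlonglongrightarrow> flow (\<gamma> j) (\<sigma> j) t z'" if "z \<longlonglongrightarrow> z'" for z z'
        unfolding flow_def using that by (intro tendsto_intros)
      show "(\<lambda>n. A t (?y n) j) \<longlonglongrightarrow> A t x j"
        by (rule flow[OF y])
      show "(\<lambda>n. A t (\<lambda>j. min (?y n j) 0) j) \<longlonglongrightarrow> A t (\<lambda>j. min (x j) 0) j"
        by (rule flow) (intro tendsto_min y tendsto_const)
    qed (use t in \<open>auto simp: flow_le_iff min_def\<close>)
    from LIMSEQ_unique[OF lim this[folded eq]] show ?thesis .
  qed
qed

lemma cond_prob_threshold:
  assumes X: "has_cdf P I X H" and t: "1 \<le> t" and \<sigma>: "\<And>j. j \<in> I \<Longrightarrow> 0 < \<sigma> j"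
  shows "cond_prob P (\<lambda>\<omega>. \<forall>j\<in>I. ereal (1 / t powr \<gamma> j) * (X j \<omega> - ereal (\<sigma> j * box_cox (\<gamma> j) t)) \<le> ereal (x j))
      (\<lambda>\<omega>. \<not> (\<forall>j\<in>I. X j \<omega> \<le> ereal (\<sigma> j * box_cox (\<gamma> j) t))) = H x"
proof -
  interpret X: cdf_of P I X H
    using X index by unfold_locales
  let ?u = "\<lambda>j. \<sigma> j * box_cox (\<gamma> j) t"
  have u: "?u = A t (\<lambda>_. 0)" by (simp add: flow_0)
  have "cond_prob P (\<lambda>\<omega>. \<forall>j\<in>I. ereal (1 / t powr \<gamma> j) * (X j \<omega> - ereal (?u j)) \<le> ereal (x j))
      (\<lambda>\<omega>. \<not> (\<forall>j\<in>I. X j \<omega> \<le> ereal (?u j))) =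
    cond_prob P (\<lambda>\<omega>. \<forall>j\<in>I. X j \<omega> \<le> ereal (A t x j)) (\<lambda>\<omega>. \<not> (\<forall>j\<in>I. X j \<omega> \<le> ereal (?u j)))"
    using t by (simp add: ereal_affine_le_iff flow_def)
  also have "\<dots> = (H (A t x) - H (\<lambda>j. min (A t x j) (?u j))) / (1 - H ?u)"
    by (rule X.cond_prob_eq)
  also have "(\<lambda>j. min (A t x j) (?u j)) = A t (\<lambda>j. min (x j) 0)"
    using t by (simp add: flow_min flow_0)
  also have "1 - H ?u = 1 / t"
    unfolding u using H_flow_0[OF t \<sigma>] by simp
  finally show ?thesis
    using threshold_stable[OF t \<sigma>, of x] t by simp
qed

end

lemma gp_params_iff: "gp_params I H \<gamma> \<sigma> \<longleftrightarrow> (\<exists>G. gp I G \<gamma> \<sigma> H)"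
proof -
  have "gp_assoc I H G \<Longrightarrow> gev_cdf I G" for G
    by (simp add: gp_assoc_def)
  then show ?thesis
    unfolding gp_params_def gp_def gev_def gp_axioms_def gev_params_def by blast
qed

lemma gp_params_imp_gp_cdf: "gp_params I H \<gamma> \<sigma> \<Longrightarrow> gp_cdf I H"
  unfolding gp_params_def gp_cdf_def by blast

lemma (in gp) gp_params: "gp_params I H \<gamma> \<sigma>"
  unfolding gp_params_iff using gp_axioms by blast

subsection \<open>Threshold-stable distributions are generalized Pareto\<close>

text \<open>Threshold stability is required only where the flow has moved the minimum of
  \<open>x\<close> with 0 into the open positive orthant. Limits of cdfs can be controlled there,
  and every point inside the support arrives there for large \<open>t\<close>, so this recovers
  \<open>V\<close> on the whole support. The assumption \<open>less_1\<close> gives each margin of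
  the reconstructed cdf a positive exponent.\<close>

lemma gp_reconstruct:
  fixes I :: "'i set" and \<gamma> \<sigma> :: "'i \<Rightarrow> real" and K :: "('i \<Rightarrow> real) \<Rightarrow> real"
  defines "A \<equiv> \<lambda>t x j. flow (\<gamma> j) (\<sigma> j) t (x j)"
  assumes fin: "finite I" "I \<noteq> {}" and ext: "ext_cdf I K" and \<sigma>: "\<And>j. j \<in> I \<Longrightarrow> 0 < \<sigma> j"
    and outside: "\<And>x j. j \<in> I \<Longrightarrow> 0 < \<gamma> j \<Longrightarrow> \<sigma> j + \<gamma> j * x j < 0 \<Longrightarrow> K x = 0"
    and less_1: "\<And>j. j \<in> I \<Longrightarrow> margin1 K j 0 < 1"
    and threshold: "\<And>t x. 1 \<le> t \<Longrightarrow> (\<And>j. j \<in> I \<Longrightarrow> 0 < A t (\<lambda>j. min (x j) 0) j) \<Longrightarrow>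
      K x = t * (K (A t x) - K (A t (\<lambda>j. min (x j) 0)))"
  shows "gp_params I K \<gamma> \<sigma>"
proof -
  interpret K: vec_cdf I K using ext fin by unfold_locales
  have A_A: "A t (A u x) = A (t * u) x" if "0 < t" "0 < u" for t u x
    using that by (simp add: A_def flow_flow)
  have A_1 [simp]: "A 1 x = x" for x by (simp add: A_def)
  have A_nonneg: "0 \<le> A t x j" if "1 \<le> t" "\<And>j. j \<in> I \<Longrightarrow> 0 \<le> x j" "j \<in> I" for t x j
    unfolding A_def using that \<sigma> by (intro flow_nonneg) (auto intro: less_imp_le)
  have th0: "K x = t * (K (A t x) - K (A t (\<lambda>_. 0)))" if t: "1 < t" and x: "\<And>j. j \<in> I \<Longrightarrow> 0 \<le> x j" for t x
  proof -
    have "K (A t (\<lambda>j. min (x j) 0)) = K (A t (\<lambda>_. 0))"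
      using x by (intro K.cdf_cong) (simp add: A_def)
    moreover have "0 < A t (\<lambda>j. min (x j) 0) j" if "j \<in> I" for j
      using x[OF that] \<sigma>[OF that] t by (simp add: A_def flow_0_pos)
    ultimately show ?thesis using threshold[of t x] t by simp
  qed
  have K_0: "K (\<lambda>_. 0) = 0"
    using th0[of 2 "\<lambda>_. 0"] by simp
  \<comment> \<open>Let all coordinates of \<open>x\<close> tend to \<infinity> in
    \<open>th0\<close>: the left side tends to 1, which fixes the value of \<open>K\<close> at the
    image of 0.\<close>
  have K_A_0: "K (A t (\<lambda>_. 0)) = 1 - 1 / t" if t: "1 < t" for t
  proof -
    have "(\<lambda>n. K (\<lambda>_. real n)) \<longlonglongrightarrow> margin {} K (\<lambda>_. 0)"
      by (intro K.margin_tendsto) (auto simp: filterlim_real_sequentially)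
    then have lim: "(\<lambda>n. K (\<lambda>_. real n)) \<longlonglongrightarrow> 1"
      by (simp add: K.margin_eq K.prob_space)
    have "(\<lambda>n. K (A t (\<lambda>_. real n))) \<longlonglongrightarrow> margin {} K (\<lambda>_. 0)"
      unfolding A_def flow_def using t
      by (intro K.margin_tendsto filterlim_affine_at_top filterlim_real_sequentially) auto
    then have "(\<lambda>n. K (A t (\<lambda>_. real n))) \<longlonglongrightarrow> 1"
      by (simp add: K.margin_eq K.prob_space)
    then have "(\<lambda>n. t * (K (A t (\<lambda>_. real n)) - K (A t (\<lambda>_. 0)))) \<longlonglongrightarrow> t * (1 - K (A t (\<lambda>_. 0)))"
      by (intro tendsto_intros)
    moreover have "K (\<lambda>_. real n) = t * (K (A t (\<lambda>_. real n)) - K (A t (\<lambda>_. 0)))" for n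
      using th0[OF t, of "\<lambda>_. real n"] by simp
    ultimately have "t * (1 - K (A t (\<lambda>_. 0))) = 1"
      using LIMSEQ_unique[OF lim] by simp
    then show ?thesis using t by (simp add: field_simps)
  qed
  have homogeneous: "1 - K (A t x) = (1 - K x) / t" if t: "1 \<le> t" and x: "\<And>j. j \<in> I \<Longrightarrow> 0 \<le> x j" for t x
  proof (cases "t = 1")
    case False
    then have "1 < t" using t by simp
    have "K x = t * (K (A t x) - K (A t (\<lambda>_. 0)))"
      by (rule th0[OF \<open>1 < t\<close> x])
    then have "K x / t = K (A t x) - (1 - 1 / t)"
      using \<open>1 < t\<close> by (simp add: K_A_0)
    then show ?thesis
      by (simp add: diff_divide_distrib)
  qed simp
  \<comment> \<open>The times at which \<open>x\<close> has entered the nonnegative orthant, where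
    \<open>t * (1 - K (A t x))\<close> can serve as \<open>V x\<close>. Homogeneity makes this value
    independent of the time.\<close>
  define good where "good t x \<longleftrightarrow> 0 < t \<and> (\<forall>j\<in>I. 0 \<le> A t x j)" for t x
  have same: "t * (1 - K (A t x)) = u * (1 - K (A u x))" if "good t x" "good u x" for t u x
  proof -
    have le: "t * (1 - K (A t x)) = u * (1 - K (A u x))" if "t \<le> u" "good t x" "good u x" for t u
    proof -
      have pos: "0 < t" "0 < u" using that by (auto simp: good_def)
      then have "A u x = A (u / t) (A t x)"
        by (subst A_A) auto
      then have "1 - K (A u x) = (1 - K (A t x)) / (u / t)"
        using that pos homogeneous[of "u / t" "A t x"] by (simp add: good_def)
      then show ?thesis using pos by (simp add: field_simps)
    qed
    show ?thesis
    proof (cases "t \<le> u")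
      case True
      then show ?thesis using le that by blast
    next
      case False
      then show ?thesis using le[of u t] that by simp
    qed
  qed
  \<comment> \<open>No time is good exactly if some coordinate of \<open>x\<close> is at or below
    its lower endpoint, hence the value 0.\<close>
  define G where "G x = (if \<exists>t. good t x then exp (- ((SOME t. good t x) * (1 - K (A (SOME t. good t x) x)))) else 0)" for x
  have G_good: "G x = exp (- (t * (1 - K (A t x))))" if "good t x" for t x
  proof -
    let ?T = "SOME t. good t x"
    have "good ?T x" using that by (rule someI)
    then have "?T * (1 - K (A ?T x)) = t * (1 - K (A t x))" using that by (rule same)
    moreover have "\<exists>t. good t x" using that by blast
    ultimately show ?thesis by (simp only: G_def if_True)
  qed
  have G_bad: "G x = 0" if "\<And>t. \<not> good t x" for x
    using that by (simp add: G_def)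
  have good_mono: "good u x" if "good t x" "t \<le> u" for t u x
  proof -
    have pos: "0 < t" "0 < u" using that by (auto simp: good_def)
    then have eq: "A (u / t) (A t x) = A u x"
      by (subst A_A) auto
    have "0 \<le> A (u / t) (A t x) j" if "j \<in> I" for j
      using \<open>good t x\<close> \<open>t \<le> u\<close> pos that
      by (intro A_nonneg[of "u / t" "A t x"]) (simp_all add: good_def)
    then show ?thesis
      using pos by (simp add: good_def eq)
  qed
  \<comment> \<open>The point that reaches 0 at time \<open>n + 1\<close>, so
    \<open>c n \<le> x\<close> says that \<open>real (Suc n)\<close> is a good time for
    \<open>x\<close>. The regions grow because 0 flows downwards for times below 1.\<close>
  define c where "c n j = flow (\<gamma> j) (\<sigma> j) (1 / real (Suc n)) 0" for n j
  have good_c: "good (real (Suc n)) x \<longleftrightarrow> (\<forall>j\<in>I. c n j \<le> x j)" for n x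
  proof -
    have "0 \<le> A (real (Suc n)) x j \<longleftrightarrow> c n j \<le> x j" for j
      using flow_le_iff[of "real (Suc n)" "\<gamma> j" "\<sigma> j" "c n j" "x j"]
        flow_inverse(1)[of "real (Suc n)" "\<gamma> j" "\<sigma> j" 0] by (simp add: A_def c_def)
    then show ?thesis by (simp add: good_def)
  qed
  define Q where "Q r x = (if \<forall>j\<in>I. 0 \<le> x j then exp (- r * (1 - K x)) else 0)" for r :: real and x
  have ext_Q: "ext_cdf I (Q r)" if "0 < r" for r
    unfolding Q_def by (rule ext_cdf_poisson[OF ext fin(1) that])
  have Fn_eq: "(\<lambda>x. if \<forall>j\<in>I. c n j \<le> x j then G x else 0) = (\<lambda>x. Q (real (Suc n)) (A (real (Suc n)) x))" for n
  proof
    fix x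
    define N where "N = real (Suc n)"
    have "(\<forall>j\<in>I. 0 \<le> A N x j) \<longleftrightarrow> good N x"
      by (simp add: good_def N_def)
    then show "(if \<forall>j\<in>I. c n j \<le> x j then G x else 0) = Q (real (Suc n)) (A (real (Suc n)) x)"
      unfolding N_def[symmetric] good_c[folded N_def, symmetric] Q_def using G_good[of N x] by simp
  qed
  have lim_margin1: "(\<lambda>n. F (\<lambda>i. if i = j then y else real n)) \<longlonglongrightarrow> margin1 F j y"
    if "ext_cdf I F" "j \<in> I" for F j y
  proof -
    interpret F: vec_cdf I F using that fin by unfold_locales
    show ?thesis
      using that by (intro F.margin1_tendsto_real) auto
  qed
  have margin1_Q: "margin1 (Q r) j 0 = exp (- r * (1 - margin1 K j 0))" if r: "0 < r" and j: "j \<in> I" for r j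
  proof (rule LIMSEQ_unique)
    show "(\<lambda>n. Q r (\<lambda>i. if i = j then 0 else real n)) \<longlonglongrightarrow> margin1 (Q r) j 0"
      by (rule lim_margin1[OF ext_Q[OF r] j])
    have "(\<lambda>n. exp (- r * (1 - K (\<lambda>i. if i = j then 0 else real n)))) \<longlonglongrightarrow> exp (- r * (1 - margin1 K j 0))"
      by (intro tendsto_intros lim_margin1[OF ext j])
    then show "(\<lambda>n. Q r (\<lambda>i. if i = j then 0 else real n)) \<longlonglongrightarrow> exp (- r * (1 - margin1 K j 0))"
      by (simp add: Q_def)
  qed
  have ext_G: "ext_cdf I G"
  proof (rule ext_cdf_glue[OF fin(1), where c=c])
    show "c n j \<le> c m j" if "m \<le> n" "j \<in> I" for m n j
    proof -
      have "box_cox (\<gamma> j) (1 / real (Suc n)) \<le> box_cox (\<gamma> j) (1 / real (Suc m))"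
        using box_cox_strict_mono[of "1 / real (Suc n)" "1 / real (Suc m)" "\<gamma> j"] that
        by (cases "m = n") (auto simp: field_simps intro: less_imp_le)
      then show ?thesis using \<sigma>[OF that(2)] by (simp add: c_def flow_0)
    qed
    have A_eq: "A t x = (\<lambda>j. t powr \<gamma> j * x j + \<sigma> j * box_cox (\<gamma> j) t)" for t x
      by (simp add: A_def flow_def)
    show "ext_cdf I (\<lambda>x. if \<forall>j\<in>I. c n j \<le> x j then G x else 0)" for n
      unfolding Fn_eq A_eq by (intro ext_cdf_affine ext_Q fin) auto
    show "G x = 0" if bad: "\<And>n. \<exists>j\<in>I. x j < c n j" for x
    proof (rule G_bad)
      fix t
      show "\<not> good t x"
      proof
        assume *: "good t x"
        obtain n where "t \<le> real n" using real_arch_simple by blast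
        then have "good (real (Suc n)) x" using good_mono[OF *] by simp
        then show False using bad[of n] unfolding good_c by force
      qed
    qed
    \<comment> \<open>At \<open>c n\<close> the margin is the probability that component
      \<open>j\<close> of the Poisson maximum does not exceed 0. It decays geometrically because one
      vector exceeds 0 in component \<open>j\<close> with the positive probability
      \<open>1 - margin1 K j 0\<close>.\<close>
    show "(\<lambda>n. margin1 (\<lambda>x. if \<forall>j\<in>I. c n j \<le> x j then G x else 0) j (c n j)) \<longlonglongrightarrow> 0" if j: "j \<in> I" for j
    proof -
      have "margin1 (\<lambda>x. if \<forall>j\<in>I. c n j \<le> x j then G x else 0) j (c n j) = exp (- real (Suc n) * (1 - margin1 K j 0))" for n
      proof -
        have "margin1 (\<lambda>x. if \<forall>j\<in>I. c n j \<le> x j then G x else 0) j (c n j) =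
            margin1 (Q (real (Suc n))) j (flow (\<gamma> j) (\<sigma> j) (real (Suc n)) (c n j))"
          unfolding Fn_eq A_eq flow_def by (rule margin1_affine[OF ext_Q fin(1) _ j]) auto
        also have "flow (\<gamma> j) (\<sigma> j) (real (Suc n)) (c n j) = 0"
          unfolding c_def by (rule flow_inverse) simp
        also have "margin1 (Q (real (Suc n))) j 0 = exp (- real (Suc n) * (1 - margin1 K j 0))"
          by (rule margin1_Q[OF _ j]) simp
        finally show ?thesis .
      qed
      moreover have "(\<lambda>n. exp (- real (Suc n) * (1 - margin1 K j 0))) \<longlonglongrightarrow> 0"
      proof -
        have "(\<lambda>n. exp (- (1 - margin1 K j 0)) ^ Suc n) \<longlonglongrightarrow> 0"
          using less_1[OF j] by (intro LIMSEQ_Suc LIMSEQ_realpow_zero) auto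
        then show ?thesis by (simp only: exp_of_nat_mult[symmetric]) (simp add: algebra_simps)
      qed
      ultimately show ?thesis by simp
    qed
  qed
  interpret G: vec_cdf I G using ext_G fin by unfold_locales
  have G_nonneg: "G x = exp (- (1 - K x))" if "\<And>j. j \<in> I \<Longrightarrow> 0 \<le> x j" for x
    using G_good[of 1 x] that by (simp add: good_def)
  have G_stable: "G (A t x) powr t = G x" if t: "0 < t" for t x
  proof (cases "\<exists>r. good r x")
    case True
    then obtain r where r: "good r x" by blast
    then have "0 < r" by (simp add: good_def)
    then have eq: "A (r / t) (A t x) = A r x" using t by (subst A_A) auto
    then have "good (r / t) (A t x)" using r t by (simp add: good_def)
    from G_good[OF this] G_good[OF r] show ?thesis
      using t by (simp add: eq powr_def)
  next
    case False
    have "\<not> good s (A t x)" for s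
    proof
      assume *: "good s (A t x)"
      then have "0 < s" by (simp add: good_def)
      then have "good (s * t) x" using * t by (simp add: good_def A_A)
      then show False using False by blast
    qed
    then show ?thesis using False by (simp add: G_bad)
  qed
  define p where "p j = 1 - margin1 K j 0" for j
  have p_pos: "0 < p j" if "j \<in> I" for j
    using less_1[OF that] by (simp add: p_def)
  have margin1_G_0: "margin1 G j 0 = exp (- p j)" if j: "j \<in> I" for j
  proof (rule LIMSEQ_unique)
    show "(\<lambda>n. G (\<lambda>i. if i = j then 0 else real n)) \<longlonglongrightarrow> margin1 G j 0"
      by (rule lim_margin1[OF ext_G j])
    have "(\<lambda>n. exp (- (1 - K (\<lambda>i. if i = j then 0 else real n)))) \<longlonglongrightarrow> exp (- (1 - margin1 K j 0))"
      by (intro tendsto_intros lim_margin1[OF ext j])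
    then show "(\<lambda>n. G (\<lambda>i. if i = j then 0 else real n)) \<longlonglongrightarrow> exp (- p j)"
      by (subst G_nonneg) (auto simp: p_def)
  qed
  have margin1_stable: "margin1 G j (flow (\<gamma> j) (\<sigma> j) t y) powr t = margin1 G j y" if j: "j \<in> I" and t: "0 < t" for j t y
  proof (rule LIMSEQ_unique)
    let ?y = "\<lambda>n i. if i = j then y else real n"
    have "(\<lambda>n. G (A t (?y n))) \<longlonglongrightarrow> margin {j} G (\<lambda>_. flow (\<gamma> j) (\<sigma> j) t y)"
      using j t by (intro G.margin_tendsto)
        (auto simp: A_def approximates_const, auto simp: flow_def intro!: filterlim_affine_at_top filterlim_real_sequentially)
    then show "(\<lambda>n. G (A t (?y n)) powr t) \<longlonglongrightarrow> margin1 G j (flow (\<gamma> j) (\<sigma> j) t y) powr t"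
      unfolding margin1_def using t G.cdf_nonneg by (intro tendsto_powr') auto
    show "(\<lambda>n. G (A t (?y n)) powr t) \<longlonglongrightarrow> margin1 G j y"
      unfolding G_stable[OF t] by (rule lim_margin1[OF ext_G j])
  qed
  have margin1_G: "margin1 G j y = exp (- (p j / gev_exponent (\<gamma> j) (\<sigma> j) 0) * gev_exponent (\<gamma> j) (\<sigma> j) y)"
    if j: "j \<in> I" and y: "0 < \<sigma> j + \<gamma> j * y" for j y
  proof -
    let ?e = "gev_exponent (\<gamma> j) (\<sigma> j)"
    have pos: "0 < ?e 0" "0 < ?e y" using gev_exponent_pos \<sigma>[OF j] y by auto
    have "flow (\<gamma> j) (\<sigma> j) (?e y / ?e 0) y = 0"
      using flow_to[of "\<sigma> j" "\<gamma> j" y 0] \<sigma>[OF j] y by simp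
    then have "margin1 G j y = exp (- p j) powr (?e y / ?e 0)"
      using margin1_stable[OF j, of "?e y / ?e 0" y] pos by (simp add: margin1_G_0[OF j])
    then show ?thesis by (simp add: powr_def)
  qed
  have "real_cdf I G"
    unfolding real_cdf_iff[OF fin(1)]
  proof (intro conjI ballI ext_G)
    fix j assume j: "j \<in> I"
    define k where "k = p j / gev_exponent (\<gamma> j) (\<sigma> j) 0"
    have k: "0 < k" using p_pos[OF j] gev_exponent_pos[of "\<sigma> j" "\<gamma> j" 0] \<sigma>[OF j] by (simp add: k_def)
    show "(\<lambda>n. margin1 G j (- real n)) \<longlonglongrightarrow> 0"
    proof (rule order_tendstoI)
      fix a :: real assume "a < 0"
      then show "\<forall>\<^sub>F n in sequentially. a < margin1 G j (- real n)"
        using G.margin1_nonneg[OF j] by (auto intro: always_eventually less_le_trans)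
    next
      fix a :: real assume a: "0 < a"
      \<comment> \<open>An exponent so large that \<open>exp (- (k * m))\<close> falls below
        \<open>a\<close>; the factor 2 gives strictness and the maximum with 1 keeps
        \<open>m\<close> positive.\<close>
      define m where "m = max 1 (- 2 * ln a / k)"
      have "0 < m" by (simp add: m_def)
      then obtain y where y: "0 < \<sigma> j + \<gamma> j * y" "gev_exponent (\<gamma> j) (\<sigma> j) y = m"
        using gev_exponent_surj[of m "\<gamma> j" "\<sigma> j"] \<sigma>[OF j] by auto
      have "- (k * m) < ln a"
      proof (cases "0 < ln a")
        case False
        then have "- 2 * ln a / k \<le> m" by (simp add: m_def)
        then have "- 2 * ln a \<le> k * m" using k by (simp add: field_simps)
        moreover have "0 < k * m" using k by (simp add: m_def)
        ultimately show ?thesis using False by (cases "ln a = 0") auto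
      next
        case True
        have "0 < k * m" using k by (simp add: m_def)
        with True show ?thesis by simp
      qed
      then have "exp (- (k * m)) < a"
        using a by (metis exp_less_cancel_iff exp_ln)
      then have less: "margin1 G j y < a"
        using margin1_G[OF j y(1)] y(2) by (simp add: k_def)
      obtain N where N: "- y \<le> real N" using real_arch_simple by blast
      have "margin1 G j (- real n) < a" if "N \<le> n" for n
        using G.margin1_mono[OF j, of "- real n" y] N that less by simp
      then show "\<forall>\<^sub>F n in sequentially. margin1 G j (- real n) < a"
        using eventually_sequentially by blast
    qed
  qed
  then have "gev_params I G \<gamma> \<sigma>"
  proof (rule gev_paramsI[OF fin])
    show "\<exists>\<kappa>>0. \<forall>x. 0 < \<sigma> j + \<gamma> j * x \<longrightarrow> margin1 G j x = exp (- \<kappa> * gev_exponent (\<gamma> j) (\<sigma> j) x)" if j: "j \<in> I" for j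
      using margin1_G[OF j] p_pos[OF j] gev_exponent_pos[of "\<sigma> j" "\<gamma> j" 0] \<sigma>[OF j]
      by (intro exI[of _ "p j / gev_exponent (\<gamma> j) (\<sigma> j) 0"]) auto
    show "G (\<lambda>j. flow (\<gamma> j) (\<sigma> j) t (x j)) powr t = G x" if "0 < t" for t x
      using G_stable[OF that] by (simp add: A_def)
  qed (use \<sigma> in auto)
  then interpret gev: gev I G \<gamma> \<sigma> by unfold_locales
  \<comment> \<open>Of all powers of an associated cdf the construction returns the one with
    \<open>v = 1\<close>.\<close>
  have G_0: "G (\<lambda>_. 0) = exp (- 1)"
    by (subst G_nonneg) (auto simp: K_0)
  have "gp_assoc I K G"
  proof (subst gev.gp_assoc_iff)
    show "ext_cdf I K \<and> (\<forall>x. 0 < G x \<longrightarrow> K x = (ln (G x) - ln (G (\<lambda>j. min (x j) 0))) / - ln (G (\<lambda>_. 0))) \<and>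
      (\<forall>x. (\<exists>j\<in>I. 0 < \<gamma> j \<and> \<sigma> j + \<gamma> j * x j < 0) \<longrightarrow> K x = 0)"
    proof (intro conjI allI impI ext)
      fix x assume x: "0 < G x"
      have "\<forall>\<^sub>F t in at_top. \<forall>j\<in>I. 0 < A t (\<lambda>j. min (x j) 0) j"
        unfolding A_def using x \<sigma> fin
        by (intro eventually_ball_finite ballI flow_eventually_pos) (auto simp: gev.cdf_pos_iff min_def)
      then have "\<forall>\<^sub>F t in at_top. 1 \<le> t \<and> (\<forall>j\<in>I. 0 < A t (\<lambda>j. min (x j) 0) j)"
        using eventually_ge_at_top by (rule eventually_conj[rotated])
      then obtain t where t: "1 \<le> t" "\<And>j. j \<in> I \<Longrightarrow> 0 < A t (\<lambda>j. min (x j) 0) j"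
        using eventually_happens[of _ "at_top :: real filter"] by fastforce
      have le: "A t (\<lambda>j. min (x j) 0) j \<le> A t x j" for j
        using t by (simp add: A_def flow_le_iff)
      have "good t (\<lambda>j. min (x j) 0)" "good t x"
        using t le less_le_trans[OF t(2) le] by (auto simp: good_def intro: less_imp_le)
      then have "ln (G x) - ln (G (\<lambda>j. min (x j) 0)) = t * (K (A t x) - K (A t (\<lambda>j. min (x j) 0)))"
        by (simp add: G_good algebra_simps)
      also have "\<dots> = K x"
        using threshold[OF t] by simp
      finally show "K x = (ln (G x) - ln (G (\<lambda>j. min (x j) 0))) / - ln (G (\<lambda>_. 0))"
        by (simp add: G_0)
    qed (use ext outside in auto)
  qed (simp_all add: G_0)
  then have "gp I G \<gamma> \<sigma> K" by unfold_locales
  then show ?thesis unfolding gp_params_iff by blast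
qed

subsection \<open>Mixtures of generalized Pareto distributions\<close>

lemma gev_params_prod_powr:
  assumes "finite A" "A \<noteq> {}" "\<And>a. a \<in> A \<Longrightarrow> gev_params I (G a) \<gamma> \<sigma>" "\<And>a. a \<in> A \<Longrightarrow> 0 < c a"
  shows "gev_params I (\<lambda>x. \<Prod>a\<in>A. G a x powr c a) \<gamma> \<sigma>"
  using assms
proof (induction rule: finite_ne_induct)
  case (singleton a)
  then interpret gev I "G a" \<gamma> \<sigma> by unfold_locales auto
  show ?case using gev_params_power singleton by simp
next
  case (insert a A)
  then interpret gev I "G a" \<gamma> \<sigma> by unfold_locales auto
  show ?case
    using insert gev_params_mult[OF gev_params_power[of "c a"] insert.IH] by simp
qed

text \<open>The logarithms of the associated cdfs are combined: the exponent
  \<open>w a / v a\<close> normalizes \<open>G a\<close> to \<open>v = 1\<close> and weights it, so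
  that log-ratios of the product give the weighted sum of the \<open>H a\<close>. Terms of weight 0
  are removed because powers need positive exponents. This route also covers components with
  \<open>\<sigma> j \<le> 0\<close>.\<close>

lemma gp_cdf_finite_mixture:
  assumes A: "finite A" "\<And>a. a \<in> A \<Longrightarrow> 0 \<le> w a" "(\<Sum>a\<in>A. w a) = 1"
    and gp: "\<And>a. a \<in> A \<Longrightarrow> gp_params I (H a) \<gamma> \<sigma>"
  shows "gp_cdf I (\<lambda>x. \<Sum>a\<in>A. w a * H a x)"
proof -
  obtain G where G: "\<And>a. a \<in> A \<Longrightarrow> gp I (G a) \<gamma> \<sigma> (H a)"
    using gp unfolding gp_params_iff by metis
  define B where "B = {a\<in>A. 0 < w a}"
  have sum_B: "(\<Sum>a\<in>A. w a * f a) = (\<Sum>a\<in>B. w a * f a)" for f :: "_ \<Rightarrow> real"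
    unfolding B_def using A by (intro sum.mono_neutral_right) (auto simp: less_le)
  have "(\<Sum>a\<in>B. w a) = 1"
    using A sum_B[of "\<lambda>_. 1"] by simp
  then have B: "finite B" "B \<noteq> {}"
    using A(1) by (force simp: B_def)+
  have gpB: "gp I (G a) \<gamma> \<sigma> (H a)" if "a \<in> B" for a using that G by (simp add: B_def)
  define v where "v a = - ln (G a (\<lambda>_. 0))" for a
  have v: "0 < v a" if "a \<in> B" for a
    using gp.v_pos[OF gpB[OF that]] by (simp add: v_def gp.v_def[OF gpB[OF that]])
  define c where "c a = w a / v a" for a
  have c: "0 < c a" if "a \<in> B" for a
    using v[OF that] that by (simp add: c_def B_def)
  define G' where "G' x = (\<Prod>a\<in>B. G a x powr c a)" for x
  have "gev_params I (\<lambda>x. \<Prod>a\<in>B. G a x powr c a) \<gamma> \<sigma>"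
    using B c gpB by (intro gev_params_prod_powr) (auto simp: gp_def gev_def)
  then interpret G': gev I G' \<gamma> \<sigma>
    by unfold_locales (simp add: G'_def[abs_def])
  have pos: "0 < G a x" if "0 < G' x" "a \<in> B" for a x
  proof -
    interpret a: gp I "G a" \<gamma> \<sigma> "H a" by (rule gpB[OF that(2)])
    show ?thesis using that(1) unfolding a.cdf_pos_iff G'.cdf_pos_iff .
  qed
  have ln_G': "ln (G' x) = (\<Sum>a\<in>B. c a * ln (G a x))" if "0 < G' x" for x
  proof -
    have "G a x \<noteq> 0" if "a \<in> B" for a
      using pos[OF \<open>0 < G' x\<close> that] by simp
    then show ?thesis
      unfolding G'_def using B by (subst ln_prod) auto
  qed
  have pos_0: "0 < G' (\<lambda>_. 0)"
    unfolding G'_def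
  proof (rule prod_pos)
    fix a assume "a \<in> B"
    then interpret a: gp I "G a" \<gamma> \<sigma> "H a" by (rule gpB)
    show "0 < G a (\<lambda>_. 0) powr c a" using a.G_0 by simp
  qed
  have ln_0: "ln (G' (\<lambda>_. 0)) = - 1"
  proof -
    have "ln (G' (\<lambda>_. 0)) = (\<Sum>a\<in>B. - (w a * 1))"
      unfolding ln_G'[OF pos_0]
    proof (rule sum.cong[OF refl])
      fix a assume "a \<in> B"
      from v[OF this] show "c a * ln (G a (\<lambda>_. 0)) = - (w a * 1)" by (simp add: c_def v_def field_simps)
    qed
    also have "\<dots> = - 1" using sum_B[of "\<lambda>_. 1"] A by (simp add: sum_negf)
    finally show ?thesis .
  qed
  have "G' (\<lambda>_. 0) < 1" using ln_0 pos_0 by (metis ln_less_zero_iff neg_less_0_iff_less zero_less_one)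
  have "gp_assoc I (\<lambda>x. \<Sum>a\<in>A. w a * H a x) G'"
    unfolding G'.gp_assoc_iff[OF pos_0 \<open>G' (\<lambda>_. 0) < 1\<close>]
  proof (intro conjI allI impI)
    have "ext_cdf I (\<lambda>x. \<integral>a. H a x \<partial>point_measure A w)"
    proof (rule ext_cdf_mixture[OF G'.index(1) prob_space_point_measure])
      show "ext_cdf I (H a)" if "a \<in> space (point_measure A w)" for a
        using G[of a] that by (auto simp: space_point_measure gp_def gp_axioms_def gp_assoc_def)
    qed (use A in \<open>auto simp: measurable_def sets_point_measure space_point_measure\<close>)
    then show "ext_cdf I (\<lambda>x. \<Sum>a\<in>A. w a * H a x)"
      using A by (simp add: lebesgue_integral_point_measure_finite)
    show "(\<Sum>a\<in>A. w a * H a x) = (ln (G' x) - ln (G' (\<lambda>j. min (x j) 0))) / - ln (G' (\<lambda>_. 0))"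
      if x: "0 < G' x" for x
    proof -
      have x': "0 < G' (\<lambda>j. min (x j) 0)"
        using x pos_0 by (auto simp: G'.cdf_pos_iff min_def)
      have "(\<Sum>a\<in>B. w a * H a x) = (\<Sum>a\<in>B. c a * ln (G a x) - c a * ln (G a (\<lambda>j. min (x j) 0)))"
      proof (rule sum.cong[OF refl])
        fix a assume a: "a \<in> B"
        interpret a: gp I "G a" \<gamma> \<sigma> "H a" by (rule gpB[OF a])
        have "v a * H a x = ln (G a x) - ln (G a (\<lambda>j. min (x j) 0))"
          using a.H_eq[OF pos[OF x a]] v[OF a] by (simp add: a.V_full a.v_def v_def[symmetric])
        moreover have "w a * H a x = c a * (v a * H a x)"
          using v[OF a] by (simp add: c_def)
        ultimately show "w a * H a x = c a * ln (G a x) - c a * ln (G a (\<lambda>j. min (x j) 0))"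
          by (simp add: right_diff_distrib)
      qed
      then show ?thesis
        unfolding sum_B ln_0 ln_G'[OF x] ln_G'[OF x'] by (simp add: sum_subtractf)
    qed
    show "(\<Sum>a\<in>A. w a * H a x) = 0" if ex: "\<exists>j\<in>I. 0 < \<gamma> j \<and> \<sigma> j + \<gamma> j * x j < 0" for x
    proof (rule sum.neutral, rule ballI)
      fix a assume "a \<in> A"
      then interpret a: gp I "G a" \<gamma> \<sigma> "H a" by (rule G)
      show "w a * H a x = 0" using ex a.H_outside by auto
    qed
  qed
  then show ?thesis by (auto simp: gp_cdf_def)
qed

lemma gp_params_mixture:
  assumes N: "prob_space N" and meas: "\<And>x. (\<lambda>a. H a x) \<in> borel_measurable N"
    and gp: "\<And>a. a \<in> space N \<Longrightarrow> gp_params I (H a) \<gamma> \<sigma>" and \<sigma>: "\<And>j. j \<in> I \<Longrightarrow> 0 < \<sigma> j"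
  shows "gp_params I (\<lambda>x. \<integral>a. H a x \<partial>N) \<gamma> \<sigma>"
proof -
  interpret N: prob_space N by fact
  note meas[measurable]
  obtain G where G: "\<And>a. a \<in> space N \<Longrightarrow> gp I (G a) \<gamma> \<sigma> (H a)"
    using gp unfolding gp_params_iff by metis
  obtain a0 where a0: "a0 \<in> space N" using N.not_empty by blast
  interpret a0: gp I "G a0" \<gamma> \<sigma> "H a0" by (rule G[OF a0])
  have bnd: "0 \<le> H a x" "H a x \<le> 1" if "a \<in> space N" for a x
  proof -
    interpret a: gp I "G a" \<gamma> \<sigma> "H a" by (rule G[OF that])
    show "0 \<le> H a x" "H a x \<le> 1" by (rule a.H.cdf_nonneg a.H.cdf_le_1)+
  qed
  have int [intro]: "integrable N (\<lambda>a. H a x)" for x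
    by (rule N.integrable_const_bound[where B=1]) (use bnd in \<open>auto intro!: AE_I2\<close>)
  have ext: "ext_cdf I (\<lambda>x. \<integral>a. H a x \<partial>N)"
  proof (rule ext_cdf_mixture[OF a0.index(1) N meas])
    fix a assume "a \<in> space N"
    then interpret a: gp I "G a" \<gamma> \<sigma> "H a" by (rule G)
    show "ext_cdf I (H a)" by (rule a.H.ext_cdf)
  qed
  interpret K: vec_cdf I "\<lambda>x. \<integral>a. H a x \<partial>N"
    using ext a0.index by unfold_locales
  show ?thesis
  proof (rule gp_reconstruct[OF a0.index ext \<sigma>])
    fix x j assume j: "j \<in> I" "0 < \<gamma> j" "\<sigma> j + \<gamma> j * x j < 0"
    have "H a x = 0" if "a \<in> space N" for a
    proof -
      interpret a: gp I "G a" \<gamma> \<sigma> "H a" by (rule G[OF that])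
      show ?thesis using a.H_outside[of j x] j by simp
    qed
    then show "(\<integral>a. H a x \<partial>N) = 0" by (simp cong: Bochner_Integration.integral_cong)
  next
    \<comment> \<open>The margin of the mixture is the integral of the margins by dominated
      convergence. Each of them is below 1 at 0 since \<open>\<sigma> j\<close> is positive, and so
      the integral over a probability space is below 1 as well.\<close>
    fix j assume j: "j \<in> I"
    let ?y = "\<lambda>n i. if i = j then 0 else real n"
    have lim: "(\<lambda>n. H a (?y n)) \<longlonglongrightarrow> margin1 (H a) j 0" if "a \<in> space N" for a
    proof -
      interpret a: gp I "G a" \<gamma> \<sigma> "H a" by (rule G[OF that])
      show ?thesis using j by (intro a.H.margin1_tendsto_real) auto
    qed
    have meas1 [measurable]: "(\<lambda>a. margin1 (H a) j 0) \<in> borel_measurable N"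
      by (rule borel_measurable_LIMSEQ_real[OF lim]) measurable
    have less: "0 \<le> margin1 (H a) j 0" "margin1 (H a) j 0 < 1" if "a \<in> space N" for a
    proof -
      interpret a: gp I "G a" \<gamma> \<sigma> "H a" by (rule G[OF that])
      have "margin1 (H a) j 0 = 1 - a.V {j} (\<lambda>_. 0) / a.v"
        using a.margin_H_nonneg[of "{j}" "\<lambda>_. 0"] j by (simp add: margin1_def)
      moreover have "0 < a.V {j} (\<lambda>_. 0)"
        using a.V1_eq[OF j, of "\<lambda>_. 0"] \<sigma>[OF j] a.\<kappa>_pos[OF j] gev_exponent_pos[of "\<sigma> j" "\<gamma> j" 0] by simp
      ultimately show "margin1 (H a) j 0 < 1" using a.v_pos by simp
      show "0 \<le> margin1 (H a) j 0" by (rule a.H.margin1_nonneg[OF j])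
    qed
    have "(\<lambda>n. \<integral>a. H a (?y n) \<partial>N) \<longlonglongrightarrow> (\<integral>a. margin1 (H a) j 0 \<partial>N)"
      by (rule integral_dominated_convergence[where w="\<lambda>_. 1"]) (use bnd lim in \<open>auto intro!: AE_I2\<close>)
    moreover have "(\<lambda>n. \<integral>a. H a (?y n) \<partial>N) \<longlonglongrightarrow> margin1 (\<lambda>x. \<integral>a. H a x \<partial>N) j 0"
      using j by (intro K.margin1_tendsto_real) auto
    ultimately have "margin1 (\<lambda>x. \<integral>a. H a x \<partial>N) j 0 = (\<integral>a. margin1 (H a) j 0 \<partial>N)"
      using LIMSEQ_unique by blast
    also have "\<dots> < (\<integral>a. 1 \<partial>N)"
    proof (rule N.integral_less_AE_space)
      show "integrable N (\<lambda>a. margin1 (H a) j 0)"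
        by (rule N.integrable_const_bound[where B=1]) (use less in \<open>auto intro!: AE_I2 less_imp_le\<close>)
    qed (use less in \<open>auto simp: N.emeasure_space_1\<close>)
    finally show "margin1 (\<lambda>x. \<integral>a. H a x \<partial>N) j 0 < 1" by (simp add: N.prob_space)
  next
    fix t :: real and x assume t: "1 \<le> t"
    let ?x = "\<lambda>j. flow (\<gamma> j) (\<sigma> j) t (x j)" and ?x' = "\<lambda>j. flow (\<gamma> j) (\<sigma> j) t (min (x j) 0)"
    have "H a x = t * (H a ?x - H a ?x')" if "a \<in> space N" for a
    proof -
      interpret a: gp I "G a" \<gamma> \<sigma> "H a" by (rule G[OF that])
      show ?thesis using a.threshold_stable[OF t \<sigma>] .
    qed
    then have "(\<integral>a. H a x \<partial>N) = (\<integral>a. t * (H a ?x - H a ?x') \<partial>N)"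
      by (intro Bochner_Integration.integral_cong) auto
    also have "\<dots> = t * ((\<integral>a. H a ?x \<partial>N) - (\<integral>a. H a ?x' \<partial>N))"
      using int by simp
    finally show "(\<integral>a. H a x \<partial>N) = t * ((\<integral>a. H a ?x \<partial>N) - (\<integral>a. H a ?x' \<partial>N))" .
  qed
qed

subsection \<open>Identifiability of shape and scale\<close>

text \<open>By the cocycle identity the value at 4 is \<open>2 powr g + 1\<close> times the value at
  2. The quotient identifies \<open>g\<close>, and then the value at 2 identifies
  \<open>s\<close>.\<close>

lemma box_cox_mult_inject:
  assumes "0 < s" and eq: "\<And>t. 1 \<le> t \<Longrightarrow> s * box_cox g t = s' * box_cox g' t"
  shows "g' = g \<and> s' = s"
proof -
  have pos: "0 < box_cox g 2" "0 < box_cox g' 2" by (auto intro: box_cox_pos)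
  have *: "s * box_cox g (2 * 2) = (2 powr g + 1) * (s * box_cox g 2)"
    "s' * box_cox g' (2 * 2) = (2 powr g' + 1) * (s' * box_cox g' 2)"
    by (subst box_cox_mult; simp add: algebra_simps)+
  have eq2: "s * box_cox g 2 = s' * box_cox g' 2" by (rule eq) simp
  have "s * box_cox g (2 * 2) = s' * box_cox g' (2 * 2)" by (rule eq) simp
  then have "(2 powr g + 1) * (s * box_cox g 2) = (2 powr g' + 1) * (s * box_cox g 2)"
    unfolding * eq2 .
  then have "2 powr g = 2 powr g'"
    using pos assms(1) by simp
  then have "g = g'"
    by (subst (asm) powr_inj) auto
  then show ?thesis using eq[of 2] pos by simp
qed

text \<open>The probability that component \<open>j\<close> exceeds \<open>y\<close> while some
  component in \<open>K\<close> exceeds its threshold, by inclusion and exclusion. It is written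
  with margins so that it depends on \<open>F\<close> alone and can be compared between two
  representations of the same cdf.\<close>

definition joint_tail ::
  "(('i \<Rightarrow> real) \<Rightarrow> real) \<Rightarrow> 'i \<Rightarrow> 'i set \<Rightarrow> ('i \<Rightarrow> real) \<Rightarrow> real \<Rightarrow> real" where
  "joint_tail F j K u y = 1 - margin1 F j y - (margin K F u - margin (insert j K) F (u(j := y)))"

lemma (in cdf_of) joint_tail_eq:
  assumes "j \<in> I" "K \<subseteq> I" "j \<notin> K"
  shows "joint_tail F j K u y = \<P>(\<omega> in P. ereal y < X j \<omega> \<and> \<not> (\<forall>k\<in>K. X k \<omega> \<le> ereal (u k)))"
proof -
  let ?E = "{\<omega>\<in>space P. X j \<omega> \<le> ereal y}" and ?F = "{\<omega>\<in>space P. \<forall>k\<in>K. X k \<omega> \<le> ereal (u k)}"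
  have fin: "finite K" using assms finite_index finite_subset by blast
  have E: "?E \<in> events"
    using component_measurable[OF assms(1)] by measurable
  have "Measurable.pred P (\<lambda>\<omega>. X k \<omega> \<le> ereal (u k))" if "k \<in> K" for k
  proof -
    have "k \<in> I" using that assms(2) by blast
    then show ?thesis by measurable
  qed
  then have F: "?F \<in> events"
    using fin by (auto simp: pred_def intro!: sets.sets_Collect_finite_All)
  have *: "margin1 F j y = prob ?E" "margin K F u = prob ?F"
    "margin (insert j K) F (u(j := y)) = prob (?E \<inter> ?F)"
    using assms by (auto simp: margin1_eq margin_eq intro!: arg_cong[where f=prob])
  have "prob (?E \<union> ?F) = prob ?E + prob ?F - prob (?E \<inter> ?F)"
    using E F finite_measure_Union'[OF E F] finite_measure_Diff'[OF F E] by (simp add: Int_commute)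
  moreover have "prob (space P - (?E \<union> ?F)) = 1 - prob (?E \<union> ?F)"
    using E F by (intro prob_compl) auto
  moreover have "space P - (?E \<union> ?F) = {\<omega>\<in>space P. ereal y < X j \<omega> \<and> \<not> (\<forall>k\<in>K. X k \<omega> \<le> ereal (u k))}"
    by auto
  ultimately show ?thesis
    by (simp add: joint_tail_def *)
qed

context gp
begin

text \<open>\<open>margin1 H j 0\<close> is 1 exactly if \<open>margin1 G j 0\<close> is 1, that is,
  if 0 is at or above the upper endpoint of component \<open>j\<close>. Thus the sign of
  \<open>\<sigma> j\<close> can be read off from \<open>H\<close>.\<close>

lemma margin1_H_less_1_iff:
  assumes j: "j \<in> I"
  shows "margin1 H j 0 < 1 \<longleftrightarrow> 0 < \<sigma> j"
proof -
  have eq: "margin1 H j 0 = 1 + ln (margin1 G j 0) / v"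
    using margin_H_nonneg[of "{j}" "\<lambda>_. 0"] j by (simp add: margin1_def V_def)
  show ?thesis
  proof (cases "0 < \<sigma> j")
    case True
    then have "ln (margin1 G j 0) < 0"
      using margin1_inside_bounds[OF j, of 0] by simp
    then show ?thesis using True v_pos by (simp add: eq divide_neg_pos)
  next
    case False
    then have "margin1 G j 0 = 1"
      using margin1_outside[OF j, of 0] support_0[OF j] by auto
    then show ?thesis using False by (simp add: eq)
  qed
qed

lemma shape_neg_if_sigma_nonpos: "j \<in> I \<Longrightarrow> \<not> 0 < \<sigma> j \<Longrightarrow> \<gamma> j < 0"
  using support_0[of j] sigma_pos_if_shape_0[of j] by (cases "\<gamma> j" "0::real" rule: linorder_cases) auto

lemma margin1_H_nonneg:
  assumes j: "j \<in> I" and "0 \<le> y"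
  shows "margin1 H j y = 1 - V {j} (\<lambda>_. y) / v"
  using margin_H_nonneg[of "{j}" "\<lambda>_. y"] assms by (simp add: margin1_def)

lemma margin1_H_flow_0:
  assumes j: "j \<in> I" and "0 < \<sigma> j" "1 \<le> t"
  shows "1 - margin1 H j (flow (\<gamma> j) (\<sigma> j) t 0) = (1 - margin1 H j 0) / t"
proof -
  have "V {j} (\<lambda>_. flow (\<gamma> j) (\<sigma> j) t 0) = V {j} (A t (\<lambda>_. 0))"
    unfolding V_def by (intro arg_cong[where f="\<lambda>x. - ln x"] margin_cong) simp
  also have "\<dots> = V {j} (\<lambda>_. 0) / t"
    using assms by (intro V_flow) auto
  finally show ?thesis
    using assms by (simp add: margin1_H_nonneg flow_nonneg)
qed

lemma margin1_H_inj:
  assumes j: "j \<in> I" and xy: "0 \<le> x" "0 \<le> y" and eq: "margin1 H j x = margin1 H j y" "margin1 H j x < 1"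
  shows "x = y"
proof -
  have V: "V {j} (\<lambda>_. z) = - ln (margin1 G j z)" for z
    by (simp add: V_def margin1_def)
  have pos: "0 < margin1 G j z" if "0 \<le> z" for z
    using margin_pos_nonneg[of "{j}" "\<lambda>_. z"] j that by (simp add: margin1_def)
  have "ln (margin1 G j x) = ln (margin1 G j y)"
    using eq(1) xy v_pos by (simp add: margin1_H_nonneg[OF j] V)
  then have G_eq: "margin1 G j x = margin1 G j y"
    using pos xy by simp
  have "ln (margin1 G j x) < 0"
    using eq(2) xy v_pos by (simp add: margin1_H_nonneg[OF j] V divide_less_0_iff)
  then have "0 < \<sigma> j + \<gamma> j * x"
    using pos[OF xy(1)] by (intro margin1_bounds_imp_inside[OF j]) auto
  then show ?thesis
    using G_eq by (rule margin1_inj[OF j])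
qed

text \<open>The components that can exceed 0. Forcing one of them above a high threshold gives the
  flow an event to act on when \<open>\<sigma> j \<le> 0\<close>.\<close>

abbreviation K :: "'i set" where "K \<equiv> {k\<in>I. 0 < \<sigma> k}"

text \<open>Thresholds \<open>u \<ge> 0\<close> on \<open>K\<close> leave the same negative part in
  both margins that contain \<open>j\<close>, so their terms in \<open>V I\<close> cancel and
  \<open>v * joint_tail\<close> becomes a value of \<open>V {j}\<close> plus one of
  \<open>V K\<close> minus one of \<open>V (insert j K)\<close>. The flow divides each by
  \<open>t\<close>. Adding a component to a margin can only increase \<open>V\<close>, so the value
  of \<open>V {j}\<close> alone is an upper bound.\<close>

lemma joint_tail_flow:
  assumes j: "j \<in> I" "\<not> 0 < \<sigma> j" and t: "1 \<le> t"
  shows "joint_tail H j K (A t (\<lambda>_. 0)) (flow (\<gamma> j) (\<sigma> j) t y) = joint_tail H j K (\<lambda>_. 0) y / t"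
    and "v * joint_tail H j K (\<lambda>_. 0) y \<le> V {j} (\<lambda>_. y)"
proof -
  let ?J = "insert j K"
  have J: "?J \<subseteq> I" "K \<subseteq> I" "{j} \<subseteq> I" using j by auto
  have \<gamma>: "\<gamma> j < 0" by (rule shape_neg_if_sigma_nonpos[OF j])
  have eq: "v * joint_tail H j K u y = V {j} (\<lambda>_. y) + V K u - V ?J (u(j := y))"
    if u: "\<And>k. k \<in> K \<Longrightarrow> 0 \<le> u k" for u y
  proof -
    let ?z = "\<lambda>i. if i = j then min y 0 else 0"
    have 1: "margin1 H j y = (V I ?z - V {j} (\<lambda>_. y)) / v"
    proof -
      have "0 < margin {j} G (\<lambda>_. y)" using \<gamma> unfolding margin_pos_iff[OF J(3)] by simp
      from margin_H_eq[OF J(3) this] show ?thesis by (simp add: margin1_def)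
    qed
    have 2: "margin K H u = 1 - V K u / v"
      by (rule margin_H_nonneg[OF J(2) u])
    have 3: "margin ?J H (u(j := y)) = (V I ?z - V ?J (u(j := y))) / v"
    proof -
      have "0 < margin ?J G (u(j := y))"
        using \<gamma> u unfolding margin_pos_iff[OF J(1)] by (auto intro!: add_pos_nonneg)
      moreover have "(\<lambda>i. if i \<in> ?J then min ((u(j := y)) i) 0 else 0) = ?z"
        using u by (auto simp: fun_eq_iff)
      ultimately show ?thesis using margin_H_eq[OF J(1), of "u(j := y)"] by simp
    qed
    have "v * joint_tail H j K u y = v - v * margin1 H j y - v * margin K H u + v * margin ?J H (u(j := y))"
      by (simp add: joint_tail_def algebra_simps)
    also have "\<dots> = v - (V I ?z - V {j} (\<lambda>_. y)) - (v - V K u) + (V I ?z - V ?J (u(j := y)))"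
    proof -
      have cancel: "v * (x / v) = x" for x using v_pos by simp
      show ?thesis unfolding 1 2 3 by (simp only: cancel right_diff_distrib mult_1_right)
    qed
    finally show ?thesis by simp
  qed
  have Vflow: "V L (A t x) = V L x / t" if "L \<subseteq> I" for L x
    using that t by (intro V_flow) auto
  have "V {j} (\<lambda>_. flow (\<gamma> j) (\<sigma> j) t y) = V {j} (A t (\<lambda>_. y))"
    unfolding V_def by (intro arg_cong[where f="\<lambda>x. - ln x"] margin_cong) simp
  then have 1: "V {j} (\<lambda>_. flow (\<gamma> j) (\<sigma> j) t y) = V {j} (\<lambda>_. y) / t"
    by (simp only: Vflow[OF J(3)])
  have "V ?J ((A t (\<lambda>_. 0))(j := flow (\<gamma> j) (\<sigma> j) t y)) = V ?J (A t ((\<lambda>_. 0)(j := y)))"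
    unfolding V_def by (intro arg_cong[where f="\<lambda>x. - ln x"] margin_cong) simp
  then have 2: "V ?J ((A t (\<lambda>_. 0))(j := flow (\<gamma> j) (\<sigma> j) t y)) = V ?J ((\<lambda>_. 0)(j := y)) / t"
    by (simp only: Vflow[OF J(1)])
  have 3: "V K (A t (\<lambda>_. 0)) = V K (\<lambda>_. 0) / t"
    by (rule Vflow[OF J(2)])
  have nonneg: "0 \<le> A t (\<lambda>_. 0) k" if "k \<in> K" for k
    using that t by (intro flow_nonneg) auto
  have "v * joint_tail H j K (A t (\<lambda>_. 0)) (flow (\<gamma> j) (\<sigma> j) t y) = 
    v * (joint_tail H j K (\<lambda>_. 0) y / t)"
  proof -
    have "v * joint_tail H j K (A t (\<lambda>_. 0)) (flow (\<gamma> j) (\<sigma> j) t y) =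
        V {j} (\<lambda>_. flow (\<gamma> j) (\<sigma> j) t y) + V K (A t (\<lambda>_. 0)) -
        V ?J ((A t (\<lambda>_. 0))(j := flow (\<gamma> j) (\<sigma> j) t y))"
      by (rule eq) (rule nonneg)
    also have "\<dots> = (V {j} (\<lambda>_. y) + V K (\<lambda>_. 0) - V ?J ((\<lambda>_. 0)(j := y))) / t"
      unfolding 1 2 3 by (simp only: add_divide_distrib diff_divide_distrib)
    also have "\<dots> = v * joint_tail H j K (\<lambda>_. 0) y / t"
      by (subst eq) auto
    finally show ?thesis by simp
  qed
  then show "joint_tail H j K (A t (\<lambda>_. 0)) (flow (\<gamma> j) (\<sigma> j) t y) = joint_tail H j K (\<lambda>_. 0) y / t"
    by (subst (asm) mult_left_cancel) (use v_pos in auto)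
  have "V K (\<lambda>_. 0) \<le> V ?J ((\<lambda>_. 0)(j := y))"
  proof -
    interpret J: vec_cdf ?J "margin ?J G"
      using ext_cdf_margin[OF J(1)] index finite_subset[OF J(1)] by unfold_locales
    have "margin ?J G ((\<lambda>_. 0)(j := y)) \<le> margin K G ((\<lambda>_. 0)(j := y))"
      using J.cdf_le_margin[of K] margin_margin[of K ?J] J by auto
    moreover have "margin K G ((\<lambda>_. 0)(j := y)) = margin K G (\<lambda>_. 0)"
      using j by (intro margin_cong) auto
    moreover have "0 < margin ?J G ((\<lambda>_. 0)(j := y))"
      using \<gamma> unfolding margin_pos_iff[OF J(1)] by auto
    ultimately show ?thesis unfolding V_def by simp
  qed
  then show "v * joint_tail H j K (\<lambda>_. 0) y \<le> V {j} (\<lambda>_. y)"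
    by (subst eq) auto
qed

text \<open>Almost surely some component in \<open>K\<close> exceeds 0, because the others have
  \<open>margin1 G i 0 = 1\<close> and do not contribute to \<open>G\<close> at 0. The joint event
  at threshold 0 is then the plain exceedance of component \<open>j\<close>.\<close>

lemma joint_tail_0:
  assumes j: "j \<in> I" "\<not> 0 < \<sigma> j"
  shows "joint_tail H j K (\<lambda>_. 0) y = 1 - margin1 H j y"
proof -
  have J: "insert j K \<subseteq> I" "K \<subseteq> I" using j by auto
  have "margin K G (\<lambda>_. 0) - G (\<lambda>_. 0) \<le> (\<Sum>i\<in>I - K. 1 - margin1 G i 0)"
    by (rule margin_diff_le) auto
  also have "\<dots> = 0"
  proof (rule sum.neutral, rule ballI)
    fix i assume "i \<in> I - K"
    then show "1 - margin1 G i 0 = 0"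
      using margin1_outside[of i 0] shape_neg_if_sigma_nonpos[of i] by auto
  qed
  finally have "margin K G (\<lambda>_. 0) = G (\<lambda>_. 0)"
    using cdf_le_margin[of K "\<lambda>_. 0"] by simp
  then have "V K (\<lambda>_. 0) = v" by (simp add: V_def v_def)
  then have 1: "margin K H (\<lambda>_. 0) = 0"
    using margin_H_nonneg[of K "\<lambda>_. 0"] v_pos by simp
  interpret J: vec_cdf "insert j K" "margin (insert j K) H"
    using H.ext_cdf_margin[OF J(1)] index finite_subset[OF J(1)] by unfold_locales
  have "margin (insert j K) H ((\<lambda>_. 0)(j := y)) \<le> margin K H ((\<lambda>_. 0)(j := y))"
    using J.cdf_le_margin[of K] H.margin_margin[of K "insert j K"] J by auto
  also have "\<dots> = margin K H (\<lambda>_. 0)"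
    using j by (intro margin_cong) auto
  finally have "margin (insert j K) H ((\<lambda>_. 0)(j := y)) = 0"
    using J.cdf_nonneg[of "(\<lambda>_. 0)(j := y)"] 1 by simp
  then show ?thesis by (simp add: joint_tail_def 1)
qed

lemma joint_tail_mono:
  assumes j: "j \<in> I" "\<not> 0 < \<sigma> j" and "y \<le> z" "\<And>k. k \<in> K \<Longrightarrow> u k \<le> u' k"
  shows "joint_tail H j K u' z \<le> joint_tail H j K u y"
proof -
  let ?P = "cdf_measure I H"
  have jK: "j \<notin> K" "K \<subseteq> I" using j by auto
  have fin: "finite K" using index by simp
  have [measurable]: "(\<lambda>\<omega>. \<omega> j) \<in> borel_measurable ?P" "\<And>k. k \<in> K \<Longrightarrow> (\<lambda>\<omega>. \<omega> k) \<in> borel_measurable ?P"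
    using H.component_measurable j by auto
  show ?thesis
    unfolding H.joint_tail_eq[OF j(1) jK(2,1)]
  proof (rule H.finite_measure_mono)
    show "{\<omega> \<in> space ?P. ereal z < \<omega> j \<and> \<not> (\<forall>k\<in>K. \<omega> k \<le> ereal (u' k))} \<subseteq>
      {\<omega> \<in> space ?P. ereal y < \<omega> j \<and> \<not> (\<forall>k\<in>K. \<omega> k \<le> ereal (u k))}"
      using assms(3,4) by (auto intro: le_less_trans order_trans simp del: ereal_less_eq(3) simp flip: ereal_less_eq(3))
    show "{\<omega> \<in> space ?P. ereal y < \<omega> j \<and> \<not> (\<forall>k\<in>K. \<omega> k \<le> ereal (u k))} \<in> H.events"
      using fin by measurable
  qed
qed

text \<open>Below the upper endpoint the margin of \<open>H\<close> might already be 1. One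
  exceedance at \<open>y0\<close> excludes this, since the flow transports it: a point
  \<open>y\<close> inside the support is the image of a point \<open>z \<le> y0\<close>, and its
  joint tail is that of \<open>z\<close> divided by \<open>t\<close>. Beyond the endpoint
  \<open>V {j}\<close> is 0 and bounds the tail.\<close>

lemma margin1_H_less_1_iff_endpoint:
  assumes j: "j \<in> I" "\<not> 0 < \<sigma> j" and y0: "margin1 H j y0 < 1"
  shows "margin1 H j y < 1 \<longleftrightarrow> y < - \<sigma> j / \<gamma> j"
proof -
  have \<gamma>: "\<gamma> j < 0" by (rule shape_neg_if_sigma_nonpos[OF j])
  have inside_iff: "0 < \<sigma> j + \<gamma> j * y \<longleftrightarrow> y < - \<sigma> j / \<gamma> j" for y
    using \<gamma> by (auto simp: field_simps)
  have imp_inside: "0 < \<sigma> j + \<gamma> j * y" if "margin1 H j y < 1" for y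
  proof (rule ccontr)
    assume "\<not> 0 < \<sigma> j + \<gamma> j * y"
    then have "margin1 G j y = 1"
      using margin1_outside[OF j(1), of y] \<gamma> by auto
    then have "v * joint_tail H j K (\<lambda>_. 0) y \<le> 0"
      using joint_tail_flow(2)[OF j, of 1 y] by (simp add: V_def margin1_def)
    then show False
      using that v_pos by (simp add: joint_tail_0[OF j] mult_le_0_iff)
  qed
  have "margin1 H j y < 1" if y: "0 < \<sigma> j + \<gamma> j * y" for y
  proof -
    have y0': "0 < \<sigma> j + \<gamma> j * y0" by (rule imp_inside[OF y0])
    \<comment> \<open>Large enough for the backward flow of \<open>y\<close> to land at or below
      \<open>y0\<close>: the exponent at \<open>z\<close> is then at least that at
      \<open>y0\<close>.\<close>
    define t where "t = max 1 (e j y0 / e j y)"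
    have t: "1 \<le> t" "0 < t" by (auto simp: t_def)
    define z where "z = flow (\<gamma> j) (\<sigma> j) (1 / t) y"
    have z: "0 < \<sigma> j + \<gamma> j * z" using y t by (simp add: z_def flow_support_pos_iff)
    have "e j z = t * e j y" using y t by (simp add: z_def gev_exponent_flow)
    moreover have "e j y0 \<le> t * e j y"
      using gev_exponent_pos[OF y] by (simp add: t_def max_def field_simps)
    ultimately have "z \<le> y0"
      using gev_exponent_strict_antimono[OF y0' z] by (cases "z \<le> y0") auto
    have "0 < 1 - margin1 H j y0" using y0 by simp
    also have "\<dots> \<le> joint_tail H j K (\<lambda>_. 0) z"
      unfolding joint_tail_0[OF j] using H.margin1_mono[OF j(1) \<open>z \<le> y0\<close>] by simp
    also have "\<dots> = t * joint_tail H j K (A t (\<lambda>_. 0)) (flow (\<gamma> j) (\<sigma> j) t z)"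
      using joint_tail_flow(1)[OF j t(1), of z] t by simp
    also have "flow (\<gamma> j) (\<sigma> j) t z = y"
      unfolding z_def using t by (rule_tac flow_inverse)
    also have "joint_tail H j K (A t (\<lambda>_. 0)) y \<le> joint_tail H j K (\<lambda>_. 0) y"
      using t by (intro joint_tail_mono[OF j]) (auto intro!: flow_nonneg)
    finally show ?thesis
      using t by (simp add: joint_tail_0[OF j] zero_less_mult_iff)
  qed
  then show ?thesis using imp_inside inside_iff by blast
qed

end

text \<open>Move \<open>y\<close> forward with the flow of \<gamma>' and \<sigma>', then back with
  that of \<gamma> and \<sigma>. The thresholds on \<open>K\<close> move equally under both, so the
  joint tail returns to its old value. If \<open>\<gamma>' j < \<gamma> j\<close>, the first flow
  contracts faster towards the common endpoint, so the resulting point \<open>z\<close> tends to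
  this endpoint and the bound \<open>V {j}\<close> tends to 0: a positive probability would be at
  most 0.\<close>

lemma gp_shape_le:
  assumes gp: "gp I G \<gamma> \<sigma> H" "gp I G' \<gamma>' \<sigma>' H" and j: "j \<in> I" "\<not> 0 < \<sigma> j" and y: "margin1 H j y < 1"
    and K: "\<And>k. k \<in> I \<Longrightarrow> 0 < \<sigma> k \<longleftrightarrow> 0 < \<sigma>' k" "\<And>k. k \<in> I \<Longrightarrow> 0 < \<sigma> k \<Longrightarrow> \<gamma>' k = \<gamma> k \<and> \<sigma>' k = \<sigma> k"
    and endpoint: "- \<sigma>' j / \<gamma>' j = - \<sigma> j / \<gamma> j"
  shows "\<gamma> j \<le> \<gamma>' j"
proof (rule ccontr)
  assume less: "\<not> \<gamma> j \<le> \<gamma>' j"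
  interpret G: gp I G \<gamma> \<sigma> H by fact
  interpret G': gp I G' \<gamma>' \<sigma>' H by fact
  have j': "\<not> 0 < \<sigma>' j" using j K by simp
  have K_eq: "G'.K = G.K" using K by auto
  have \<gamma>: "\<gamma> j < 0" "\<gamma>' j < 0"
    using G.shape_neg_if_sigma_nonpos[OF j] G'.shape_neg_if_sigma_nonpos[OF j(1) j'] by auto
  have y': "0 < \<sigma>' j + \<gamma>' j * y"
    using G'.margin1_H_less_1_iff_endpoint[OF j(1) j' y, of y] y \<gamma> by (auto simp: field_simps)
  \<comment> \<open>Collects the factors free of \<open>t\<close> in
    \<open>G.\<kappa> j * G.e j z\<close>. The quotient \<open>\<gamma> j / \<gamma>' j\<close>
    converts one support expression into the other, since both vanish at the common
    endpoint.\<close>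
  define C where "C = G.\<kappa> j * (\<gamma> j / \<gamma>' j * (\<sigma>' j + \<gamma>' j * y)) powr (- 1 / \<gamma> j)"
  have bound: "v * (1 - margin1 H j y) \<le> C * t powr (1 - \<gamma>' j / \<gamma> j)" if t: "1 \<le> t" and v: "v = G.v" for t v
  proof -
    define w where "w = flow (\<gamma>' j) (\<sigma>' j) t y"
    define z where "z = flow (\<gamma> j) (\<sigma> j) (1 / t) w"
    have w_support: "\<sigma> j + \<gamma> j * w = \<gamma> j / \<gamma>' j * (t powr \<gamma>' j * (\<sigma>' j + \<gamma>' j * y))"
    proof -
      have "\<sigma> j + \<gamma> j * w = \<gamma> j / \<gamma>' j * (\<sigma>' j + \<gamma>' j * w)"
        using endpoint \<gamma> by (simp add: field_simps)
      then show ?thesis using t by (simp add: w_def flow_support)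
    qed
    moreover have "0 < \<gamma> j / \<gamma>' j" using \<gamma> by (rule divide_neg_neg)
    ultimately have w: "0 < \<sigma> j + \<gamma> j * w" using y' t by (simp only: w_support) (intro mult_pos_pos, auto)
    then have z: "0 < \<sigma> j + \<gamma> j * z" using t by (simp add: z_def flow_support_pos_iff)
    have "joint_tail H j G.K (\<lambda>_. 0) y / t = joint_tail H j G.K (G'.A t (\<lambda>_. 0)) w"
      using G'.joint_tail_flow(1)[OF j(1) j' t, of y] by (simp add: K_eq w_def)
    also have "\<dots> = joint_tail H j G.K (G.A t (\<lambda>_. 0)) w"
    proof -
      have "margin G.K H (G'.A t (\<lambda>_. 0)) = margin G.K H (G.A t (\<lambda>_. 0))"
        "margin (insert j G.K) H ((G'.A t (\<lambda>_. 0))(j := w)) = margin (insert j G.K) H ((G.A t (\<lambda>_. 0))(j := w))"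
        using K(2) by (auto intro!: margin_cong)
      then show ?thesis by (simp add: joint_tail_def)
    qed
    also have "\<dots> = joint_tail H j G.K (G.A t (\<lambda>_. 0)) (flow (\<gamma> j) (\<sigma> j) t z)"
      unfolding z_def using t by (subst flow_inverse) auto
    also have "\<dots> = joint_tail H j G.K (\<lambda>_. 0) z / t"
      by (rule G.joint_tail_flow(1)[OF j t])
    finally have "1 - margin1 H j y = joint_tail H j G.K (\<lambda>_. 0) z"
      using t by (simp add: G.joint_tail_0[OF j])
    then have "v * (1 - margin1 H j y) \<le> G.V {j} (\<lambda>_. z)"
      using G.joint_tail_flow(2)[OF j t, of z] v by simp
    also have "\<dots> = G.\<kappa> j * G.e j z"
      using G.V1_eq[OF j(1), of "\<lambda>_. z"] z by simp
    also have "G.e j z = t * G.e j w"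
      using w t by (simp add: z_def gev_exponent_flow)
    also have "G.e j w = (\<gamma> j / \<gamma>' j * (t powr \<gamma>' j * (\<sigma>' j + \<gamma>' j * y))) powr (- 1 / \<gamma> j)"
      using \<gamma> by (simp add: gev_exponent_def w_support)
    also have "\<dots> = ((\<gamma> j / \<gamma>' j * (\<sigma>' j + \<gamma>' j * y)) * t powr \<gamma>' j) powr (- 1 / \<gamma> j)"
      by (simp add: ac_simps)
    also have "\<dots> = (\<gamma> j / \<gamma>' j * (\<sigma>' j + \<gamma>' j * y)) powr (- 1 / \<gamma> j) * t powr (- (\<gamma>' j / \<gamma> j))"
      unfolding powr_mult powr_powr by simp
    finally have "v * (1 - margin1 H j y) \<le> C * (t * t powr (- (\<gamma>' j / \<gamma> j)))"
      by (simp add: C_def ac_simps)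
    also have "t * t powr (- (\<gamma>' j / \<gamma> j)) = t powr (1 - \<gamma>' j / \<gamma> j)"
      using t by (simp add: powr_diff powr_minus field_simps)
    finally show ?thesis .
  qed
  have "1 - \<gamma>' j / \<gamma> j < 0"
    using less \<gamma> by (simp add: field_simps)
  then have "((\<lambda>t. t powr (1 - \<gamma>' j / \<gamma> j)) \<longlongrightarrow> 0) at_top"
    by (rule tendsto_neg_powr) (rule filterlim_ident)
  then have lim: "((\<lambda>t. C * t powr (1 - \<gamma>' j / \<gamma> j)) \<longlongrightarrow> 0) at_top"
    by (rule tendsto_mult_right_zero)
  have "G.v * (1 - margin1 H j y) \<le> 0"
  proof (rule tendsto_lowerbound[OF lim])
    show "\<forall>\<^sub>F t in at_top. G.v * (1 - margin1 H j y) \<le> C * t powr (1 - \<gamma>' j / \<gamma> j)"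
      using eventually_ge_at_top[of 1] by eventually_elim (rule bound[OF _ refl])
  qed simp
  then show False using y G.v_pos by (simp add: mult_le_0_iff)
qed

lemma gp_params_unique:
  assumes gp: "gp I G \<gamma> \<sigma> H" "gp I G' \<gamma>' \<sigma>' H" and j: "j \<in> I" and y: "margin1 H j y < 1"
  shows "\<gamma>' j = \<gamma> j \<and> \<sigma>' j = \<sigma> j"
proof -
  interpret G: gp I G \<gamma> \<sigma> H by fact
  interpret G': gp I G' \<gamma>' \<sigma>' H by fact
  have sign: "0 < \<sigma> k \<longleftrightarrow> 0 < \<sigma>' k" if "k \<in> I" for k
    using G.margin1_H_less_1_iff[OF that] G'.margin1_H_less_1_iff[OF that] by simp
  have pos: "\<gamma>' k = \<gamma> k \<and> \<sigma>' k = \<sigma> k" if k: "k \<in> I" and \<sigma>: "0 < \<sigma> k" for k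
  proof (rule box_cox_mult_inject[OF \<sigma>])
    fix t :: real assume t: "1 \<le> t"
    have \<sigma>': "0 < \<sigma>' k" using sign[OF k] \<sigma> by simp
    have less: "margin1 H k 0 < 1" using G.margin1_H_less_1_iff[OF k] \<sigma> by simp
    have "flow (\<gamma> k) (\<sigma> k) t 0 = flow (\<gamma>' k) (\<sigma>' k) t 0"
    proof (rule G.margin1_H_inj[OF k])
      show "0 \<le> flow (\<gamma> k) (\<sigma> k) t 0" "0 \<le> flow (\<gamma>' k) (\<sigma>' k) t 0"
        using \<sigma> \<sigma>' t by (auto intro!: flow_nonneg)
      show "margin1 H k (flow (\<gamma> k) (\<sigma> k) t 0) = margin1 H k (flow (\<gamma>' k) (\<sigma>' k) t 0)"
        using G.margin1_H_flow_0[OF k \<sigma> t] G'.margin1_H_flow_0[OF k \<sigma>' t] by simp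
      have "0 < (1 - margin1 H k 0) / t" using less t by simp
      then show "margin1 H k (flow (\<gamma> k) (\<sigma> k) t 0) < 1"
        using G.margin1_H_flow_0[OF k \<sigma> t] by simp
    qed
    then show "\<sigma> k * box_cox (\<gamma> k) t = \<sigma>' k * box_cox (\<gamma>' k) t" by (simp add: flow_0)
  qed
  show ?thesis
  proof (cases "0 < \<sigma> j")
    case True
    then show ?thesis using pos j by blast
  next
    case False
    then have False': "\<not> 0 < \<sigma>' j" using sign[OF j] by simp
    have \<gamma>: "\<gamma> j < 0" "\<gamma>' j < 0"
      using G.shape_neg_if_sigma_nonpos[OF j False] G'.shape_neg_if_sigma_nonpos[OF j False'] by auto
    have "z < - \<sigma> j / \<gamma> j \<longleftrightarrow> z < - \<sigma>' j / \<gamma>' j" for z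
      using G.margin1_H_less_1_iff_endpoint[OF j False y] G'.margin1_H_less_1_iff_endpoint[OF j False' y] by blast
    then have endpoint: "- \<sigma>' j / \<gamma>' j = - \<sigma> j / \<gamma> j"
      by (metis less_irrefl linorder_less_linear)
    have "\<gamma> j \<le> \<gamma>' j"
      by (rule gp_shape_le[OF gp j False y sign pos endpoint])
    moreover have "\<gamma>' j \<le> \<gamma> j"
      by (rule gp_shape_le[OF gp(2,1) j False' y]) (use sign pos endpoint in auto)
    ultimately have "\<gamma>' j = \<gamma> j" by simp
    then show ?thesis using endpoint \<gamma> by (simp add: field_simps)
  qed
qed

subsection \<open>Limits of generalized Pareto distributions\<close>

text \<open>Beyond the upper endpoint this is \<open>0 powr a = 0\<close>.\<close>

definition gp_survival :: "real \<Rightarrow> real \<Rightarrow> real" where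
  "gp_survival g z = (if g = 0 then exp (- z) else (max 0 (1 + g * z)) powr (- 1 / g))"

lemma gp_survival_eq_gp_tail: "0 < 1 + g * z \<Longrightarrow> gp_survival g z = gp_tail g z"
  by (auto simp: gp_survival_def gp_tail_def)

lemma gp_survival_eq_0: "1 + g * z \<le> 0 \<Longrightarrow> gp_survival g z = 0"
  by (auto simp: gp_survival_def)

lemma gp_survival_0 [simp]: "gp_survival g 0 = 1"
  by (simp add: gp_survival_def)

lemma gp_survival_nonneg: "0 \<le> gp_survival g z"
  by (simp add: gp_survival_def)

text \<open>At \<open>g = 0\<close> the exponent \<open>- 1 / g\<close> blows up. There the
  logarithm of the tail is \<open>- l n\<close>, and a quadratic bound for
  \<open>ln (1 + w) - w\<close> makes \<open>l n - zn n\<close> of the order of \<open>gn n\<close>.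
  For \<open>g < 0\<close> the base may tend to 0, which is harmless as the exponent is positive;
  for \<open>g > 0\<close> this is excluded by assumption.\<close>

lemma gp_survival_tendsto:
  assumes g: "gn \<longlonglongrightarrow> g" and z: "zn \<longlonglongrightarrow> z" and pos: "0 < g \<longrightarrow> 0 < 1 + g * z"
  shows "(\<lambda>n. gp_survival (gn n) (zn n)) \<longlonglongrightarrow> gp_survival g z"
proof (cases "g = 0")
  case False
  then have "\<forall>\<^sub>F n in sequentially. gn n \<noteq> 0"
    using g by (rule_tac tendsto_imp_eventually_ne)
  then have "\<forall>\<^sub>F n in sequentially. (max 0 (1 + gn n * zn n)) powr (- 1 / gn n) = gp_survival (gn n) (zn n)"
    by eventually_elim (simp add: gp_survival_def)
  moreover have "(\<lambda>n. (max 0 (1 + gn n * zn n)) powr (- 1 / gn n)) \<longlonglongrightarrow> (max 0 (1 + g * z)) powr (- 1 / g)"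
  proof (rule tendsto_powr')
    show "(\<lambda>n. max 0 (1 + gn n * zn n)) \<longlonglongrightarrow> max 0 (1 + g * z)"
      by (intro tendsto_intros g z)
    show "(\<lambda>n. - 1 / gn n) \<longlonglongrightarrow> - 1 / g"
      by (intro tendsto_intros g False)
    show "max 0 (1 + g * z) \<noteq> 0 \<or> 0 < - 1 / g \<and> (\<forall>\<^sub>F n in sequentially. 0 \<le> max 0 (1 + gn n * zn n))"
      using pos False by (cases "0 < g") (auto simp: not_less divide_less_0_iff)
  qed
  ultimately show ?thesis
    using False by (simp add: gp_survival_def Lim_transform_eventually)
next
  case True
  define l where "l n = (if gn n = 0 then zn n else ln (1 + gn n * zn n) / gn n)" for n
  have w: "(\<lambda>n. gn n * zn n) \<longlonglongrightarrow> 0"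
    using tendsto_mult[OF g z] True by simp
  then have "(\<lambda>n. \<bar>gn n * zn n\<bar>) \<longlonglongrightarrow> 0"
    by (rule tendsto_rabs_zero)
  then have small: "\<forall>\<^sub>F n in sequentially. \<bar>gn n * zn n\<bar> < 1 / 2"
    by (rule order_tendstoD) simp
  have "(\<lambda>n. l n - zn n) \<longlonglongrightarrow> 0"
  proof (rule Lim_null_comparison)
    show "\<forall>\<^sub>F n in sequentially. norm (l n - zn n) \<le> 2 * \<bar>gn n\<bar> * (zn n)\<^sup>2"
      using small
    proof eventually_elim
      case (elim n)
      show ?case
      proof (cases "gn n = 0")
        case False
        let ?w = "gn n * zn n"
        have "\<bar>ln (1 + ?w) - ?w\<bar> \<le> 2 * ?w\<^sup>2"
          using elim by (intro abs_ln_one_plus_x_minus_x_bound) auto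
        also have "2 * ?w\<^sup>2 = 2 * (\<bar>gn n\<bar> * \<bar>gn n\<bar>) * (zn n)\<^sup>2"
          by (simp add: power2_eq_square)
        also have "\<dots> = 2 * \<bar>gn n\<bar> * (zn n)\<^sup>2 * \<bar>gn n\<bar>"
          by (simp only: ac_simps)
        finally have "\<bar>ln (1 + ?w) - ?w\<bar> / \<bar>gn n\<bar> \<le> 2 * \<bar>gn n\<bar> * (zn n)\<^sup>2"
          using False by (subst pos_divide_le_eq) auto
        moreover have "l n - zn n = (ln (1 + ?w) - ?w) / gn n"
          using False by (simp add: l_def diff_divide_distrib)
        ultimately show ?thesis by (simp add: abs_divide)
      qed (simp add: l_def)
    qed
    have "(\<lambda>n. 2 * \<bar>gn n\<bar> * (zn n)\<^sup>2) \<longlonglongrightarrow> 2 * \<bar>g\<bar> * z\<^sup>2"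
      by (intro tendsto_intros g z)
    then show "(\<lambda>n. 2 * \<bar>gn n\<bar> * (zn n)\<^sup>2) \<longlonglongrightarrow> 0"
      using True by simp
  qed
  from tendsto_add[OF this z] have "l \<longlonglongrightarrow> z" by simp
  then have "(\<lambda>n. exp (- l n)) \<longlonglongrightarrow> exp (- z)"
    by (intro tendsto_intros)
  moreover have "\<forall>\<^sub>F n in sequentially. exp (- l n) = gp_survival (gn n) (zn n)"
    using small
  proof eventually_elim
    case (elim n)
    then have "0 < 1 + gn n * zn n" by linarith
    then show ?case by (auto simp: gp_survival_def l_def powr_def)
  qed
  ultimately show ?thesis
    using True by (simp add: gp_survival_def[of 0] Lim_transform_eventually)
qed

text \<open>At 0 the function is the difference quotient of \<open>h \<mapsto> t powr h\<close>,
  whose derivative there is \<open>ln t\<close>.\<close>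

lemma box_cox_tendsto:
  assumes g: "gn \<longlonglongrightarrow> g" and t: "0 < t"
  shows "(\<lambda>n. box_cox (gn n) t) \<longlonglongrightarrow> box_cox g t"
proof -
  have "isCont (\<lambda>g. box_cox g t) g"
  proof (cases "g = 0")
    case True
    have "((\<lambda>h. exp (h * ln t)) has_field_derivative ln t) (at 0)"
      by (auto intro!: derivative_eq_intros)
    then have "((\<lambda>h. (exp ((0 + h) * ln t) - exp (0 * ln t)) / h) \<longlongrightarrow> ln t) (at 0)"
      unfolding DERIV_def .
    moreover have "\<forall>\<^sub>F h in at 0. (exp ((0 + h) * ln t) - exp (0 * ln t)) / h = box_cox h t"
      using t by (auto simp: eventually_at_filter box_cox_def powr_def)
    ultimately have "((\<lambda>h. box_cox h t) \<longlongrightarrow> ln t) (at 0)"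
      by (rule Lim_transform_eventually)
    then show ?thesis using True by (simp add: isCont_def box_cox_def[of 0])
  next
    case False
    have "\<forall>\<^sub>F h in nhds g. h \<noteq> 0"
      using False by (simp add: t1_space_nhds)
    then have "\<forall>\<^sub>F h in nhds g. (t powr h - 1) / h = box_cox h t"
      by eventually_elim (simp add: box_cox_def)
    moreover have "isCont (\<lambda>h. (t powr h - 1) / h) g"
      using False t by (intro continuous_intros) auto
    ultimately show ?thesis
      by (subst (asm) isCont_cong) auto
  qed
  then show ?thesis
    using g by (rule isCont_tendsto_compose)
qed

lemma flow_tendsto:
  assumes "gn \<longlonglongrightarrow> g" "sn \<longlonglongrightarrow> s" "xn \<longlonglongrightarrow> x" "0 < t"
  shows "(\<lambda>n. flow (gn n) (sn n) t (xn n)) \<longlonglongrightarrow> flow g s t x"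
  unfolding flow_def using assms by (intro tendsto_intros box_cox_tendsto) auto

section \<open>Bounds on the parameters from tail probabilities\<close>

text \<open>The derivative of \<open>- ln (gev_exponent g s x)\<close> in \<open>x\<close> is
  \<open>1 / (s + g * x)\<close>. It is largest at the end of the interval where
  \<open>s + g * x\<close> is smallest, which the sign of \<open>g\<close> decides.\<close>

lemma ln_gev_exponent_ratio_le:
  assumes "a < b" "0 < s + g * a" "0 < s + g * b"
  shows "0 \<le> g \<Longrightarrow> ln (gev_exponent g s a / gev_exponent g s b) \<le> (b - a) / (s + g * a)"
    and "g < 0 \<Longrightarrow> ln (gev_exponent g s a / gev_exponent g s b) \<le> (b - a) / (s + g * b)"
proof -
  have ln_eq: "ln (gev_exponent g s a / gev_exponent g s b) = (ln (s + g * b) - ln (s + g * a)) / g" if "g \<noteq> 0"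
    using that assms by (simp add: gev_exponent_def ln_div diff_divide_distrib)
  show "ln (gev_exponent g s a / gev_exponent g s b) \<le> (b - a) / (s + g * a)" if "0 \<le> g"
  proof (cases "g = 0")
    case True
    have "exp (- a / s) / exp (- b / s) = exp ((b - a) / s)"
      by (simp add: exp_diff[symmetric] diff_divide_distrib)
    then show ?thesis using True by (simp add: gev_exponent_def)
  next
    case False
    then have g: "0 < g" using that by simp
    have "ln (s + g * b) - ln (s + g * a) = ln ((s + g * b) / (s + g * a))"
      using assms by (simp add: ln_div)
    also have "\<dots> \<le> (s + g * b) / (s + g * a) - 1"
      using assms by (intro ln_le_minus_one) simp
    also have "\<dots> = g * ((b - a) / (s + g * a))"
      using assms by (simp add: field_simps)
    finally show ?thesis
      unfolding ln_eq[OF False] using g by (simp add: divide_le_eq mult.commute)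
  qed
  show "ln (gev_exponent g s a / gev_exponent g s b) \<le> (b - a) / (s + g * b)" if g: "g < 0"
  proof -
    have "ln (s + g * a) - ln (s + g * b) = ln ((s + g * a) / (s + g * b))"
      using assms by (simp add: ln_div)
    also have "\<dots> \<le> (s + g * a) / (s + g * b) - 1"
      using assms by (intro ln_le_minus_one) simp
    also have "\<dots> = - g * ((b - a) / (s + g * b))"
      using assms by (simp add: field_simps)
    finally have "(ln (s + g * a) - ln (s + g * b)) / (- g) \<le> (b - a) / (s + g * b)"
      using g by (subst pos_divide_le_eq) (simp_all add: mult.commute)
    also have "(ln (s + g * a) - ln (s + g * b)) / (- g) = (ln (s + g * b) - ln (s + g * a)) / g"
      by (metis minus_diff_eq minus_divide_divide)
    finally show ?thesis using ln_eq g by simp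
  qed
qed

context gp
begin

text \<open>In threshold stability the subtracted term is at most the value of \<open>H\<close> at
  the image of 0, which is \<open>1 - 1 / t\<close>; letting the other coordinates tend to
  \<infinity> gives the marginal bound.\<close>

lemma margin1_H_le_flow:
  assumes j: "j \<in> I" and \<sigma>: "\<And>j. j \<in> I \<Longrightarrow> 0 < \<sigma> j" and t: "1 \<le> t"
  shows "1 - margin1 H j x \<le> t * (1 - margin1 H j (flow (\<gamma> j) (\<sigma> j) t x))"
proof -
  let ?y = "\<lambda>n i. if i = j then x else real n"
  have lim: "(\<lambda>n. H (?y n)) \<longlonglongrightarrow> margin1 H j x"
    using j by (intro H.margin1_tendsto_real) auto
  have "(\<lambda>n. H (A t (?y n))) \<longlonglongrightarrow> margin1 H j (flow (\<gamma> j) (\<sigma> j) t x)"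
    unfolding margin1_def using j t
    by (intro H.margin_tendsto)
      (auto simp: approximates_const, auto simp: flow_def intro!: filterlim_affine_at_top filterlim_real_sequentially)
  then have "(\<lambda>n. t * (H (A t (?y n)) - (1 - 1 / t))) \<longlonglongrightarrow> t * (margin1 H j (flow (\<gamma> j) (\<sigma> j) t x) - (1 - 1 / t))"
    by (intro tendsto_intros)
  moreover have "t * (H (A t (?y n)) - (1 - 1 / t)) \<le> H (?y n)" for n
  proof -
    have "H (A t (\<lambda>j. min (?y n j) 0)) \<le> H (A t (\<lambda>_. 0))"
      using t by (intro H.cdf_mono) (simp add: flow_le_iff)
    then have "H (A t (\<lambda>j. min (?y n j) 0)) \<le> 1 - 1 / t"
      using H_flow_0[OF t \<sigma>] by simp
    then have "t * (H (A t (?y n)) - (1 - 1 / t)) \<le> t * (H (A t (?y n)) - H (A t (\<lambda>j. min (?y n j) 0)))"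
      using t by (intro mult_left_mono) auto
    then show ?thesis using threshold_stable[OF t \<sigma>, of "?y n"] by simp
  qed
  ultimately have "t * (margin1 H j (flow (\<gamma> j) (\<sigma> j) t x) - (1 - 1 / t)) \<le> margin1 H j x"
    using lim by (intro LIMSEQ_le[of _ _ "\<lambda>n. H (?y n)"]) auto
  then show ?thesis using t by (simp add: algebra_simps)
qed

text \<open>The flow takes \<open>a\<close> to \<open>b\<close> in the time
  \<open>e j a / e j b\<close>, so the tail shrinks by no more than this factor. The second bound
  uses \<open>1 - 1 / t \<le> ln t\<close>.\<close>

lemma margin1_H_ratio:
  assumes j: "j \<in> I" and \<sigma>: "\<And>j. j \<in> I \<Longrightarrow> 0 < \<sigma> j"
    and ab: "a < b" "0 < \<sigma> j + \<gamma> j * a" "0 < \<sigma> j + \<gamma> j * b"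
  shows "1 - margin1 H j a \<le> (e j a / e j b) * (1 - margin1 H j b)"
    and "margin1 H j b - margin1 H j a \<le> ln (e j a / e j b)"
proof -
  let ?t = "e j a / e j b"
  have pos: "0 < e j a" "0 < e j b" using ab gev_exponent_pos by auto
  have t: "1 \<le> ?t"
    using gev_exponent_strict_antimono[OF ab(2,3,1)] pos by simp
  show 1: "1 - margin1 H j a \<le> ?t * (1 - margin1 H j b)"
    using margin1_H_le_flow[OF j \<sigma> t, of a] flow_to[OF ab(2,3)] by simp
  have "x / T \<le> y" if "x \<le> T * y" "1 \<le> T" for x y T :: real
    using that by (simp add: pos_divide_le_eq mult.commute)
  from this[OF 1 t] have "(1 - margin1 H j a) / ?t \<le> 1 - margin1 H j b" .
  then have "margin1 H j b - margin1 H j a \<le> (1 - margin1 H j a) - (1 - margin1 H j a) / ?t"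
    by simp
  also have "\<dots> = (1 - margin1 H j a) * (1 - 1 / ?t)"
    by (simp only: right_diff_distrib mult_1_right times_divide_eq_right)
  also have "\<dots> \<le> 1 * (1 - 1 / ?t)"
    using H.margin1_nonneg[OF j, of a] t pos
    by (intro mult_right_mono) (auto simp: divide_le_eq le_divide_eq)
  also have "\<dots> \<le> ln ?t"
    using ln_le_minus_one[of "1 / ?t"] t pos by (simp add: ln_div)
  finally show "margin1 H j b - margin1 H j a \<le> ln ?t" .
qed

lemma V1_survival:
  assumes j: "j \<in> I" and \<sigma>: "0 < \<sigma> j" and x: "0 < \<gamma> j \<longrightarrow> 0 < \<sigma> j + \<gamma> j * x"
  shows "V {j} (\<lambda>_. x) / v = (1 - margin1 H j 0) * gp_survival (\<gamma> j) (x / \<sigma> j)"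
proof -
  have p: "1 - margin1 H j 0 = V {j} (\<lambda>_. 0) / v"
    using margin1_H_nonneg[OF j, of 0] by simp
  have V0: "V {j} (\<lambda>_. 0) = \<kappa> j * e j 0"
    using V1_eq[OF j, of "\<lambda>_. 0"] \<sigma> by simp
  have iff: "0 < 1 + \<gamma> j * (x / \<sigma> j) \<longleftrightarrow> 0 < \<sigma> j + \<gamma> j * x"
    using \<sigma> by (simp add: field_simps)
  show ?thesis
  proof (cases "0 < \<sigma> j + \<gamma> j * x")
    case True
    then have "V {j} (\<lambda>_. x) = \<kappa> j * e j 0 * gp_tail (\<gamma> j) (x / \<sigma> j)"
      using V1_eq[OF j, of "\<lambda>_. x"] gev_exponent_scale[OF \<sigma> True] by simp
    then show ?thesis
      using True iff by (simp add: p V0 gp_survival_eq_gp_tail)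
  next
    case False
    then have "margin1 G j x = 1" using margin1_outside[OF j, of x] x by auto
    then show ?thesis
      using False iff by (simp add: V_def margin1_def[symmetric] gp_survival_eq_0 not_less)
  qed
qed

lemma margin1_H_survival:
  assumes j: "j \<in> I" and \<sigma>: "0 < \<sigma> j" and x: "0 \<le> x"
  shows "margin1 H j x = 1 - (1 - margin1 H j 0) * gp_survival (\<gamma> j) (x / \<sigma> j)"
proof -
  have "0 < \<gamma> j \<longrightarrow> 0 < \<sigma> j + \<gamma> j * x" using \<sigma> x by (simp add: add_pos_nonneg)
  then show ?thesis
    using margin1_H_nonneg[OF j x] V1_survival[OF j \<sigma>] by simp
qed

text \<open>Equality holds for \<open>x \<ge> 0\<close>. For negative \<open>x\<close> the first
  term of \<open>margin1 H j x\<close> is a value of \<open>V I\<close> at a nonpositive vector,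
  hence at least \<open>v\<close>.\<close>

lemma margin1_H_ge_survival:
  assumes j: "j \<in> I" and \<sigma>: "0 < \<sigma> j" and x: "0 < \<gamma> j \<longrightarrow> 0 < \<sigma> j + \<gamma> j * x"
  shows "1 - margin1 H j x \<le> (1 - margin1 H j 0) * gp_survival (\<gamma> j) (x / \<sigma> j)"
proof -
  let ?z = "\<lambda>i. if i \<in> {j} then min x 0 else 0"
  have "0 < margin {j} G (\<lambda>_. x)"
    using margin_pos_iff[of "{j}" "\<lambda>_. x"] j x by simp
  then have "margin1 H j x = (V I ?z - V {j} (\<lambda>_. x)) / v"
    using margin_H_eq[of "{j}" "\<lambda>_. x"] j by (simp add: margin1_def)
  moreover have "v \<le> V I ?z"
  proof -
    have "G ?z \<le> G (\<lambda>_. 0)" by (intro cdf_mono) auto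
    moreover have "0 < G ?z" using x support_0 by (auto simp: cdf_pos_iff min_def)
    ultimately show ?thesis by (simp add: V_full v_def)
  qed
  ultimately have "1 - margin1 H j x \<le> V {j} (\<lambda>_. x) / v"
    using v_pos by (simp add: field_simps)
  then show ?thesis using V1_survival[OF assms] by simp
qed

lemma margin1_H_outside: "j \<in> I \<Longrightarrow> 0 < \<gamma> j \<Longrightarrow> \<sigma> j + \<gamma> j * x < 0 \<Longrightarrow> margin1 H j x = 0"
  using margin_H_outside[of "{j}" j "\<lambda>_. x"] by (simp add: margin1_def)

text \<open>Tail probabilities at a few points bound the parameters: if \<open>\<gamma>\<close> or \<open>\<sigma>\<close> were large, then the
  log-Lipschitz bounds would make the distribution function nearly constant between the points.\<close>

lemma params_bounded:
  assumes j: "j \<in> I" and \<sigma>: "\<And>j. j \<in> I \<Longrightarrow> 0 < \<sigma> j"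
    and xy: "x < y" "y < z" "z < w"
    and H: "0 < margin1 H j y" "margin1 H j z < 1" "d < margin1 H j y - margin1 H j x"
      "q < 1 - margin1 H j z" "1 - margin1 H j w < q / 2" and dq: "0 < d" "0 < q"
  defines "B \<equiv> max ((y - x) / d) ((w - z) / ln 2)"
  shows "\<bar>\<gamma> j\<bar> \<le> B / (z - y)" and "\<sigma> j \<le> B + B / (z - y) * (\<bar>y\<bar> + \<bar>z\<bar>)"
    and "0 < \<gamma> j \<longrightarrow> 0 \<le> \<sigma> j + \<gamma> j * y"
proof -
  show y: "0 < \<gamma> j \<longrightarrow> 0 \<le> \<sigma> j + \<gamma> j * y"
    using H(1) margin1_H_outside[OF j, of y] by force
  \<comment> \<open>For \<open>\<gamma> j \<ge> 0\<close> the support expression is smallest on the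
    left, and the pair \<open>z\<close>, \<open>w\<close> is used: the tail more than halves, so the
    ratio of exponents exceeds 2. For \<open>\<gamma> j < 0\<close> it is smallest on the right, and
    the pair \<open>x\<close>, \<open>y\<close> with its increment above \<open>d\<close> is used.
    The gap between \<open>y\<close> and \<open>z\<close> turns the bound on the support expression
    into one on \<open>\<gamma> j\<close>.\<close>
  have "\<bar>\<gamma> j\<bar> \<le> B / (z - y) \<and> \<sigma> j \<le> B + B / (z - y) * (\<bar>y\<bar> + \<bar>z\<bar>)"
  proof (cases "0 \<le> \<gamma> j")
    case True
    have "\<sigma> j + \<gamma> j * z = (\<sigma> j + \<gamma> j * y) + \<gamma> j * (z - y)" by (simp add: algebra_simps)
    moreover have "0 \<le> \<sigma> j + \<gamma> j * y" using True y \<sigma>[OF j] by (cases "\<gamma> j = 0") auto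
    moreover have "0 < (\<sigma> j + \<gamma> j * y) + \<gamma> j * (z - y)"
      using True y \<sigma>[OF j] xy by (cases "\<gamma> j = 0") (auto intro: add_nonneg_pos)
    ultimately have z: "0 < \<sigma> j + \<gamma> j * z" "\<gamma> j * (z - y) \<le> \<sigma> j + \<gamma> j * z" by auto
    have "\<gamma> j * z \<le> \<gamma> j * w" using True xy by (intro mult_left_mono) auto
    then have w: "0 < \<sigma> j + \<gamma> j * w" using z by simp
    have t: "0 < e j z / e j w" using gev_exponent_pos z w by simp
    have "q < e j z / e j w * (1 - margin1 H j w)"
      using margin1_H_ratio(1)[OF j \<sigma> xy(3) z(1) w] H(4) by simp
    also have "\<dots> \<le> e j z / e j w * (q / 2)"
      using H(5) t by (intro mult_left_mono) auto
    finally have "q < e j z / e j w * (q / 2)" .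
    moreover have "2 < r" if "q < r * (q / 2)" for r
    proof -
      have "0 < q * (r - 2)" using that by (simp add: algebra_simps)
      then show ?thesis using dq by (simp add: zero_less_mult_iff)
    qed
    ultimately have "2 < e j z / e j w" by blast
    then have "ln 2 < ln (e j z / e j w)" by (rule ln_less_cancel_iff[THEN iffD2, rotated 2]) (use t in auto)
    also have "\<dots> \<le> (w - z) / (\<sigma> j + \<gamma> j * z)"
      by (rule ln_gev_exponent_ratio_le(1)[OF xy(3) z(1) w True])
    finally have "\<sigma> j + \<gamma> j * z \<le> (w - z) / ln 2"
      using z by (simp add: field_simps)
    then have B: "\<sigma> j + \<gamma> j * z \<le> B" by (simp add: B_def)
    then have \<gamma>: "\<gamma> j \<le> B / (z - y)" using z xy by (simp add: field_simps)
    have "\<gamma> j * - z \<le> \<gamma> j * \<bar>z\<bar>" using True by (intro mult_left_mono) auto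
    also have "\<dots> \<le> B / (z - y) * (\<bar>y\<bar> + \<bar>z\<bar>)"
      using \<gamma> True by (intro mult_mono) auto
    finally show ?thesis using \<gamma> B True by simp
  next
    case False
    have z: "0 < \<sigma> j + \<gamma> j * z"
    proof (rule ccontr)
      assume *: "\<not> ?thesis"
      have "0 \<le> z"
      proof (rule ccontr)
        assume "\<not> 0 \<le> z"
        then have "0 < \<gamma> j * z" using False by (intro mult_neg_neg) auto
        then show False using * \<sigma>[OF j] by linarith
      qed
      moreover have "1 + \<gamma> j * (z / \<sigma> j) \<le> 0"
      proof -
        have "1 + \<gamma> j * (z / \<sigma> j) = (\<sigma> j + \<gamma> j * z) / \<sigma> j"
          using less_imp_neq[OF \<sigma>[OF j]] by (simp add: add_divide_distrib)
        also have "\<dots> \<le> 0"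
          using * by (intro divide_nonpos_pos \<sigma>[OF j]) simp
        finally show ?thesis .
      qed
      ultimately have "margin1 H j z = 1"
        by (subst margin1_H_survival[OF j \<sigma>[OF j]]) (simp_all add: gp_survival_eq_0)
      then show False using H(2) by simp
    qed
    have y_eq: "\<sigma> j + \<gamma> j * y = (\<sigma> j + \<gamma> j * z) + - \<gamma> j * (z - y)" by (simp add: algebra_simps)
    have "0 < - \<gamma> j * (z - y)" using False xy by (intro mult_pos_pos) auto
    then have y': "0 < \<sigma> j + \<gamma> j * y" "- \<gamma> j * (z - y) \<le> \<sigma> j + \<gamma> j * y"
      unfolding y_eq using z by linarith+
    have "\<gamma> j * y \<le> \<gamma> j * x" using False xy by (intro mult_left_mono_neg) auto
    then have x: "0 < \<sigma> j + \<gamma> j * x" using y' by simp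
    have "d < ln (e j x / e j y)"
      using margin1_H_ratio(2)[OF j \<sigma> xy(1) x y'(1)] H(3) by simp
    also have "\<dots> \<le> (y - x) / (\<sigma> j + \<gamma> j * y)"
      using False by (intro ln_gev_exponent_ratio_le(2)[OF xy(1) x y'(1)]) auto
    finally have "\<sigma> j + \<gamma> j * y \<le> (y - x) / d"
      using y' dq by (simp add: field_simps)
    then have B: "\<sigma> j + \<gamma> j * y \<le> B" by (simp add: B_def)
    then have "- \<gamma> j * (z - y) \<le> B" using y'(2) by linarith
    then have \<gamma>: "- \<gamma> j \<le> B / (z - y)" using xy by (simp add: pos_le_divide_eq)
    have "- \<gamma> j * y \<le> - \<gamma> j * \<bar>y\<bar>" using False by (intro mult_left_mono) auto
    also have "\<dots> \<le> B / (z - y) * (\<bar>y\<bar> + \<bar>z\<bar>)"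
      using \<gamma> False by (intro mult_mono) auto
    finally show ?thesis using \<gamma> B False by simp
  qed
  then show "\<bar>\<gamma> j\<bar> \<le> B / (z - y)" "\<sigma> j \<le> B + B / (z - y) * (\<bar>y\<bar> + \<bar>z\<bar>)" by auto
qed

end

section \<open>Subsequences, and shifts that avoid discontinuities\<close>

lemma finite_convergent_subsequence:
  fixes f :: "'a \<Rightarrow> nat \<Rightarrow> real"
  assumes "finite A" "\<And>a. a \<in> A \<Longrightarrow> Bseq (f a)"
  shows "\<exists>r. strict_mono r \<and> (\<forall>a\<in>A. convergent (\<lambda>n. f a (r n)))"
  using assms
proof (induction rule: finite_induct)
  case empty
  then show ?case by (auto intro: exI[of _ "\<lambda>n. n"] strict_monoI)
next
  case (insert a A)
  then obtain r :: "nat \<Rightarrow> nat" where r: "strict_mono r" "\<forall>a\<in>A. convergent (\<lambda>n. f a (r n))" by auto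
  have "bounded (range (f a))"
    using insert.prems[of a] by (simp add: Bseq_eq_bounded)
  then have "bounded (range (\<lambda>n. f a (r n)))"
    by (rule bounded_subset) auto
  then obtain l s where s: "strict_mono s" "((\<lambda>n. f a (r n)) \<circ> s) \<longlonglongrightarrow> l"
    using bounded_imp_convergent_subsequence by blast
  have "convergent (\<lambda>n. f b (r (s n)))" if "b \<in> A" for b
    using r(2) that convergent_subseq_convergent[OF _ s(1), of "\<lambda>n. f b (r n)"] by (auto simp: comp_def)
  moreover have "convergent (\<lambda>n. f a (r (s n)))"
    using s(2) by (auto simp: convergent_def comp_def)
  ultimately show ?case
    using strict_mono_o[OF r(1) s(1)] by (intro exI[of _ "r \<circ> s"]) (auto simp: comp_def)
qed

lemma ex_avoiding:
  fixes a b :: real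
  assumes "countable C" "a < b"
  shows "\<exists>x. a < x \<and> x < b \<and> x \<notin> C"
  using real_interval_avoid_countable_set[OF assms(2,1)] by auto

text \<open>One sequence of shifts serves all points of \<open>X\<close>, so that all coordinates of
  a vector can be shifted by the same amount; the forbidden shifts \<open>c - x\<close> are still
  countable.\<close>

lemma avoiding_sequence:
  fixes X :: "real set"
  assumes "countable C" "countable X"
  obtains \<epsilon> :: "nat \<Rightarrow> real" where "\<And>n. 0 < \<epsilon> n" "\<epsilon> \<longlonglongrightarrow> 0" "\<And>n x. x \<in> X \<Longrightarrow> x + \<epsilon> n \<notin> C"
proof -
  have "countable (\<Union>x\<in>X. (\<lambda>c. c - x) ` C)"
    using assms by auto
  then have "\<exists>e. 0 < e \<and> e < 1 / real (Suc n) \<and> e \<notin> (\<Union>x\<in>X. (\<lambda>c. c - x) ` C)" for n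
    by (intro ex_avoiding) auto
  then obtain \<epsilon> where \<epsilon>: "\<And>n. 0 < \<epsilon> n" "\<And>n. \<epsilon> n < 1 / real (Suc n)"
    "\<And>n. \<epsilon> n \<notin> (\<Union>x\<in>X. (\<lambda>c. c - x) ` C)" by metis
  have "\<epsilon> \<longlonglongrightarrow> 0"
  proof (rule tendsto_sandwich[OF _ _ tendsto_const])
    show "(\<lambda>n. 1 / real (Suc n)) \<longlonglongrightarrow> 0" using LIMSEQ_Suc[OF lim_1_over_n] by simp
  qed (use \<epsilon> in \<open>auto intro: always_eventually less_imp_le\<close>)
  moreover have "x + \<epsilon> n \<notin> C" if "x \<in> X" for n x
  proof
    assume "x + \<epsilon> n \<in> C"
    then have "\<epsilon> n \<in> (\<lambda>c. c - x) ` C" by (rule rev_image_eqI) simp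
    then show False using \<epsilon>(3)[of n] that by blast
  qed
  ultimately show ?thesis using \<epsilon>(1) by (intro that) auto
qed

lemma (in cdf_of) margin_diff_const_le:
  assumes J: "J \<subseteq> I" and y: "\<And>j. j \<in> J \<Longrightarrow> y j = x j" "\<And>j. j \<in> I - J \<Longrightarrow> y j = b"
  shows "\<bar>margin J F x - F y\<bar> \<le> real (card I) * (1 - F (\<lambda>_. b))"
proof -
  have eq: "margin J F y = margin J F x"
    using y by (intro margin_cong) auto
  have "margin J F y - F y \<le> (\<Sum>j\<in>I - J. 1 - margin1 F j (y j))"
    by (rule margin_diff_le[OF J])
  also have "\<dots> \<le> (\<Sum>j\<in>I - J. 1 - F (\<lambda>_. b))"
  proof (rule sum_mono)
    fix j assume "j \<in> I - J"
    then show "1 - margin1 F j (y j) \<le> 1 - F (\<lambda>_. b)"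
      using cdf_le_margin1[of j "\<lambda>_. b"] y(2) by simp
  qed
  also have "\<dots> = real (card (I - J)) * (1 - F (\<lambda>_. b))"
    by simp
  also have "\<dots> \<le> real (card I) * (1 - F (\<lambda>_. b))"
    using finite_index cdf_le_1 by (intro mult_right_mono of_nat_mono card_mono) auto
  finally show ?thesis
    using cdf_le_margin[OF J, of y] eq by simp
qed

lemma (in cdf_of) cdf_const_at_top:
  assumes "filterlim s at_top sequentially"
  shows "(\<lambda>n. F (\<lambda>_. s n)) \<longlonglongrightarrow> 1"
proof -
  have "(\<lambda>n. F (\<lambda>_. s n)) \<longlonglongrightarrow> margin {} F (\<lambda>_. 0)"
    using assms by (intro margin_tendsto) auto
  then show ?thesis by (simp add: margin_eq prob_space)
qed

text \<open>The danger is mass escaping to \<infinity> in the coordinates outside \<open>J\<close>.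
  As \<open>L\<close> is a cdf, its tail is small at some common level \<open>b m\<close> outside
  \<open>C\<close>, and by convergence so are the tails of \<open>H n\<close>; margins are then
  approximated by values at \<open>y\<close> uniformly in large \<open>n\<close>.\<close>

lemma margin_tendsto_off_countable:
  assumes fin: "finite I" and H: "\<And>n. ext_cdf I (H n)" and L: "ext_cdf I L" and C: "countable C"
    and conv: "\<And>x. (\<And>j. j \<in> I \<Longrightarrow> x j \<notin> C) \<Longrightarrow> (\<lambda>n. H n x) \<longlonglongrightarrow> L x"
    and J: "J \<subseteq> I" and x: "\<And>j. j \<in> J \<Longrightarrow> x j \<notin> C"
  shows "(\<lambda>n. margin J (H n) x) \<longlonglongrightarrow> margin J L x"
proof (rule LIMSEQ_I)
  fix r :: real assume r: "0 < r"
  interpret L: vec_cdf I L using L fin by unfold_locales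
  define N where "N = real (card I)"
  have "\<exists>b. real m < b \<and> b < real m + 1 \<and> b \<notin> C" for m
    by (rule ex_avoiding[OF C]) simp
  then obtain b where b: "\<And>m. real m < b m" "\<And>m. b m \<notin> C" by metis
  have "filterlim b at_top sequentially"
    using b(1) by (intro filterlim_at_top_mono[OF filterlim_real_sequentially]) (auto intro: always_eventually less_imp_le)
  from L.cdf_const_at_top[OF this] have "(\<lambda>m. N * (1 - L (\<lambda>_. b m))) \<longlonglongrightarrow> N * (1 - 1)"
    by (intro tendsto_intros)
  then have "\<forall>\<^sub>F m in sequentially. N * (1 - L (\<lambda>_. b m)) < r / 4"
    using r by (intro order_tendstoD(2)) auto
  then obtain m where m: "N * (1 - L (\<lambda>_. b m)) < r / 4"
    by (auto simp: eventually_sequentially)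
  define y where "y j = (if j \<in> J then x j else b m)" for j
  have "(\<lambda>n. H n y) \<longlonglongrightarrow> L y"
    using x b(2) by (intro conv) (auto simp: y_def)
  then have "\<forall>\<^sub>F n in sequentially. \<bar>H n y - L y\<bar> < r / 4"
    using tendstoD[of "\<lambda>n. H n y" "L y" sequentially "r / 4"] r by (simp add: dist_real_def)
  moreover have "(\<lambda>n. N * (1 - H n (\<lambda>_. b m))) \<longlonglongrightarrow> N * (1 - L (\<lambda>_. b m))"
    using b(2) by (intro tendsto_intros conv) auto
  then have "\<forall>\<^sub>F n in sequentially. N * (1 - H n (\<lambda>_. b m)) < r / 4"
    using m by (rule order_tendstoD(2))
  ultimately have "\<forall>\<^sub>F n in sequentially. norm (margin J (H n) x - margin J L x) < r"
  proof eventually_elim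
    case (elim n)
    interpret H: vec_cdf I "H n" using H fin by unfold_locales
    have "\<bar>margin J (H n) x - H n y\<bar> \<le> N * (1 - H n (\<lambda>_. b m))"
      unfolding N_def by (rule H.margin_diff_const_le[OF J]) (auto simp: y_def)
    moreover have "\<bar>margin J L x - L y\<bar> \<le> N * (1 - L (\<lambda>_. b m))"
      unfolding N_def by (rule L.margin_diff_const_le[OF J]) (auto simp: y_def)
    ultimately show ?case using elim m r unfolding real_norm_def by linarith
  qed
  then show "\<exists>no. \<forall>n\<ge>no. norm (margin J (H n) x - margin J L x) < r"
    by (simp add: eventually_sequentially)
qed

lemma (in vec_cdf) ex_right_avoiding:
  assumes j: "j \<in> I" and C: "countable C" and less: "margin1 F j x < m" and "x < b"
  shows "\<exists>y. x < y \<and> y < b \<and> y \<notin> C \<and> margin1 F j y < m"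
proof -
  obtain \<epsilon> where \<epsilon>: "\<And>n. 0 < \<epsilon> n" "\<epsilon> \<longlonglongrightarrow> 0" "\<And>n y. y \<in> {x} \<Longrightarrow> y + \<epsilon> n \<notin> C"
    using avoiding_sequence[OF C, of "{x}"] by (metis countable_insert countable_empty)
  have lim: "(\<lambda>n. x + \<epsilon> n) \<longlonglongrightarrow> x"
    using tendsto_add[OF tendsto_const \<epsilon>(2), of x] by simp
  then have "(\<lambda>n. margin1 F j (x + \<epsilon> n)) \<longlonglongrightarrow> margin1 F j x"
    using \<epsilon>(1) by (intro margin1_right_continuous j) (auto intro: less_imp_le)
  then have "\<forall>\<^sub>F n in sequentially. margin1 F j (x + \<epsilon> n) < m"
    using less by (rule order_tendstoD(2))
  moreover have "\<forall>\<^sub>F n in sequentially. x + \<epsilon> n < b"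
    using lim \<open>x < b\<close> by (rule order_tendstoD(2))
  ultimately have "\<forall>\<^sub>F n in sequentially. margin1 F j (x + \<epsilon> n) < m \<and> x + \<epsilon> n < b"
    by (rule eventually_conj)
  then obtain n where "margin1 F j (x + \<epsilon> n) < m" "x + \<epsilon> n < b"
    by (auto simp: eventually_sequentially)
  then show ?thesis
    using \<epsilon>(1)[of n] \<epsilon>(3)[of x n] by (intro exI[of _ "x + \<epsilon> n"]) auto
qed

section \<open>Limits with non-degenerate margins\<close>

text \<open>Nondegeneracy gives points \<open>x < y\<close> with an increment of the limit margin,
  then \<open>z > y\<close> where it is still below 1, and \<open>w\<close> with a tail below
  \<open>q / 2\<close>. Chosen outside \<open>C\<close>, the strict inequalities pass to
  \<open>H n\<close> for large \<open>n\<close>. The points \<open>y\<close>, \<open>z\<close> and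
  the bound \<open>q\<close> are returned because they later show that no component of the limit
  loses its mass above 0.\<close>

lemma gp_limit_params_bounded:
  assumes fin: "finite J" and gp: "\<And>n. gp J (G n) (\<gamma>n n) (\<sigma>n n) (H n)"
    and \<sigma>: "\<And>n j. j \<in> J \<Longrightarrow> 0 < \<sigma>n n j" and ext: "ext_cdf J L" and C: "countable C"
    and conv: "\<And>y. y \<notin> C \<Longrightarrow> (\<lambda>n. margin1 (H n) j y) \<longlonglongrightarrow> margin1 L j y"
    and j: "j \<in> J" and nondeg: "nondegenerate (margin1 L j)"
  shows "\<exists>B y z q. y < z \<and> 0 < q \<and> (\<forall>\<^sub>F n in sequentially. \<bar>\<gamma>n n j\<bar> \<le> B \<and> \<bar>\<sigma>n n j\<bar> \<le> B \<and>
    (0 < \<gamma>n n j \<longrightarrow> 0 \<le> \<sigma>n n j + \<gamma>n n j * y) \<and> q < 1 - margin1 (H n) j z)"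
proof -
  interpret L: vec_cdf J L using ext fin by unfold_locales
  let ?L = "margin1 L j"
  obtain x0 y0 where xy0: "x0 < y0" "?L x0 < ?L y0" "?L y0 < 1"
    using nondeg by (auto simp: nondegenerate_def)
  obtain x where x: "x0 < x" "x < y0" "x \<notin> C" "?L x < ?L y0"
    using L.ex_right_avoiding[OF j C xy0(2,1)] by blast
  obtain y where y: "y0 < y" "y \<notin> C" "?L y < 1"
    using L.ex_right_avoiding[OF j C xy0(3), of "y0 + 1"] by auto
  obtain z where z: "y < z" "z \<notin> C" "?L z < 1"
    using L.ex_right_avoiding[OF j C y(3), of "y + 1"] by auto
  have xy: "x < y" "?L x < ?L y"
    using x y L.margin1_mono[OF j, of y0 y] by auto
  define q where "q = (1 - ?L z) / 2"
  define d where "d = (?L y - ?L x) / 2"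
  have q: "0 < q" "q < 1 - ?L z" and d: "0 < d" "d < ?L y - ?L x"
    using z xy by (auto simp: q_def d_def)
  have "\<forall>\<^sub>F w in at_top. 1 - q / 2 < ?L w"
    using q by (intro order_tendstoD(1)[OF L.margin1_at_top[OF j]]) auto
  then obtain W where W: "\<And>w. W \<le> w \<Longrightarrow> 1 - q / 2 < ?L w"
    by (auto simp: eventually_at_top_linorder)
  obtain w where w: "max W z < w" "w \<notin> C"
    using ex_avoiding[OF C, of "max W z" "max W z + 1"] by auto
  have w': "1 - ?L w < q / 2" using W[of w] w by simp
  have "0 < ?L y" using xy L.margin1_nonneg[OF j, of x] by simp
  then have "\<forall>\<^sub>F n in sequentially. 0 < margin1 (H n) j y"
    by (rule order_tendstoD(1)[OF conv[OF y(2)]])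
  moreover have "\<forall>\<^sub>F n in sequentially. d < margin1 (H n) j y - margin1 (H n) j x"
    using d by (intro order_tendstoD(1)[OF tendsto_diff[OF conv[OF y(2)] conv[OF x(3)]]])
  moreover have "\<forall>\<^sub>F n in sequentially. q < 1 - margin1 (H n) j z"
    using q by (intro order_tendstoD(1)[OF tendsto_diff[OF tendsto_const conv[OF z(2)]]])
  moreover have "\<forall>\<^sub>F n in sequentially. 1 - margin1 (H n) j w < q / 2"
    using w' by (intro order_tendstoD(2)[OF tendsto_diff[OF tendsto_const conv[OF w(2)]]])
  ultimately have ev: "\<forall>\<^sub>F n in sequentially. 0 < margin1 (H n) j y \<and> d < margin1 (H n) j y - margin1 (H n) j x \<and>
      q < 1 - margin1 (H n) j z \<and> 1 - margin1 (H n) j w < q / 2"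
    by eventually_elim blast
  define B0 where "B0 = max ((y - x) / d) ((w - z) / ln 2)"
  define B where "B = max (B0 / (z - y)) (B0 + B0 / (z - y) * (\<bar>y\<bar> + \<bar>z\<bar>))"
  from ev have "\<forall>\<^sub>F n in sequentially. \<bar>\<gamma>n n j\<bar> \<le> B \<and> \<bar>\<sigma>n n j\<bar> \<le> B \<and>
    (0 < \<gamma>n n j \<longrightarrow> 0 \<le> \<sigma>n n j + \<gamma>n n j * y) \<and> q < 1 - margin1 (H n) j z"
  proof eventually_elim
    case (elim n)
    interpret gp J "G n" "\<gamma>n n" "\<sigma>n n" "H n" by (rule gp)
    have less: "z < w" "margin1 (H n) j z < 1" using w q elim by auto
    from elim have elim': "0 < margin1 (H n) j y" "d < margin1 (H n) j y - margin1 (H n) j x"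
      "q < 1 - margin1 (H n) j z" "1 - margin1 (H n) j w < q / 2" by auto
    note bounds = params_bounded[OF j \<sigma> xy(1) z(1) less(1) elim'(1) less(2) elim'(2-4) d(1) q(1), folded B0_def]
    have "\<bar>\<gamma>n n j\<bar> \<le> B" using bounds(1) by (simp add: B_def)
    moreover have "\<bar>\<sigma>n n j\<bar> \<le> B" using bounds(2) \<sigma>[OF j, of n] by (simp add: B_def)
    ultimately show ?case using bounds(3) elim'(3) by blast
  qed
  then show ?thesis using z(1) q(1) by blast
qed

text \<open>Along a subsequence the parameters and the margins at 0 converge, and \<open>c\<close>
  keeps the limits of \<sigma> positive. A subsequence suffices because \<open>L\<close> is already
  given and only has to satisfy the assumptions of the reconstruction.\<close>

lemma gp_limit_nondegenerate:
  assumes fin: "finite J" "J \<noteq> {}" and gp_n: "\<And>n. gp_params J (H n) (\<gamma>n n) (\<sigma>n n)"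
    and c: "0 < c" "\<And>n j. j \<in> J \<Longrightarrow> c \<le> \<sigma>n n j"
    and ext: "ext_cdf J L" and C: "countable C"
    and conv: "\<And>x. (\<And>j. j \<in> J \<Longrightarrow> x j \<notin> C) \<Longrightarrow> (\<lambda>n. H n x) \<longlonglongrightarrow> L x"
    and nondeg: "\<And>j. j \<in> J \<Longrightarrow> nondegenerate (margin1 L j)"
  shows "gp_cdf J L"
proof -
  interpret L: vec_cdf J L using ext fin by unfold_locales
  obtain G where gp: "\<And>n. gp J (G n) (\<gamma>n n) (\<sigma>n n) (H n)"
    using gp_n unfolding gp_params_iff by metis
  have \<sigma>n: "0 < \<sigma>n n j" if "j \<in> J" for n j using c(1) c(2)[OF that, of n] by simp
  have ext_H: "ext_cdf J (H n)" for n
  proof -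
    interpret gp J "G n" "\<gamma>n n" "\<sigma>n n" "H n" by (rule gp)
    show ?thesis by (rule H.ext_cdf)
  qed
  have mconv: "(\<lambda>n. margin1 (H n) j y) \<longlonglongrightarrow> margin1 L j y" if "j \<in> J" "y \<notin> C" for j y
    using margin_tendsto_off_countable[OF fin(1) ext_H ext C conv, of "{j}" "\<lambda>_. y"] that
    by (simp add: margin1_def)
  have ex: "\<forall>j\<in>J. \<exists>B y z q. y < z \<and> 0 < q \<and> (\<forall>\<^sub>F n in sequentially. \<bar>\<gamma>n n j\<bar> \<le> B \<and> \<bar>\<sigma>n n j\<bar> \<le> B \<and>
    (0 < \<gamma>n n j \<longrightarrow> 0 \<le> \<sigma>n n j + \<gamma>n n j * y) \<and> q < 1 - margin1 (H n) j z)"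
    using gp_limit_params_bounded[OF fin(1) gp \<sigma>n ext C mconv _ nondeg] by blast
  then obtain B y z q where bounds: "\<And>j. j \<in> J \<Longrightarrow> y j < z j" "\<And>j. j \<in> J \<Longrightarrow> 0 < q j"
    "\<And>j. j \<in> J \<Longrightarrow> \<forall>\<^sub>F n in sequentially. \<bar>\<gamma>n n j\<bar> \<le> B j \<and> \<bar>\<sigma>n n j\<bar> \<le> B j \<and>
      (0 < \<gamma>n n j \<longrightarrow> 0 \<le> \<sigma>n n j + \<gamma>n n j * y j) \<and> q j < 1 - margin1 (H n) j (z j)"
    unfolding bchoice_iff by blast
  \<comment> \<open>The three sequences of each component are packed into one family, so that a
    single extraction makes all of them converge.\<close>
  define f where "f = (\<lambda>(j, k::nat) n. if k = 0 then \<gamma>n n j else if k = 1 then \<sigma>n n j else margin1 (H n) j 0)"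
  have "\<exists>r. strict_mono r \<and> (\<forall>a\<in>J \<times> {0, 1, 2}. convergent (\<lambda>n. f a (r n)))"
  proof (rule finite_convergent_subsequence)
    show "finite (J \<times> {0::nat, 1, 2})" using fin by simp
    fix a assume "a \<in> J \<times> {0::nat, 1, 2}"
    then obtain j k where a: "a = (j, k)" "j \<in> J" by auto
    have "\<bar>margin1 (H n) j 0\<bar> \<le> 1" for n
    proof -
      interpret gp J "G n" "\<gamma>n n" "\<sigma>n n" "H n" by (rule gp)
      show ?thesis using H.margin1_nonneg[OF a(2), of 0] H.margin1_le_1[OF a(2), of 0] by simp
    qed
    then have "\<forall>\<^sub>F n in sequentially. norm (f a n) \<le> max 1 (B j)"
      using bounds(3)[OF a(2)] by (auto simp: f_def a(1) le_max_iff_disj elim!: eventually_mono)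
    moreover have "0 < max 1 (B j)" by simp
    ultimately show "Bseq (f a)"
      unfolding Bfun_def by blast
  qed
  then obtain r where r: "strict_mono r" and r_conv: "\<And>a. a \<in> J \<times> {0, 1, 2} \<Longrightarrow> convergent (\<lambda>n. f a (r n))"
    by blast
  define \<gamma> where "\<gamma> j = lim (\<lambda>n. \<gamma>n (r n) j)" for j
  define \<sigma> where "\<sigma> j = lim (\<lambda>n. \<sigma>n (r n) j)" for j
  define p where "p j = 1 - lim (\<lambda>n. margin1 (H (r n)) j 0)" for j
  have \<gamma>_lim: "(\<lambda>n. \<gamma>n (r n) j) \<longlonglongrightarrow> \<gamma> j" and \<sigma>_lim: "(\<lambda>n. \<sigma>n (r n) j) \<longlonglongrightarrow> \<sigma> j"
    and p_lim: "(\<lambda>n. 1 - margin1 (H (r n)) j 0) \<longlonglongrightarrow> p j" if "j \<in> J" for j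
    using r_conv[of "(j, 0)"] r_conv[of "(j, 1)"] r_conv[of "(j, 2)"] that
    by (auto simp: f_def \<gamma>_def \<sigma>_def p_def convergent_LIMSEQ_iff intro!: tendsto_intros)
  have \<sigma>: "0 < \<sigma> j" if "j \<in> J" for j
  proof -
    have "c \<le> \<sigma> j" using c(2)[OF that] by (intro LIMSEQ_le_const[OF \<sigma>_lim[OF that]]) auto
    then show ?thesis using c(1) by simp
  qed
  have survival_lim: "(\<lambda>n. 1 - (1 - margin1 (H (r n)) j 0) * gp_survival (\<gamma>n (r n) j) (xn n / \<sigma>n (r n) j))
      \<longlonglongrightarrow> 1 - p j * gp_survival (\<gamma> j) (x / \<sigma> j)"
    if j: "j \<in> J" and x: "xn \<longlonglongrightarrow> x" "0 < \<gamma> j \<longrightarrow> 0 < \<sigma> j + \<gamma> j * x" for j xn x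
  proof (intro tendsto_intros p_lim[OF j] gp_survival_tendsto \<gamma>_lim[OF j] \<sigma>_lim[OF j] x(1))
    show "\<sigma> j \<noteq> 0" using \<sigma>[OF j] by simp
    have "1 + \<gamma> j * (x / \<sigma> j) = (\<sigma> j + \<gamma> j * x) / \<sigma> j" using \<sigma>[OF j] by (simp add: field_simps)
    then show "0 < \<gamma> j \<longrightarrow> 0 < 1 + \<gamma> j * (x / \<sigma> j)" using x(2) \<sigma>[OF j] by simp
  qed
  have margin_lim: "(\<lambda>n. margin1 (H (r n)) j (xn n)) \<longlonglongrightarrow> 1 - p j * gp_survival (\<gamma> j) (x / \<sigma> j)"
    if j: "j \<in> J" and x: "xn \<longlonglongrightarrow> x" "0 \<le> x" "\<forall>\<^sub>F n in sequentially. 0 \<le> xn n" for j xn x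
  proof (rule Lim_transform_eventually[OF survival_lim[OF j x(1)]])
    show "0 < \<gamma> j \<longrightarrow> 0 < \<sigma> j + \<gamma> j * x" using x(2) \<sigma>[OF j] by (simp add: add_pos_nonneg)
    show "\<forall>\<^sub>F n in sequentially. 1 - (1 - margin1 (H (r n)) j 0) * gp_survival (\<gamma>n (r n) j) (xn n / \<sigma>n (r n) j) =
        margin1 (H (r n)) j (xn n)"
      using x(3)
    proof eventually_elim
      case (elim n)
      interpret gp J "G (r n)" "\<gamma>n (r n)" "\<sigma>n (r n)" "H (r n)" by (rule gp)
      show ?case by (rule margin1_H_survival[OF j \<sigma>n[OF j] elim, symmetric])
    qed
  qed
  have mconv_r: "(\<lambda>n. margin1 (H (r n)) j y) \<longlonglongrightarrow> margin1 L j y" if "j \<in> J" "y \<notin> C" for j y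
    using LIMSEQ_subseq_LIMSEQ[OF mconv[OF that] r] by (simp add: comp_def)
  have conv_r: "(\<lambda>n. H (r n) x) \<longlonglongrightarrow> L x" if "\<And>j. j \<in> J \<Longrightarrow> x j \<notin> C" for x
    using LIMSEQ_subseq_LIMSEQ[OF conv[OF that] r] by (simp add: comp_def)
  have margin_L: "margin1 L j x = 1 - p j * gp_survival (\<gamma> j) (x / \<sigma> j)" if j: "j \<in> J" and x: "0 \<le> x" for j x
  proof -
    obtain \<epsilon> where \<epsilon>: "\<And>n. 0 < \<epsilon> n" "\<epsilon> \<longlonglongrightarrow> 0" "\<And>n y. y \<in> {x} \<Longrightarrow> y + \<epsilon> n \<notin> C"
      using avoiding_sequence[OF C, of "{x}"] by (metis countable_insert countable_empty)
    have lim: "(\<lambda>n. x + \<epsilon> n) \<longlonglongrightarrow> x"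
      using tendsto_add[OF tendsto_const \<epsilon>(2), of x] by simp
    have "margin1 L j (x + \<epsilon> m) = 1 - p j * gp_survival (\<gamma> j) ((x + \<epsilon> m) / \<sigma> j)" for m
    proof (rule LIMSEQ_unique)
      show "(\<lambda>n. margin1 (H (r n)) j (x + \<epsilon> m)) \<longlonglongrightarrow> margin1 L j (x + \<epsilon> m)"
        using \<epsilon>(3) by (intro mconv_r j) auto
      show "(\<lambda>n. margin1 (H (r n)) j (x + \<epsilon> m)) \<longlonglongrightarrow> 1 - p j * gp_survival (\<gamma> j) ((x + \<epsilon> m) / \<sigma> j)"
        using x \<epsilon>(1)[of m] by (intro margin_lim j) auto
    qed
    moreover have "(\<lambda>m. 1 - p j * gp_survival (\<gamma> j) ((x + \<epsilon> m) / \<sigma> j)) \<longlonglongrightarrow> 1 - p j * gp_survival (\<gamma> j) (x / \<sigma> j)"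
    proof (intro tendsto_intros gp_survival_tendsto lim)
      show "\<sigma> j \<noteq> 0" using \<sigma>[OF j] by simp
      show "0 < \<gamma> j \<longrightarrow> 0 < 1 + \<gamma> j * (x / \<sigma> j)" using x \<sigma>[OF j] by (simp add: add_pos_nonneg)
    qed
    moreover have "(\<lambda>m. margin1 L j (x + \<epsilon> m)) \<longlonglongrightarrow> margin1 L j x"
      using \<epsilon>(1) by (intro L.margin1_right_continuous j lim) (auto intro: less_imp_le)
    ultimately show ?thesis using LIMSEQ_unique by (simp only:)
  qed
  \<comment> \<open>If \<open>p j\<close> were 0, the survival function would force the tails of
    \<open>H (r n)\<close> at \<open>z j\<close> to vanish in the limit, against the lower bound
    \<open>q j\<close>. As \<open>z j\<close> may be negative, \<open>y j < z j\<close> is used to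
    keep it strictly inside the limiting support.\<close>
  have p: "0 < p j" if j: "j \<in> J" for j
  proof -
    have ev: "\<forall>\<^sub>F n in sequentially. (0 < \<gamma>n (r n) j \<longrightarrow> 0 \<le> \<sigma>n (r n) j + \<gamma>n (r n) j * y j) \<and>
        q j < 1 - margin1 (H (r n)) j (z j)"
      using eventually_subseq[OF r bounds(3)[OF j]] by eventually_elim blast
    have y: "0 \<le> \<sigma> j + \<gamma> j * y j" if "0 < \<gamma> j"
    proof (rule tendsto_lowerbound)
      show "(\<lambda>n. \<sigma>n (r n) j + \<gamma>n (r n) j * y j) \<longlonglongrightarrow> \<sigma> j + \<gamma> j * y j"
        by (intro tendsto_intros \<gamma>_lim \<sigma>_lim j)
      show "\<forall>\<^sub>F n in sequentially. 0 \<le> \<sigma>n (r n) j + \<gamma>n (r n) j * y j"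
        using ev order_tendstoD(1)[OF \<gamma>_lim[OF j] that] by eventually_elim auto
    qed simp
    have z: "0 < \<gamma> j \<longrightarrow> 0 < \<sigma> j + \<gamma> j * z j"
    proof
      assume *: "0 < \<gamma> j"
      then have "\<gamma> j * y j < \<gamma> j * z j" using bounds(1)[OF j] by simp
      then show "0 < \<sigma> j + \<gamma> j * z j" using y[OF *] by simp
    qed
    have "(\<lambda>n. 1 - (1 - margin1 (H (r n)) j 0) * gp_survival (\<gamma>n (r n) j) (z j / \<sigma>n (r n) j))
      \<longlonglongrightarrow> 1 - p j * gp_survival (\<gamma> j) (z j / \<sigma> j)"
      by (rule survival_lim[OF j tendsto_const z])
    moreover have "\<forall>\<^sub>F n in sequentially. 1 - (1 - margin1 (H (r n)) j 0) * gp_survival (\<gamma>n (r n) j) (z j / \<sigma>n (r n) j) \<le> 1 - q j"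
      using ev
    proof eventually_elim
      case (elim n)
      interpret gp J "G (r n)" "\<gamma>n (r n)" "\<sigma>n (r n)" "H (r n)" by (rule gp)
      have "0 < \<sigma>n (r n) j + \<gamma>n (r n) j * z j" if *: "0 < \<gamma>n (r n) j"
      proof -
        have "\<gamma>n (r n) j * y j < \<gamma>n (r n) j * z j" using * bounds(1)[OF j] by simp
        moreover have "0 \<le> \<sigma>n (r n) j + \<gamma>n (r n) j * y j" using elim * by blast
        ultimately show ?thesis by linarith
      qed
      then show ?case
        using margin1_H_ge_survival[OF j \<sigma>n[OF j], of "z j"] elim by auto
    qed
    ultimately have "1 - p j * gp_survival (\<gamma> j) (z j / \<sigma> j) \<le> 1 - q j"
      by (rule tendsto_upperbound) simp
    then have "0 < p j * gp_survival (\<gamma> j) (z j / \<sigma> j)" using bounds(2)[OF j] by simp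
    then show ?thesis using gp_survival_nonneg[of "\<gamma> j" "z j / \<sigma> j"] by (auto simp: zero_less_mult_iff)
  qed
  \<comment> \<open>The arguments may vary with \<open>n\<close> because the margins converge to
    continuous limits on the positive half-line, and a joint cdf varies by no more than its margins
    do. The auxiliary point \<open>u\<close> lies off \<open>C\<close> and close to
    \<open>x\<close>.\<close>
  have key: "(\<lambda>n. H (r n) (xn n)) \<longlonglongrightarrow> L x"
    if pos: "\<And>j. j \<in> J \<Longrightarrow> 0 < x j" and lim: "\<And>j. j \<in> J \<Longrightarrow> (\<lambda>n. xn n j) \<longlonglongrightarrow> x j" for xn x
  proof (rule LIMSEQ_I)
    fix a :: real assume a: "0 < a"
    obtain \<epsilon> where \<epsilon>: "\<And>n. 0 < \<epsilon> n" "\<epsilon> \<longlonglongrightarrow> 0" "\<And>n y. y \<in> x ` J \<Longrightarrow> y + \<epsilon> n \<notin> C"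
      using avoiding_sequence[OF C, of "x ` J"] fin(1) by (metis countable_finite finite_imageI)
    define D where "D u = (\<Sum>j\<in>J. \<bar>margin1 L j (x j) - margin1 L j (u j)\<bar>)" for u
    have "(\<lambda>m. D (\<lambda>j. x j + \<epsilon> m)) \<longlonglongrightarrow> (\<Sum>j\<in>J. \<bar>margin1 L j (x j) - margin1 L j (x j)\<bar>)"
      unfolding D_def
    proof (intro tendsto_intros L.margin1_right_continuous)
      show "(\<lambda>m. x j + \<epsilon> m) \<longlonglongrightarrow> x j" for j
        using tendsto_add[OF tendsto_const \<epsilon>(2), of "x j"] by simp
    qed (use \<epsilon>(1) in \<open>auto intro: less_imp_le\<close>)
    then have "\<forall>\<^sub>F m in sequentially. D (\<lambda>j. x j + \<epsilon> m) < a / 4"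
      using a by (intro order_tendstoD(2)) auto
    then obtain m where m: "D (\<lambda>j. x j + \<epsilon> m) < a / 4"
      by (auto simp: eventually_sequentially)
    define u where "u j = x j + \<epsilon> m" for j
    have u: "0 < u j" "u j \<notin> C" if "j \<in> J" for j
      using pos[OF that] \<epsilon>(1)[of m] \<epsilon>(3)[of "x j" m] that by (auto simp: u_def)
    have D: "D u < a / 4" using m by (simp add: u_def[abs_def])
    have "(\<lambda>n. H (r n) u) \<longlonglongrightarrow> L u" using u by (intro conv_r) auto
    then have "\<forall>\<^sub>F n in sequentially. \<bar>H (r n) u - L u\<bar> < a / 4"
      using tendstoD[of "\<lambda>n. H (r n) u" "L u" sequentially "a / 4"] a by (simp add: dist_real_def)
    moreover have "(\<lambda>n. \<Sum>j\<in>J. \<bar>margin1 (H (r n)) j (xn n j) - margin1 (H (r n)) j (u j)\<bar>) \<longlonglongrightarrow> D u"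
      unfolding D_def
    proof (intro tendsto_intros)
      fix j assume j: "j \<in> J"
      show "(\<lambda>n. margin1 (H (r n)) j (xn n j)) \<longlonglongrightarrow> margin1 L j (x j)"
        unfolding margin_L[OF j less_imp_le[OF pos[OF j]]] using order_tendstoD(1)[OF lim[OF j] pos[OF j]]
        by (intro margin_lim[OF j lim[OF j]]) (auto intro: less_imp_le pos[OF j] elim: eventually_mono)
      show "(\<lambda>n. margin1 (H (r n)) j (u j)) \<longlonglongrightarrow> margin1 L j (u j)"
        using u[OF j] by (intro mconv_r j)
    qed
    then have "\<forall>\<^sub>F n in sequentially. (\<Sum>j\<in>J. \<bar>margin1 (H (r n)) j (xn n j) - margin1 (H (r n)) j (u j)\<bar>) < a / 4"
      using D by (rule order_tendstoD(2))
    ultimately have "\<forall>\<^sub>F n in sequentially. norm (H (r n) (xn n) - L x) < a"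
    proof eventually_elim
      case (elim n)
      interpret gp J "G (r n)" "\<gamma>n (r n)" "\<sigma>n (r n)" "H (r n)" by (rule gp)
      have "\<bar>H (r n) (xn n) - H (r n) u\<bar> < a / 4"
        using H.cdf_lipschitz[of "xn n" u] elim by simp
      moreover have "\<bar>L x - L u\<bar> < a / 4"
        using L.cdf_lipschitz[of x u] D by (simp add: D_def)
      ultimately show ?case using elim a unfolding real_norm_def by linarith
    qed
    then show "\<exists>no. \<forall>n\<ge>no. norm (H (r n) (xn n) - L x) < a"
      by (simp add: eventually_sequentially)
  qed
  have "gp_params J L \<gamma> \<sigma>"
  proof (rule gp_reconstruct[OF fin ext \<sigma>])
    show "margin1 L j 0 < 1" if "j \<in> J" for j
      using margin_L[OF that, of 0] p[OF that] by simp
    show "L x = 0" if j: "j \<in> J" "0 < \<gamma> j" "\<sigma> j + \<gamma> j * x j < 0" for x j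
    proof -
      have "x j < - \<sigma> j / \<gamma> j" using j by (simp add: field_simps)
      then obtain y where y: "x j < y" "y < - \<sigma> j / \<gamma> j" "y \<notin> C"
        using ex_avoiding[OF C] by blast
      then have neg: "\<sigma> j + \<gamma> j * y < 0" using j(2) by (simp add: field_simps)
      have "(\<lambda>n. \<sigma>n (r n) j + \<gamma>n (r n) j * y) \<longlonglongrightarrow> \<sigma> j + \<gamma> j * y"
        by (intro tendsto_intros \<gamma>_lim \<sigma>_lim j)
      from order_tendstoD(2)[OF this neg] order_tendstoD(1)[OF \<gamma>_lim[OF j(1)] j(2)]
      have "\<forall>\<^sub>F n in sequentially. margin1 (H (r n)) j y = 0"
      proof eventually_elim
        case (elim n)
        interpret gp J "G (r n)" "\<gamma>n (r n)" "\<sigma>n (r n)" "H (r n)" by (rule gp)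
        show ?case using margin1_H_outside[OF j(1)] elim by blast
      qed
      then have "(\<lambda>n. margin1 (H (r n)) j y) \<longlonglongrightarrow> 0"
        by (rule tendsto_eventually)
      then have "margin1 L j y = 0"
        using mconv_r[OF j(1) y(3)] LIMSEQ_unique by blast
      then show ?thesis
        using L.cdf_le_margin1[OF j(1), of x] L.margin1_mono[OF j(1), of "x j" y] y L.cdf_nonneg[of x] by simp
    qed
    show "L x = t * (L (\<lambda>j. flow (\<gamma> j) (\<sigma> j) t (x j)) - L (\<lambda>j. flow (\<gamma> j) (\<sigma> j) t (min (x j) 0)))"
      if t: "1 \<le> t" and pos: "\<And>j. j \<in> J \<Longrightarrow> 0 < flow (\<gamma> j) (\<sigma> j) t (min (x j) 0)" for t x
    proof -
      let ?A = "\<lambda>x j. flow (\<gamma> j) (\<sigma> j) t (x j)" and ?x' = "\<lambda>x j. min (x j) 0"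
      \<comment> \<open>At points off \<open>C\<close> the left side converges directly; the right
        side is evaluated at positive points that depend on \<open>n\<close> through the flow, as
        \<open>key\<close> permits. The general case follows by shifting to the right.\<close>
      have off_C: "L x = t * (L (?A x) - L (?A (?x' x)))"
        if x: "\<And>j. j \<in> J \<Longrightarrow> x j \<notin> C" and pos: "\<And>j. j \<in> J \<Longrightarrow> 0 < ?A (?x' x) j" for x
      proof (rule LIMSEQ_unique[OF conv_r[OF x]])
        let ?An = "\<lambda>n x j. flow (\<gamma>n (r n) j) (\<sigma>n (r n) j) t (x j)"
        have "(\<lambda>n. t * (H (r n) (?An n x) - H (r n) (?An n (?x' x)))) \<longlonglongrightarrow> t * (L (?A x) - L (?A (?x' x)))"
        proof (intro tendsto_intros key pos)
          show "0 < ?A x j" if "j \<in> J" for j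
          proof -
            have "?A (?x' x) j \<le> ?A x j" using t by (simp add: flow_le_iff)
            then show ?thesis using pos[OF that] by linarith
          qed
        qed (use t \<gamma>_lim \<sigma>_lim in \<open>auto intro!: flow_tendsto\<close>)
        moreover have "H (r n) x = t * (H (r n) (?An n x) - H (r n) (?An n (?x' x)))" for n
          by (rule gp.threshold_stable[OF gp t \<sigma>n])
        ultimately show "(\<lambda>n. H (r n) x) \<longlonglongrightarrow> t * (L (?A x) - L (?A (?x' x)))" by simp
      qed
      obtain \<epsilon> where \<epsilon>: "\<And>n. 0 < \<epsilon> n" "\<epsilon> \<longlonglongrightarrow> 0" "\<And>n y. y \<in> x ` J \<Longrightarrow> y + \<epsilon> n \<notin> C"
        using avoiding_sequence[OF C, of "x ` J"] fin(1) by (metis countable_finite finite_imageI)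
      let ?y = "\<lambda>m j. x j + \<epsilon> m"
      have y: "(\<lambda>m. ?y m j) \<longlonglongrightarrow> x j" for j
        using tendsto_add[OF tendsto_const \<epsilon>(2), of "x j"] by simp
      have ge: "?A x j \<le> ?A (?y m) j" "?A (?x' x) j \<le> ?A (?x' (?y m)) j" for m j
        using t \<epsilon>(1)[of m] by (auto simp: flow_le_iff min_def)
      have eq: "L (?y m) = t * (L (?A (?y m)) - L (?A (?x' (?y m))))" for m
      proof (rule off_C)
        show "0 < ?A (?x' (?y m)) j" if "j \<in> J" for j
          using pos[OF that] ge(2)[of j m] by linarith
      qed (use \<epsilon>(3) in auto)
      have lim: "(\<lambda>m. L (?y m)) \<longlonglongrightarrow> L x"
        using y \<epsilon>(1) by (intro L.cdf_right_continuous) (auto intro: less_imp_le)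
      have "(\<lambda>m. t * (L (?A (?y m)) - L (?A (?x' (?y m))))) \<longlonglongrightarrow> t * (L (?A x) - L (?A (?x' x)))"
      proof (intro tendsto_intros L.cdf_right_continuous)
        show "(\<lambda>m. ?A (?y m) j) \<longlonglongrightarrow> ?A x j" for j
          using t by (intro flow_tendsto y tendsto_const) auto
        show "(\<lambda>m. ?A (?x' (?y m)) j) \<longlonglongrightarrow> ?A (?x' x) j" for j
          using t by (intro flow_tendsto tendsto_min y tendsto_const) auto
      qed (use ge in auto)
      from LIMSEQ_unique[OF lim this[folded eq]] show ?thesis .
    qed
  qed
  then show ?thesis by (rule gp_params_imp_gp_cdf)
qed

section \<open>Components that escape to minus infinity\<close>

text \<open>The law of minus a standard exponential variable, the max-stable law of shape -1 with
  upper endpoint 0. As its cdf is 1 on the nonnegative half-line, a factor of this form leaves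
  values at 0 unchanged.\<close>

lemma real_cdf_exp_min: "real_cdf {j} (\<lambda>x. exp (min (x j) 0))"
  and margin1_exp_min: "margin1 (\<lambda>x. exp (min (x j) 0)) j y = exp (min y 0)"
proof -
  let ?F = "\<lambda>y::real. exp (min y 0)"
  have cont: "continuous (at_right a) ?F" for a
    by (intro continuous_intros)
  have bot: "(?F \<longlongrightarrow> 0) at_bot"
  proof (rule Lim_transform_eventually[OF exp_at_bot])
    show "\<forall>\<^sub>F x in at_bot. exp x = ?F x"
      using eventually_le_at_bot[of 0] by eventually_elim simp
  qed
  have top: "(?F \<longlongrightarrow> 1) at_top"
  proof (rule tendsto_eventually)
    show "\<forall>\<^sub>F x in at_top. ?F x = 1"
      using eventually_ge_at_top[of 0] by eventually_elim simp
  qed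
  interpret real_distribution "interval_measure ?F"
    using cont bot top by (intro real_distribution_interval_measure) auto
  have "cdf (interval_measure ?F) = ?F"
    using cont bot by (intro cdf_interval_measure) auto
  then have "has_cdf (interval_measure ?F) {j} (\<lambda>_ \<omega>. ereal \<omega>) (\<lambda>x. ?F (x j))"
    by (auto simp: has_cdf_def cdf_def prob_space_axioms atMost_def fun_eq_iff)
  then have ext: "ext_cdf {j} (\<lambda>x. ?F (x j))"
    by (rule has_cdf_imp_ext_cdf) simp
  interpret E: vec_cdf "{j}" "\<lambda>x. ?F (x j)"
    using ext by unfold_locales auto
  show margin: "margin1 (\<lambda>x. ?F (x j)) j y = ?F y" for y
    using E.margin_full by (simp add: margin1_def)
  have "(\<lambda>n. ?F (- real n)) \<longlonglongrightarrow> 0"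
    by (rule filterlim_compose[OF bot]) (simp add: filterlim_uminus_at_bot filterlim_real_sequentially)
  then show "real_cdf {j} (\<lambda>x. ?F (x j))"
    using ext by (simp add: real_cdf_iff margin)
qed

text \<open>A component that is almost surely \<open>-\<infinity>\<close> under \<open>H\<close> corresponds to an independent component of
  \<open>G\<close> with upper endpoint at most \<open>0\<close>.\<close>

lemma gp_assoc_insert:
  assumes assoc: "gp_assoc J K G" and j: "j \<notin> J" and ext: "ext_cdf (insert j J) K"
  shows "gp_assoc (insert j J) K (\<lambda>x. G x * exp (min (x j) 0))"
proof -
  let ?E = "\<lambda>x::'a \<Rightarrow> real. exp (min (x j) 0)" and ?I = "insert j J"
  let ?G = "\<lambda>x. G x * ?E x"
  have gev: "gev_cdf J G" and G0: "0 < G (\<lambda>_. 0)" "G (\<lambda>_. 0) < 1" using assoc by (auto simp: gp_assoc_def)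
  then have fin: "finite J" "J \<noteq> {}" and real: "real_cdf J G" and max: "max_stable J G"
    by (auto simp: gev_cdf_def)
  interpret G: vec_cdf J G by (rule gev_cdf_imp_vec_cdf[OF gev])
  interpret E: vec_cdf "{j}" ?E
    using real_cdf_imp_ext_cdf[OF real_cdf_exp_min] by unfold_locales auto
  have ext_G: "ext_cdf ?I ?G"
    using ext_cdf_mult[OF G.ext_cdf E.ext_cdf] fin by simp
  interpret GE: vec_cdf ?I ?G using ext_G fin by unfold_locales auto
  have lim: "(\<lambda>n. ?G (\<lambda>k. if k = i then y else real n)) \<longlonglongrightarrow> margin1 ?G i y" if "i \<in> ?I" for i y
    using that by (intro GE.margin1_tendsto_real) auto
  have margin_J: "margin1 ?G i y = margin1 G i y" if i: "i \<in> J" for i y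
  proof (rule LIMSEQ_unique[OF lim])
    have "(\<lambda>n. G (\<lambda>k. if k = i then y else real n)) \<longlonglongrightarrow> margin1 G i y"
      using i by (intro G.margin1_tendsto_real) auto
    moreover have "j \<noteq> i" using i j by auto
    ultimately show "(\<lambda>n. ?G (\<lambda>k. if k = i then y else real n)) \<longlonglongrightarrow> margin1 G i y"
      by simp
  qed (use i in auto)
  have margin_j: "margin1 ?G j y = exp (min y 0)" for y
  proof (rule LIMSEQ_unique[OF lim])
    have "(\<lambda>n. G (\<lambda>k. if k = j then y else real n)) = (\<lambda>n. G (\<lambda>_. real n))"
      using j by (intro HOL.ext G.cdf_cong) auto
    then have "(\<lambda>n. G (\<lambda>k. if k = j then y else real n) * exp (min y 0)) \<longlonglongrightarrow> 1 * exp (min y 0)"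
      using G.cdf_const_at_top[OF filterlim_real_sequentially] by (intro tendsto_mult tendsto_const) simp
    then show "(\<lambda>n. ?G (\<lambda>k. if k = j then y else real n)) \<longlonglongrightarrow> exp (min y 0)"
      by simp
  qed simp
  have "real_cdf ?I ?G"
    using ext_G real real_cdf_exp_min[of j] fin
    by (auto simp: real_cdf_iff margin_J margin_j margin1_exp_min)
  moreover have "nondegenerate (margin1 ?G i)" if "i \<in> ?I" for i
  proof (cases "i = j")
    case True
    then show ?thesis
      unfolding nondegenerate_def True margin_j by (intro exI[of _ "-2"] exI[of _ "-1"]) auto
  next
    case False
    then have "i \<in> J" using that by simp
    moreover from this have "nondegenerate (margin1 G i)" using gev by (simp add: gev_cdf_def)
    ultimately show ?thesis by (simp add: nondegenerate_def margin_J)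
  qed
  moreover have "max_stable ?I ?G"
    unfolding max_stable_def
  proof (intro allI impI)
    fix t :: real assume t: "0 < t"
    then obtain a b where ab: "\<forall>i\<in>J. 0 < a i" "\<And>x. G (\<lambda>i. a i * x i + b i) powr t = G x"
      using max unfolding max_stable_def by blast
    let ?a = "a(j := 1 / t)" and ?b = "b(j := 0)"
    have "?G (\<lambda>i. ?a i * x i + ?b i) powr t = ?G x" for x
    proof -
      have "G (\<lambda>i. ?a i * x i + ?b i) = G (\<lambda>i. a i * x i + b i)"
        using j by (intro G.cdf_cong) auto
      moreover have "min (x j / t) 0 * t = min (x j) 0"
        using t by (auto simp: min_def field_simps)
      then have "exp (min (x j / t) 0) powr t = exp (min (x j) 0)"
        by (simp add: powr_def mult.commute)
      ultimately show ?thesis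
        using ab(2)[of x] by (simp add: powr_mult)
    qed
    then show "\<exists>a b. (\<forall>i\<in>?I. 0 < a i) \<and> (\<forall>x. ?G (\<lambda>i. a i * x i + b i) powr t = ?G x)"
      using ab(1) t j by (intro exI[of _ ?a] exI[of _ ?b]) auto
  qed
  ultimately have "gev_cdf ?I ?G"
    using fin by (simp add: gev_cdf_def)
  moreover have le: "lower_endpoint (margin1 ?G j) < ereal y" for y
    unfolding lower_endpoint_less_iff margin_j by (auto intro: exI[of _ "y - 1"])
  moreover have "margin1 ?G i = margin1 G i" if "i \<in> J" for i using margin_J[OF that] by blast
  moreover have "K x = 1 / ln (?G (\<lambda>_. 0)) * ln (?G (\<lambda>j. min (x j) 0) / ?G x)"
    if "\<forall>i\<in>J. lower_endpoint (margin1 G i) < ereal (x i)" for x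
  proof -
    \<comment> \<open>The new factor depends on its coordinate only through the minimum with 0, so
      it cancels in the quotient; at 0 it is 1.\<close>
    have "?G (\<lambda>j. min (x j) 0) / ?G x = G (\<lambda>j. min (x j) 0) / G x"
      by (simp add: min.assoc)
    then show ?thesis using assoc that by (simp add: gp_assoc_def)
  qed
  moreover have "K x = 0" if "\<exists>i\<in>J. ereal (x i) < lower_endpoint (margin1 G i)" for x
    using assoc that by (simp add: gp_assoc_def)
  moreover have "\<not> ereal y < lower_endpoint (margin1 ?G j)" for y
    using le[of y] by (meson less_asym)
  ultimately show ?thesis
    using G0 ext unfolding gp_assoc_def by auto
qed

text \<open>\<open>L\<close> is continuous at \<open>x\<close> as soon as every margin is continuous
  at \<open>x j\<close>, because increments of \<open>L\<close> are bounded by those of the margins;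
  monotone margins have countably many discontinuities.\<close>

lemma conv_in_dist_off_countable:
  assumes "ext_cdf I L" "finite I" and conv: "conv_in_dist H L"
  obtains C where "countable C" "\<And>x. (\<And>j. j \<in> I \<Longrightarrow> x j \<notin> C) \<Longrightarrow> (\<lambda>n. H n x) \<longlonglongrightarrow> L x"
proof -
  interpret vec_cdf I L using assms by unfold_locales
  define C where "C = (\<Union>j\<in>I. {a. \<not> isCont (margin1 L j) a})"
  have "countable C"
    unfolding C_def using assms(2) margin1_mono
    by (intro countable_UN countable_finite mono_ctble_discont) (auto simp: mono_def)
  moreover have "(\<lambda>n. H n x) \<longlonglongrightarrow> L x" if x: "\<And>j. j \<in> I \<Longrightarrow> x j \<notin> C" for x
  proof -
    have "((\<lambda>y. L y - L x) \<longlongrightarrow> 0) (nhds x)"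
    proof (rule Lim_null_comparison)
      show "\<forall>\<^sub>F y in nhds x. norm (L y - L x) \<le> (\<Sum>j\<in>I. \<bar>margin1 L j (y j) - margin1 L j (x j)\<bar>)"
        using cdf_lipschitz by (auto intro: always_eventually)
      have "((\<lambda>y. \<Sum>j\<in>I. \<bar>margin1 L j (y j) - margin1 L j (x j)\<bar>) \<longlongrightarrow>
          (\<Sum>j\<in>I. \<bar>margin1 L j (x j) - margin1 L j (x j)\<bar>)) (nhds x)"
      proof (intro tendsto_intros)
        fix j assume j: "j \<in> I"
        have "((\<lambda>y. y j) \<longlongrightarrow> x j) (nhds x)"
        proof (rule topological_tendstoI)
          fix S :: "real set" assume S: "open S" "x j \<in> S"
          then have "open ((\<lambda>y. y j) -` S)"
            by (intro open_vimage continuous_on_product_coordinates)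
          then show "\<forall>\<^sub>F y in nhds x. y j \<in> S"
            using S(2) by (auto simp: eventually_nhds)
        qed
        moreover have "isCont (margin1 L j) (x j)"
          using x[OF j] j by (auto simp: C_def)
        ultimately show "((\<lambda>y. margin1 L j (y j)) \<longlongrightarrow> margin1 L j (x j)) (nhds x)"
          by (rule isCont_tendsto_compose[rotated])
      qed
      then show "((\<lambda>y. \<Sum>j\<in>I. \<bar>margin1 L j (y j) - margin1 L j (x j)\<bar>) \<longlongrightarrow> 0) (nhds x)"
        by simp
    qed
    then have "(L \<longlongrightarrow> L x) (nhds x)"
      by (simp add: LIM_zero_iff)
    then show ?thesis using conv by (simp add: conv_in_dist_def)
  qed
  ultimately show ?thesis by (rule that)
qed

text \<open>The components in \<open>D\<close>, almost surely -\<infinity> in the limit, are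
  removed. A margin of \<open>H n\<close> on the remaining \<open>J\<close> need not be a
  generalized Pareto cdf, so it is conditioned on a positive component, which keeps the parameters.
  The probability \<open>\<beta> n\<close> of having none tends to 0, so the conditioned cdfs have
  the same limit. Afterwards the components of \<open>D\<close> are attached one at a time.\<close>

lemma gp_cdf_limit:
  assumes fin: "finite I" and gp_n: "\<And>n. gp_params I (H n) (\<gamma>n n) (\<sigma>n n)"
    and c: "0 < c" "\<And>n j. j \<in> I \<Longrightarrow> c \<le> \<sigma>n n j"
    and ext: "ext_cdf I L" and conv: "conv_in_dist H L"
    and margins: "\<And>j. j \<in> I \<Longrightarrow> nondegenerate (margin1 L j) \<or> (\<forall>y. margin1 L j y = 1)"
  shows "gp_cdf I L"
proof -
  interpret L: vec_cdf I L using ext fin by unfold_locales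
  obtain G where gp: "\<And>n. gp I (G n) (\<gamma>n n) (\<sigma>n n) (H n)"
    using gp_n unfolding gp_params_iff by metis
  have \<sigma>n: "0 < \<sigma>n n j" if "j \<in> I" for n j using c(1) c(2)[OF that, of n] by simp
  have ext_H: "ext_cdf I (H n)" for n
  proof -
    interpret gp I "G n" "\<gamma>n n" "\<sigma>n n" "H n" by (rule gp)
    show ?thesis by (rule H.ext_cdf)
  qed
  have H_0: "H n (\<lambda>_. 0) = 0" for n
    by (rule gp_cdf_0[OF gp_params_imp_gp_cdf[OF gp_n]])
  obtain C where C: "countable C" and C_conv: "\<And>x. (\<And>j. j \<in> I \<Longrightarrow> x j \<notin> C) \<Longrightarrow> (\<lambda>n. H n x) \<longlonglongrightarrow> L x"
    using conv_in_dist_off_countable[OF ext fin conv] by blast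
  have margin_conv: "(\<lambda>n. margin J (H n) x) \<longlonglongrightarrow> margin J L x"
    if "J \<subseteq> I" "\<And>j. j \<in> J \<Longrightarrow> x j \<notin> C" for J x
    by (rule margin_tendsto_off_countable[OF fin ext_H ext C _ that]) (blast intro: C_conv)+
  \<comment> \<open>A negative level is taken because 0 itself may belong to \<open>C\<close>; all
    \<open>H n\<close> vanish there, and exceedance of 0 implies exceedance of
    \<open>b\<close>.\<close>
  obtain b where b: "b < 0" "b \<notin> C" using ex_avoiding[OF C, of "-1" 0] by auto
  define D where "D = {j\<in>I. \<forall>y. margin1 L j y = 1}"
  define J where "J = I - D"
  have J: "J \<subseteq> I" "finite J" using fin by (auto simp: J_def)
  have D: "I - J = D" by (auto simp: J_def D_def)
  have L_eq: "margin J L = L"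
  proof
    fix x
    have "margin J L x - L x \<le> (\<Sum>j\<in>I - J. 1 - margin1 L j (x j))" by (rule L.margin_diff_le[OF J(1)])
    also have "\<dots> = 0" unfolding D by (auto simp: D_def intro!: sum.neutral)
    finally show "margin J L x = L x" using L.cdf_le_margin[OF J(1), of x] by simp
  qed
  \<comment> \<open>If every component escaped, \<open>L\<close> would be constantly 1, while
    \<open>H n\<close> is 0 at the constant vector \<open>b\<close> for all
    \<open>n\<close>.\<close>
  have "J \<noteq> {}"
  proof
    assume "J = {}"
    have "L x = 1" for x
    proof -
      have "L x = margin {} L x" using L_eq \<open>J = {}\<close> by simp
      also have "\<dots> = 1" by (simp add: L.margin_eq L.prob_space)
      finally show ?thesis .
    qed
    moreover have "H n (\<lambda>_. b) = 0" for n
    proof -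
      interpret gp I "G n" "\<gamma>n n" "\<sigma>n n" "H n" by (rule gp)
      show ?thesis
        using H.cdf_mono[of "\<lambda>_. b" "\<lambda>_. 0"] H.cdf_nonneg[of "\<lambda>_. b"] b H_0[of n] by simp
    qed
    ultimately show False
      using C_conv[of "\<lambda>_. b"] b(2) by (simp add: LIMSEQ_const_iff)
  qed
  define \<beta> where "\<beta> n = margin J (H n) (\<lambda>_. 0)" for n
  have \<beta>: "0 \<le> \<beta> n" "\<beta> n \<le> (\<Sum>j\<in>D. 1 - margin1 (H n) j b)" "\<beta> n < 1"
    "gp_params J (pos_cond (margin J (H n))) (\<gamma>n n) (\<sigma>n n)" for n
  proof -
    interpret gp I "G n" "\<gamma>n n" "\<sigma>n n" "H n" by (rule gp)
    interpret HJ: vec_cdf J "margin J (H n)"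
      using H.ext_cdf_margin[OF J(1)] J(2) by unfold_locales
    show "0 \<le> \<beta> n" unfolding \<beta>_def by (rule HJ.cdf_nonneg)
    \<comment> \<open>As \<open>H n\<close> is 0 at 0, a vector without positive component in
      \<open>J\<close> almost surely has one in \<open>D\<close>.\<close>
    have "\<beta> n \<le> (\<Sum>j\<in>D. 1 - margin1 (H n) j 0)"
      using H.margin_diff_le[OF J(1), of "\<lambda>_. 0"] by (simp add: \<beta>_def D H_0)
    also have "\<dots> \<le> (\<Sum>j\<in>D. 1 - margin1 (H n) j b)"
      using b H.margin1_mono[of _ b 0] by (intro sum_mono) (auto simp: D_def)
    finally show "\<beta> n \<le> (\<Sum>j\<in>D. 1 - margin1 (H n) j b)" .
    obtain j where j: "j \<in> J" using \<open>J \<noteq> {}\<close> by blast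
    have "\<beta> n \<le> margin1 (margin J (H n)) j 0"
      unfolding \<beta>_def using HJ.cdf_le_margin1[OF j, of "\<lambda>_. 0"] by simp
    also have "\<dots> = margin1 (H n) j 0" by (simp add: H.margin1_margin[OF j J(1)])
    also have "\<dots> < 1" using margin1_H_less_1_iff[of j] \<sigma>n[of j n] j J by auto
    finally show "\<beta> n < 1" .
    then have "gp_assoc J (pos_cond (margin J (H n))) (margin J (G n))"
      unfolding \<beta>_def by (rule gp_assoc_pos_cond[OF J(1) \<open>J \<noteq> {}\<close>])
    moreover have "gev_params J (margin J (G n)) (\<gamma>n n) (\<sigma>n n)"
      by (rule gev_params_margin[OF J(1) \<open>J \<noteq> {}\<close>])
    ultimately have "gp J (margin J (G n)) (\<gamma>n n) (\<sigma>n n) (pos_cond (margin J (H n)))"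
      by unfold_locales
    then show "gp_params J (pos_cond (margin J (H n))) (\<gamma>n n) (\<sigma>n n)"
      unfolding gp_params_iff by blast
  qed
  have "(\<lambda>n. \<Sum>j\<in>D. 1 - margin1 (H n) j b) \<longlonglongrightarrow> (\<Sum>j\<in>D. 1 - margin1 L j b)"
  proof (intro tendsto_intros)
    fix j assume "j \<in> D"
    then show "(\<lambda>n. margin1 (H n) j b) \<longlonglongrightarrow> margin1 L j b"
      using margin_conv[of "{j}" "\<lambda>_. b"] b(2) by (simp add: margin1_def D_def)
  qed
  then have sum_lim: "(\<lambda>n. \<Sum>j\<in>D. 1 - margin1 (H n) j b) \<longlonglongrightarrow> 0"
    by (simp add: D_def)
  have \<beta>_lim: "\<beta> \<longlonglongrightarrow> 0"
    by (rule tendsto_sandwich[OF _ _ tendsto_const sum_lim]) (use \<beta> in auto)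
  have "gp_cdf J L"
  proof (rule gp_limit_nondegenerate[OF J(2) \<open>J \<noteq> {}\<close> \<beta>(4) c(1) _ _ C])
    show "c \<le> \<sigma>n n j" if "j \<in> J" for n j using c(2) that J by auto
    show "ext_cdf J L" using L.ext_cdf_margin[OF J(1)] by (simp add: L_eq)
    show "nondegenerate (margin1 L j)" if "j \<in> J" for j
      using margins[of j] that by (auto simp: J_def D_def)
    show "(\<lambda>n. pos_cond (margin J (H n)) x) \<longlonglongrightarrow> L x" if x: "\<And>j. j \<in> J \<Longrightarrow> x j \<notin> C" for x
    proof -
      have "(\<lambda>n. margin J (H n) (\<lambda>j. min (x j) 0)) \<longlonglongrightarrow> 0"
      proof (rule tendsto_sandwich[OF _ _ tendsto_const \<beta>_lim])
        have "0 \<le> margin J (H n) (\<lambda>j. min (x j) 0)" "margin J (H n) (\<lambda>j. min (x j) 0) \<le> \<beta> n" for n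
        proof -
          interpret HJ: vec_cdf J "margin J (H n)"
            using vec_cdf.ext_cdf_margin[OF vec_cdf.intro[OF ext_H fin] J(1)] J(2) by unfold_locales
          show "0 \<le> margin J (H n) (\<lambda>j. min (x j) 0)" by (rule HJ.cdf_nonneg)
          show "margin J (H n) (\<lambda>j. min (x j) 0) \<le> \<beta> n"
            unfolding \<beta>_def by (rule HJ.cdf_mono) simp
        qed
        then show "\<forall>\<^sub>F n in sequentially. 0 \<le> margin J (H n) (\<lambda>j. min (x j) 0)"
          "\<forall>\<^sub>F n in sequentially. margin J (H n) (\<lambda>j. min (x j) 0) \<le> \<beta> n" by auto
      qed
      then have "(\<lambda>n. (margin J (H n) x - margin J (H n) (\<lambda>j. min (x j) 0)) / (1 - \<beta> n)) \<longlonglongrightarrow> (margin J L x - 0) / (1 - 0)"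
        using x by (intro tendsto_intros \<beta>_lim margin_conv[OF J(1)]) auto
      then show ?thesis by (simp add: pos_cond_def \<beta>_def L_eq)
    qed
  qed
  moreover have "gp_cdf (J \<union> B) L" if "finite B" "B \<subseteq> D" for B
    using that
  proof (induction rule: finite_induct)
    case empty
    show ?case using \<open>gp_cdf J L\<close> by simp
  next
    case (insert j B)
    then have IH: "gp_cdf (J \<union> B) L" by auto
    have sub: "insert j (J \<union> B) \<subseteq> I" using insert.prems J by (auto simp: D_def)
    have "margin (insert j (J \<union> B)) L = L"
    proof
      fix x
      have "margin (insert j (J \<union> B)) L x \<le> margin J (margin (insert j (J \<union> B)) L) x"
      proof -
        interpret M: vec_cdf "insert j (J \<union> B)" "margin (insert j (J \<union> B)) L"
          using L.ext_cdf_margin[OF sub] finite_subset[OF sub fin] by unfold_locales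
        show ?thesis by (rule M.cdf_le_margin) auto
      qed
      also have "margin J (margin (insert j (J \<union> B)) L) = L"
        using L.margin_margin[OF _ sub, of J] L_eq by (simp add: subset_insertI2)
      finally show "margin (insert j (J \<union> B)) L x = L x"
        using L.cdf_le_margin[OF sub, of x] by simp
    qed
    then have "ext_cdf (insert j (J \<union> B)) L"
      using L.ext_cdf_margin[OF sub] by simp
    moreover have "j \<notin> J \<union> B" using insert by (auto simp: J_def)
    ultimately show ?case
      using IH gp_assoc_insert[of "J \<union> B" L _ j] unfolding gp_cdf_def by auto
  qed
  from this[of D] have "gp_cdf (J \<union> D) L" using fin by (auto simp: D_def)
  moreover have "J \<union> D = I" by (auto simp: J_def D_def)
  ultimately show ?thesis by simp
qed

theorem theorem1:
  fixes I :: "'i set" and G H :: "('i \<Rightarrow> real) \<Rightarrow> real" and \<gamma> \<mu> \<alpha> \<sigma> :: "'i \<Rightarrow> real"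
  assumes "finite I" and "I \<noteq> {}"
    and "gev_cdf I G" and "gev_margins I G \<gamma> \<mu> \<alpha>"
    and "0 < G (\<lambda>_. 0)" and "G (\<lambda>_. 0) < 1"
    and "gp_assoc I H G"
    and "\<sigma> = (\<lambda>j. \<alpha> j - \<gamma> j * \<mu> j)"
  shows
    "\<comment> \<open>(i)\<close>
     ((\<forall>J. J \<noteq> {} \<and> J \<subseteq> I \<longrightarrow>
         (margin J H (\<lambda>_. 0) < 1 \<longrightarrow> gp_assoc J (pos_cond (margin J H)) (margin J G)) \<and>
         (gp_cdf J (margin J H) \<longleftrightarrow> margin J H (\<lambda>_. 0) = 0)) \<and>
      (\<forall>j\<in>I. 0 < \<sigma> j \<longrightarrow>
         (\<forall>x. 0 \<le> x \<and> 0 < \<sigma> j + \<gamma> j * x \<longrightarrow>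
            pos_cond (margin {j} H) (\<lambda>_. x) = 1 - gp_tail (\<gamma> j) (x / \<sigma> j)))) \<and>
    \<comment> \<open>(ii)\<close>
     (\<forall>s. (\<forall>j\<in>I. 0 < s j) \<longrightarrow> gp_cdf I (\<lambda>x. H (\<lambda>j. x j / s j))) \<and>
    \<comment> \<open>(iii)\<close>
     (\<forall>(P :: 'w measure) X u.
        has_cdf P I X H \<and> (\<forall>j\<in>I. 0 < \<sigma> j) \<and> (\<forall>j\<in>I. 0 \<le> u j) \<and> H u < 1 \<longrightarrow>
        gp_params I
          (\<lambda>x. cond_prob P (\<lambda>\<omega>. \<forall>j\<in>I. X j \<omega> - ereal (u j) \<le> ereal (x j))
                            (\<lambda>\<omega>. \<not> (\<forall>j\<in>I. X j \<omega> \<le> ereal (u j))))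
          \<gamma> (\<lambda>j. \<sigma> j + \<gamma> j * u j)) \<and>
    \<comment> \<open>(iv)\<close>
     (\<forall>Hn \<gamma>n \<sigma>n L.
        (\<forall>n. gp_params I (Hn n) (\<gamma>n n) (\<sigma>n n)) \<and>
        (\<exists>c>0. \<forall>n. \<forall>j\<in>I. c \<le> \<sigma>n n j) \<and>
        ext_cdf I L \<and> conv_in_dist Hn L \<and>
        (\<forall>j\<in>I. nondegenerate (margin1 L j) \<or> (\<forall>y. margin1 L j y = 1)) \<longrightarrow>
        gp_cdf I L) \<and>
    \<comment> \<open>(v)\<close>
     (\<forall>(A :: 'b set) w Hm \<gamma>' \<sigma>'.
        finite A \<and> (\<forall>a\<in>A. 0 \<le> w a) \<and> (\<Sum>a\<in>A. w a) = 1 \<and>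
        (\<forall>a\<in>A. gp_params I (Hm a) \<gamma>' \<sigma>') \<longrightarrow>
        gp_cdf I (\<lambda>x. \<Sum>a\<in>A. w a * Hm a x)) \<and>
     (\<forall>(N :: 'c measure) Hm \<gamma>' \<sigma>'.
        prob_space N \<and> (\<forall>x. (\<lambda>a. Hm a x) \<in> borel_measurable N) \<and>
        (\<forall>a\<in>space N. gp_params I (Hm a) \<gamma>' \<sigma>') \<and> (\<forall>j\<in>I. 0 < \<sigma>' j) \<longrightarrow>
        gp_cdf I (\<lambda>x. \<integral>a. Hm a x \<partial>N)) \<and>
    \<comment> \<open>(vi)\<close>
     ((\<forall>t>0. gp_assoc I H (\<lambda>x. G x powr t)) \<and>
      (\<forall>G'. gp_assoc I H G' \<and> (\<forall>j\<in>I. 0 < \<sigma> j) \<longrightarrow>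
         (\<exists>t>0. \<forall>x. G' x = G x powr t))) \<and>
    \<comment> \<open>(vii)\<close>
     (\<forall>v. G (\<lambda>_. 0) = exp (- v) \<longrightarrow>
        (\<forall>x. (\<forall>j\<in>I. 0 \<le> x j) \<longrightarrow> G x = exp (- v * (1 - H x))) \<and>
        ((\<forall>j\<in>I. 0 < \<sigma> j) \<longrightarrow>
           (\<forall>G'. gev_cdf I G' \<and>
              (\<forall>x. (\<forall>j\<in>I. 0 \<le> x j) \<longrightarrow> G' x = exp (- v * (1 - H x))) \<longrightarrow> G' = G))) \<and>
    \<comment> \<open>(viii)\<close>
     ((\<forall>j\<in>I. 0 < \<sigma> j) \<longrightarrow>
        (let s = (\<lambda>t j. t powr \<gamma> j); u = (\<lambda>t j. \<sigma> j * box_cox (\<gamma> j) t) in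
          (\<forall>j\<in>I. continuous_on {1..} (\<lambda>t. s t j) \<and> (\<forall>t\<ge>1. 0 < s t j) \<and>
                 continuous_on {1..} (\<lambda>t. u t j) \<and> strict_mono_on {1..} (\<lambda>t. u t j) \<and>
                 u 1 j = 0) \<and>
          ((\<lambda>t. H (u t)) \<longlongrightarrow> 1) at_top \<and>
          (\<forall>(P :: 'w measure) X. has_cdf P I X H \<longrightarrow>
             (\<forall>t\<ge>1. \<forall>x.
                cond_prob P
                  (\<lambda>\<omega>. \<forall>j\<in>I. ereal (1 / s t j) * (X j \<omega> - ereal (u t j)) \<le> ereal (x j))
                  (\<lambda>\<omega>. \<not> (\<forall>j\<in>I. X j \<omega> \<le> ereal (u t j))) = H x)))) \<and>
    \<comment> \<open>(ix)\<close>
     (\<forall>\<gamma>' \<sigma>'. gp_params I H \<gamma>' \<sigma>' \<longrightarrow>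
        (\<forall>j\<in>I. (\<exists>y. margin1 H j y < 1) \<longrightarrow> \<gamma>' j = \<gamma> j \<and> \<sigma>' j = \<sigma> j))"
proof -
  have "gev_params I G \<gamma> \<sigma>"
    using assms by (auto simp: gev_params_def)
  then interpret gp I G \<gamma> \<sigma> H
    using assms by unfold_locales
  have minus_le_iff: "z - ereal b \<le> ereal x \<longleftrightarrow> z \<le> ereal (x + b)" for z b x
    by (cases z) (auto simp: algebra_simps)
  show ?thesis
  \<comment> \<open>The goals follow the order of the statement: 1 to 3 belong to (i), 4 to (ii), 5
    to (iii), 6 to (iv), 7 and 8 to (v), 9 and 10 to (vi), 11 and 12 to (vii), 13 to (viii), 14 and
    15 to (ix).\<close>
  proof (intro conjI allI impI ballI, goal_cases)
    case (1 J)
    then show ?case using gp_assoc_pos_cond by blast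
  next
    case (2 J)
    then show ?case using gp_cdf_margin_iff by blast
  next
    case (3 j x)
    then show ?case by (intro pos_cond_margin1) auto
  next
    case (4 s)
    \<comment> \<open>Scaling is the case of threshold 0: \<open>H\<close> vanishes on the
      nonpositive orthant, so conditioning on a positive component does nothing.\<close>
    have "gp_assoc I (\<lambda>x. (H (\<lambda>j. 1 / s j * x j + 0) - H (\<lambda>j. 1 / s j * min (x j) 0 + 0)) / (1 - H (\<lambda>_. 0)))
        (\<lambda>x. G (\<lambda>j. 1 / s j * x j + 0))"
      using 4 gp_cdf_0[OF gp_params_imp_gp_cdf[OF gp_params]] by (intro gp_affine_cond) auto
    moreover have "H (\<lambda>j. 1 / s j * min (x j) 0 + 0) = 0" for x
    proof -
      have "H (\<lambda>j. 1 / s j * min (x j) 0 + 0) \<le> H (\<lambda>_. 0)"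
        using 4 by (intro H.cdf_mono) (auto simp: divide_nonpos_pos)
      then show ?thesis
        using gp_cdf_0[OF gp_params_imp_gp_cdf[OF gp_params]] H.cdf_nonneg[of "\<lambda>j. 1 / s j * min (x j) 0 + 0"] by simp
    qed
    ultimately show ?case
      using gp_cdf_0[OF gp_params_imp_gp_cdf[OF gp_params]] unfolding gp_cdf_def by auto
  next
    case (5 P X u)
    then interpret X: cdf_of P I X H using index by unfold_locales auto
    have u: "\<And>j. j \<in> I \<Longrightarrow> 0 \<le> u j" and less: "H u < 1" using 5 by auto
    have eq: "cond_prob P (\<lambda>\<omega>. \<forall>j\<in>I. X j \<omega> - ereal (u j) \<le> ereal (x j)) (\<lambda>\<omega>. \<not> (\<forall>j\<in>I. X j \<omega> \<le> ereal (u j))) =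
        (H (\<lambda>j. 1 * x j + u j) - H (\<lambda>j. 1 * min (x j) 0 + u j)) / (1 - H u)" for x
      using X.cond_prob_eq[of "\<lambda>j. x j + u j" u] by (simp add: minus_le_iff min_add_distrib_left)
    have "gp I (\<lambda>x. G (\<lambda>j. 1 * x j + u j)) \<gamma> (\<lambda>j. (\<sigma> j + \<gamma> j * u j) / 1)
      (\<lambda>x. (H (\<lambda>j. 1 * x j + u j) - H (\<lambda>j. 1 * min (x j) 0 + u j)) / (1 - H u))"
      using gev_params_affine[of "\<lambda>_. 1" u] gp_affine_cond[of "\<lambda>_. 1" u] u less
      by (auto simp: gp_def gev_def gp_axioms_def)
    then show ?case
      unfolding eq gp_params_iff by auto
  next
    case (6 Hn \<gamma>n \<sigma>n L)
    then obtain c where c: "0 < c" "\<forall>n. \<forall>j\<in>I. c \<le> \<sigma>n n j" by blast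
    show ?case
      by (rule gp_cdf_limit[OF assms(1) _ c(1), of Hn \<gamma>n \<sigma>n]) (use 6 c in auto)
  next
    case (7 A w Hm \<gamma>' \<sigma>')
    then show ?case by (intro gp_cdf_finite_mixture[of A w I Hm \<gamma>' \<sigma>']) auto
  next
    case (8 N Hm \<gamma>' \<sigma>')
    then show ?case by (intro gp_params_imp_gp_cdf[of I _ \<gamma>' \<sigma>'] gp_params_mixture) auto
  next
    case (9 t)
    then show ?case by (rule gp_power)
  next
    case (10 G')
    \<comment> \<open>Comparing \<open>G'\<close> with a power of \<open>G\<close> at 0 leaves only
      this exponent.\<close>
    define t where "t = ln (G' (\<lambda>_. 0)) / ln (G (\<lambda>_. 0))"
    have G': "gp_assoc I H G'" "gev_cdf I G'" and \<sigma>: "\<And>j. j \<in> I \<Longrightarrow> 0 < \<sigma> j"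
      and G'_0: "0 < G' (\<lambda>_. 0)" "G' (\<lambda>_. 0) < 1"
      using 10 by (auto simp: gp_assoc_def)
    have t: "0 < t" using G_0 G'_0 by (simp add: t_def divide_neg_neg)
    interpret Gt: gev I "\<lambda>x. G x powr t" \<gamma> \<sigma>
      using gev_params_power[OF t] by unfold_locales
    have "G' = (\<lambda>x. G x powr t)"
    proof (rule Gt.gev_unique[OF \<sigma> G'(2)])
      fix x :: "'i \<Rightarrow> real" assume x: "\<And>j. j \<in> I \<Longrightarrow> 0 \<le> x j"
      have "G x powr t = exp (t * (ln (G (\<lambda>_. 0)) * (1 - H x)))"
      proof -
        have "G x = exp (ln (G (\<lambda>_. 0)) * (1 - H x))"
          by (rule gp_assoc_nonneg[OF assoc x])
        then show ?thesis by (simp only: powr_def exp_not_eq_zero if_False ln_exp)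
      qed
      also have "t * (ln (G (\<lambda>_. 0)) * (1 - H x)) = ln (G' (\<lambda>_. 0)) * (1 - H x)"
        using G_0 by (simp add: t_def)
      finally show "G' x = G x powr t"
        using gp_assoc_nonneg[OF G'(1) x] by simp
    qed
    with t show ?case by auto
  next
    case (11 v x)
    then show ?case
      using gp_assoc_nonneg[OF assoc, of x] by simp
  next
    case (12 v G')
    show ?case
    proof (rule gev_unique)
      fix x :: "'i \<Rightarrow> real" assume x: "\<And>j. j \<in> I \<Longrightarrow> 0 \<le> x j"
      then show "G' x = G x"
        using 12 gp_assoc_nonneg[OF assoc x] by simp
    qed (use 12 in auto)
  next
    case 13
    then have \<sigma>: "\<And>j. j \<in> I \<Longrightarrow> 0 < \<sigma> j" by blast
    have "continuous_on {1..} (\<lambda>t. box_cox g t)" for g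
    proof (cases "g = 0")
      case True
      then show ?thesis by (auto simp: box_cox_def intro!: continuous_intros)
    next
      case False
      then show ?thesis by (auto simp: box_cox_def intro!: continuous_intros)
    qed
    then have cont: "continuous_on {1..} (\<lambda>t. \<sigma> j * box_cox (\<gamma> j) t)" "continuous_on {1..} (\<lambda>t. t powr \<gamma> j)" for j
      by (auto intro!: continuous_intros)
    have mono: "strict_mono_on {1..} (\<lambda>t. \<sigma> j * box_cox (\<gamma> j) t)" if "j \<in> I" for j
      using \<sigma>[OF that] by (auto simp: strict_mono_on_def intro!: box_cox_strict_mono)
    have lim: "((\<lambda>t. H (\<lambda>j. \<sigma> j * box_cox (\<gamma> j) t)) \<longlongrightarrow> 1) at_top"
    proof (rule Lim_transform_eventually)
      have "((\<lambda>t::real. 1 - inverse t) \<longlongrightarrow> 1 - 0) at_top"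
        by (intro tendsto_intros tendsto_inverse_0_at_top filterlim_ident)
      then show "((\<lambda>t::real. 1 - 1 / t) \<longlongrightarrow> 1) at_top" by (simp add: inverse_eq_divide)
      show "\<forall>\<^sub>F t in at_top. 1 - 1 / t = H (\<lambda>j. \<sigma> j * box_cox (\<gamma> j) t)"
        using eventually_ge_at_top[of 1]
      proof eventually_elim
        case (elim t)
        then show ?case using H_flow_0[OF elim \<sigma>] by (simp add: flow_0)
      qed
    qed
    show ?case
      unfolding Let_def using cont mono lim cond_prob_threshold \<sigma> by auto
  next
    case (14 \<gamma>' \<sigma>' j)
    then obtain G' where "gp I G' \<gamma>' \<sigma>' H" unfolding gp_params_iff by blast
    then show ?case using gp_params_unique[OF gp_axioms _ 14(2)] 14(3) by blast
  next
    case (15 \<gamma>' \<sigma>' j)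
    then obtain G' where "gp I G' \<gamma>' \<sigma>' H" unfolding gp_params_iff by blast
    then show ?case using gp_params_unique[OF gp_axioms _ 15(2)] 15(3) by blast
  qed
qed

end
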